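(* Let $(\Omega,\rightarrow)$ be a finite semigroup and let $V$ be a vector space. The free $(\mathbf{As}_\Omega^2)^!$-algebra generated by $V$ is $$T_\Omega^2(V)=V\oplus\bigoplus_{n=2}^\infty(\mathbb{K}\Omega\otimes V)^{\otimes n},$$ with the products $*_{\alpha,\beta}$ ($\alpha,\beta\in\Omega$) given as follows: for any $u,v\in V$, any $\alpha_1u_1,\ldots,\alpha_ku_k,\beta_1v_1,\ldots,\beta_lv_l\in\mathbb{K}\Omega\otimes V$ with $\alpha_i,\beta_j\in\Omega$, $u_i,v_j\in V$ and $k,l\geqslant 2$, \begin{align*} u*_{\alpha,\beta}v&=\alpha u\,\beta v,\\ \alpha_1u_1\ldots\alpha_ku_k*_{\alpha,\beta}v&=\delta_{\alpha,\alpha_1\rightarrow\cdots\rightarrow\alpha_k}\,\alpha_1u_1\ldots\alpha_ku_k\,\beta v,\\ u*_{\alpha,\beta}\beta_1v_1\ldots\beta_lv_l&=\delta_{\beta,\beta_1\rightarrow\cdots\rightarrow\beta_l}\,\alpha u\,\beta_1v_1\ldots\beta_lv_l,\\ \alpha_1u_1\ldots\alpha_ku_k*_{\alpha,\beta}\beta_1v_1\ldots\beta_lv_l&=\delta_{\alpha,\alpha_1\rightarrow\cdots\rightarrow\alpha_k}\delta_{\beta,\beta_1\rightarrow\cdots\rightarrow\beta_l}\,\alpha_1u_1\ldots\alpha_ku_k\,\beta_1v_1\ldots\beta_lv_l. \end{align*}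
   Context: $\mathbb{K}$ is a commutative field, $\delta$ is the Kronecker symbol, $\mathbb{K}\Omega$ is the vector space with basis $\Omega$, and $\alpha u$ denotes $\alpha\otimes u\in\mathbb{K}\Omega\otimes V$. $(\mathbf{As}_\Omega^2)^!$ is the Koszul dual of the nonsymmetric operad $\mathbf{As}_\Omega^2$ generated by binary operations $*_{\alpha,\beta}$, $(\alpha,\beta)\in\Omega^2$, with the relations $*_{\alpha\rightarrow\beta,\gamma}\circ_1 *_{\alpha,\beta}=*_{\alpha,\beta\rightarrow\gamma}\circ_2 *_{\beta,\gamma}$. Explicitly, an $(\mathbf{As}_\Omega^2)^!$-algebra is a vector space $W$ with bilinear products $*_{\alpha,\beta}$, $\alpha,\beta\in\Omega$, such that for all $x,y,z\in W$ and $\alpha,\beta,\gamma,\delta\in\Omega$: $(x*_{\alpha,\beta}y)*_{\alpha\rightarrow\beta,\gamma}z=x*_{\alpha,\beta\rightarrow\gamma}(y*_{\beta,\gamma}z)$; $(x*_{\alpha,\beta}y)*_{\gamma,\delta}z=0$ if $\alpha\rightarrow\beta\neq\gamma$; $x*_{\alpha,\beta}(y*_{\gamma,\delta}z)=0$ if $\beta\neq\gamma\rightarrow\delta$. *)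

theory Defs
  imports "HOL-Algebra.Module" "HOL-Algebra.AbelCoset"
begin

text \<open>
  A vector space over a field \<open>K\<close> is a structure \<open>V\<close> with \<open>module K V\<close>.  The record type of
  modules extends that of rings, so it has fields for a multiplication and a unit; the locale
  \<^locale>\<open>module\<close> does not constrain them, and they are left unspecified below.
\<close>

definition linear_map ::
    "('k, 'c) ring_scheme \<Rightarrow> ('k, 'v, 'm) module_scheme \<Rightarrow> ('k, 'w, 'n) module_scheme
      \<Rightarrow> ('v \<Rightarrow> 'w) \<Rightarrow> bool" where
  "linear_map K V W f \<longleftrightarrow>
     f \<in> carrier V \<rightarrow> carrier W \<and>
     (\<forall>x\<in>carrier V. \<forall>y\<in>carrier V. f (x \<oplus>\<^bsub>V\<^esub> y) = f x \<oplus>\<^bsub>W\<^esub> f y) \<and>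
     (\<forall>a\<in>carrier K. \<forall>x\<in>carrier V. f (a \<odot>\<^bsub>V\<^esub> x) = a \<odot>\<^bsub>W\<^esub> f x)"

definition bilinear_product ::
    "('k, 'c) ring_scheme \<Rightarrow> ('k, 'w, 'n) module_scheme \<Rightarrow> ('w \<Rightarrow> 'w \<Rightarrow> 'w) \<Rightarrow> bool" where
  "bilinear_product K W p \<longleftrightarrow>
     (\<forall>x\<in>carrier W. linear_map K W W (\<lambda>y. p x y)) \<and>
     (\<forall>y\<in>carrier W. linear_map K W W (\<lambda>x. p x y))"


subsection \<open>Vector spaces with a given basis, quotients, direct sums\<close>

definition free_module :: "('k, 'c) ring_scheme \<Rightarrow> 'x set \<Rightarrow> ('k, 'x \<Rightarrow> 'k) module" where
  "free_module K X =
     \<lparr>carrier = {f. f \<in> X \<rightarrow> carrier K \<and> (\<forall>x. x \<notin> X \<longrightarrow> f x = \<zero>\<^bsub>K\<^esub>) \<and> finite {x. f x \<noteq> \<zero>\<^bsub>K\<^esub>}},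
      mult = undefined, one = undefined,
      zero = (\<lambda>x. \<zero>\<^bsub>K\<^esub>), add = (\<lambda>f g x. f x \<oplus>\<^bsub>K\<^esub> g x), smult = (\<lambda>a f x. a \<otimes>\<^bsub>K\<^esub> f x)\<rparr>"

definition basis_vec :: "('k, 'c) ring_scheme \<Rightarrow> 'x \<Rightarrow> 'x \<Rightarrow> 'k" where
  "basis_vec K x = (\<lambda>y. if y = x then \<one>\<^bsub>K\<^esub> else \<zero>\<^bsub>K\<^esub>)"

definition module_span ::
    "('k, 'c) ring_scheme \<Rightarrow> ('k, 'v, 'm) module_scheme \<Rightarrow> 'v set \<Rightarrow> 'v set" where
  "module_span K V S = \<Inter>{U. submodule U K V \<and> S \<subseteq> U}"

definition quotient_module :: "('k, 'v, 'm) module_scheme \<Rightarrow> 'v set \<Rightarrow> ('k, 'v set) module" where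
  "quotient_module V U =
     \<lparr>carrier = a_rcosets\<^bsub>V\<^esub> U, mult = undefined, one = undefined,
      zero = U, add = set_add V, smult = (\<lambda>a C. \<Union>x\<in>C. U +>\<^bsub>V\<^esub> (a \<odot>\<^bsub>V\<^esub> x))\<rparr>"

definition direct_sum ::
    "('k, 'v, 'm) module_scheme \<Rightarrow> ('k, 'w, 'n) module_scheme \<Rightarrow> ('k, 'v \<times> 'w) module" where
  "direct_sum V W =
     \<lparr>carrier = carrier V \<times> carrier W, mult = undefined, one = undefined,
      zero = (\<zero>\<^bsub>V\<^esub>, \<zero>\<^bsub>W\<^esub>),
      add = (\<lambda>x y. (fst x \<oplus>\<^bsub>V\<^esub> fst y, snd x \<oplus>\<^bsub>W\<^esub> snd y)),
      smult = (\<lambda>a x. (a \<odot>\<^bsub>V\<^esub> fst x, a \<odot>\<^bsub>W\<^esub> snd x))\<rparr>"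

definition direct_sum_family ::
    "'i set \<Rightarrow> ('i \<Rightarrow> ('k, 'v, 'm) module_scheme) \<Rightarrow> ('k, 'i \<Rightarrow> 'v) module" where
  "direct_sum_family I V =
     \<lparr>carrier = {f \<in> \<Pi>\<^sub>E i\<in>I. carrier (V i). finite {i \<in> I. f i \<noteq> \<zero>\<^bsub>V i\<^esub>}},
      mult = undefined, one = undefined,
      zero = (\<lambda>i\<in>I. \<zero>\<^bsub>V i\<^esub>), add = (\<lambda>f g. \<lambda>i\<in>I. f i \<oplus>\<^bsub>V i\<^esub> g i),
      smult = (\<lambda>a f. \<lambda>i\<in>I. a \<odot>\<^bsub>V i\<^esub> f i)\<rparr>"


subsection \<open>Tensor products and tensor powers\<close>

definition tensor_null ::
    "('k, 'c) ring_scheme \<Rightarrow> ('k, 'v, 'm) module_scheme \<Rightarrow> ('k, 'w, 'n) module_scheme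
      \<Rightarrow> ('v \<times> 'w \<Rightarrow> 'k) set" where
  "tensor_null K V W =
    (let F = free_module K (carrier V \<times> carrier W); e = (\<lambda>x y. basis_vec K (x, y)) in
     module_span K F
      ({e (x \<oplus>\<^bsub>V\<^esub> x') y \<ominus>\<^bsub>F\<^esub> (e x y \<oplus>\<^bsub>F\<^esub> e x' y) | x x' y.
          x \<in> carrier V \<and> x' \<in> carrier V \<and> y \<in> carrier W} \<union>
       {e x (y \<oplus>\<^bsub>W\<^esub> y') \<ominus>\<^bsub>F\<^esub> (e x y \<oplus>\<^bsub>F\<^esub> e x y') | x y y'.
          x \<in> carrier V \<and> y \<in> carrier W \<and> y' \<in> carrier W} \<union>
       {e (a \<odot>\<^bsub>V\<^esub> x) y \<ominus>\<^bsub>F\<^esub> (a \<odot>\<^bsub>F\<^esub> e x y) | a x y.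
          a \<in> carrier K \<and> x \<in> carrier V \<and> y \<in> carrier W} \<union>
       {e x (a \<odot>\<^bsub>W\<^esub> y) \<ominus>\<^bsub>F\<^esub> (a \<odot>\<^bsub>F\<^esub> e x y) | a x y.
          a \<in> carrier K \<and> x \<in> carrier V \<and> y \<in> carrier W}))"

definition tensor ::
    "('k, 'c) ring_scheme \<Rightarrow> ('k, 'v, 'm) module_scheme \<Rightarrow> ('k, 'w, 'n) module_scheme
      \<Rightarrow> ('k, ('v \<times> 'w \<Rightarrow> 'k) set) module" where
  "tensor K V W =
     quotient_module (free_module K (carrier V \<times> carrier W)) (tensor_null K V W)"

definition pure_tensor ::
    "('k, 'c) ring_scheme \<Rightarrow> ('k, 'v, 'm) module_scheme \<Rightarrow> ('k, 'w, 'n) module_scheme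
      \<Rightarrow> 'v \<Rightarrow> 'w \<Rightarrow> ('v \<times> 'w \<Rightarrow> 'k) set" where
  "pure_tensor K V W x y =
     tensor_null K V W +>\<^bsub>free_module K (carrier V \<times> carrier W)\<^esub> basis_vec K (x, y)"

definition tuples :: "('k, 'v, 'm) module_scheme \<Rightarrow> nat \<Rightarrow> 'v list set" where
  "tuples V n = {xs. set xs \<subseteq> carrier V \<and> length xs = n}"

definition tensor_power_null ::
    "('k, 'c) ring_scheme \<Rightarrow> ('k, 'v, 'm) module_scheme \<Rightarrow> nat \<Rightarrow> ('v list \<Rightarrow> 'k) set" where
  "tensor_power_null K V n =
    (let F = free_module K (tuples V n); e = basis_vec K in
     module_span K F
      ({e (xs @ (x \<oplus>\<^bsub>V\<^esub> x') # ys) \<ominus>\<^bsub>F\<^esub> (e (xs @ x # ys) \<oplus>\<^bsub>F\<^esub> e (xs @ x' # ys)) | xs x x' ys.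
          xs @ x # ys \<in> tuples V n \<and> x' \<in> carrier V} \<union>
       {e (xs @ (a \<odot>\<^bsub>V\<^esub> x) # ys) \<ominus>\<^bsub>F\<^esub> (a \<odot>\<^bsub>F\<^esub> e (xs @ x # ys)) | a xs x ys.
          a \<in> carrier K \<and> xs @ x # ys \<in> tuples V n}))"

definition tensor_power ::
    "('k, 'c) ring_scheme \<Rightarrow> ('k, 'v, 'm) module_scheme \<Rightarrow> nat
      \<Rightarrow> ('k, ('v list \<Rightarrow> 'k) set) module" where
  "tensor_power K V n = quotient_module (free_module K (tuples V n)) (tensor_power_null K V n)"

definition pure_tensor_list ::
    "('k, 'c) ring_scheme \<Rightarrow> ('k, 'v, 'm) module_scheme \<Rightarrow> 'v list \<Rightarrow> ('v list \<Rightarrow> 'k) set" where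
  "pure_tensor_list K V xs =
     tensor_power_null K V (length xs) +>\<^bsub>free_module K (tuples V (length xs))\<^esub> basis_vec K xs"


subsection \<open>Algebras over the Koszul dual of \<open>As\<^sub>\<Omega>\<^sup>2\<close>\<close>

text \<open>The semigroup \<open>\<Omega>\<close> is the whole type \<open>'o\<close>, with operation \<open>ar\<close>.\<close>

definition As2_dual_algebra ::
    "('k, 'c) ring_scheme \<Rightarrow> ('o \<Rightarrow> 'o \<Rightarrow> 'o) \<Rightarrow> ('k, 'w, 'n) module_scheme
      \<Rightarrow> ('o \<Rightarrow> 'o \<Rightarrow> 'w \<Rightarrow> 'w \<Rightarrow> 'w) \<Rightarrow> bool" where
  "As2_dual_algebra K ar W p \<longleftrightarrow>
     module K W \<and>
     (\<forall>\<alpha> \<beta>. bilinear_product K W (p \<alpha> \<beta>)) \<and>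
     (\<forall>\<alpha> \<beta> \<gamma>. \<forall>x\<in>carrier W. \<forall>y\<in>carrier W. \<forall>z\<in>carrier W.
        p (ar \<alpha> \<beta>) \<gamma> (p \<alpha> \<beta> x y) z = p \<alpha> (ar \<beta> \<gamma>) x (p \<beta> \<gamma> y z)) \<and>
     (\<forall>\<alpha> \<beta> \<gamma> \<delta>. \<forall>x\<in>carrier W. \<forall>y\<in>carrier W. \<forall>z\<in>carrier W.
        ar \<alpha> \<beta> \<noteq> \<gamma> \<longrightarrow> p \<gamma> \<delta> (p \<alpha> \<beta> x y) z = \<zero>\<^bsub>W\<^esub>) \<and>
     (\<forall>\<alpha> \<beta> \<gamma> \<delta>. \<forall>x\<in>carrier W. \<forall>y\<in>carrier W. \<forall>z\<in>carrier W.
        \<beta> \<noteq> ar \<gamma> \<delta> \<longrightarrow> p \<alpha> \<beta> x (p \<gamma> \<delta> y z) = \<zero>\<^bsub>W\<^esub>)"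

definition As2_dual_hom ::
    "('k, 'c) ring_scheme \<Rightarrow> ('k, 'v, 'm) module_scheme \<Rightarrow> ('o \<Rightarrow> 'o \<Rightarrow> 'v \<Rightarrow> 'v \<Rightarrow> 'v)
      \<Rightarrow> ('k, 'w, 'n) module_scheme \<Rightarrow> ('o \<Rightarrow> 'o \<Rightarrow> 'w \<Rightarrow> 'w \<Rightarrow> 'w) \<Rightarrow> ('v \<Rightarrow> 'w) \<Rightarrow> bool" where
  "As2_dual_hom K V p W q f \<longleftrightarrow>
     linear_map K V W f \<and>
     (\<forall>\<alpha> \<beta>. \<forall>x\<in>carrier V. \<forall>y\<in>carrier V. f (p \<alpha> \<beta> x y) = q \<alpha> \<beta> (f x) (f y))"

text \<open>
  \<open>(A, p)\<close> with \<open>\<iota> : V \<rightarrow> A\<close> is free on \<open>V\<close>.  HOL cannot quantify over all types inside a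
  definition, so the type \<open>'w\<close> of the elements of the test algebras \<open>W\<close> is a parameter; a
  theorem about \<open>TYPE('w)\<close> with \<open>'w\<close> a type variable covers all test algebras.  Morphisms are
  determined on \<open>carrier A\<close> only, hence the restriction to extensional functions.
\<close>
definition free_As2_dual_algebra ::
    "'w itself \<Rightarrow> ('k, 'c) ring_scheme \<Rightarrow> ('o \<Rightarrow> 'o \<Rightarrow> 'o) \<Rightarrow> ('k, 'v, 'm) module_scheme
      \<Rightarrow> ('k, 'a, 'n) module_scheme \<Rightarrow> ('o \<Rightarrow> 'o \<Rightarrow> 'a \<Rightarrow> 'a \<Rightarrow> 'a) \<Rightarrow> ('v \<Rightarrow> 'a) \<Rightarrow> bool" where
  "free_As2_dual_algebra (_ :: 'w itself) K ar V A p \<iota> \<longleftrightarrow>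
     As2_dual_algebra K ar A p \<and> linear_map K V A \<iota> \<and>
     (\<forall>(W :: ('k, 'w) module) q f.
        As2_dual_algebra K ar W q \<and> linear_map K V W f \<longrightarrow>
        (\<exists>!F. F \<in> extensional (carrier A) \<and> As2_dual_hom K A p W q F \<and>
              (\<forall>v\<in>carrier V. F (\<iota> v) = f v)))"


subsection \<open>The space \<open>T\<^sub>\<Omega>\<^sup>2(V)\<close> and its products\<close>

text \<open>The spaces \<open>K\<Omega>\<close> and \<open>K\<Omega> \<otimes> V\<close>, and the element \<open>\<alpha>u = \<alpha> \<otimes> u\<close> of the latter.\<close>

definition KOmega :: "('k, 'c) ring_scheme \<Rightarrow> ('k, 'o \<Rightarrow> 'k) module" where
  "KOmega K = free_module K (UNIV :: 'o set)"

definition letter_space ::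
    "('k, 'c) ring_scheme \<Rightarrow> ('k, 'v, 'm) module_scheme
      \<Rightarrow> ('k, (('o \<Rightarrow> 'k) \<times> 'v \<Rightarrow> 'k) set) module" where
  "letter_space K V = tensor K (KOmega K) V"

definition letter ::
    "('k, 'c) ring_scheme \<Rightarrow> ('k, 'v, 'm) module_scheme
      \<Rightarrow> 'o \<times> 'v \<Rightarrow> (('o \<Rightarrow> 'k) \<times> 'v \<Rightarrow> 'k) set" where
  "letter K V = (\<lambda>(\<alpha>, u). pure_tensor K (KOmega K) V (basis_vec K \<alpha>) u)"

type_synonym ('k, 'o, 'v) T2_elem =
  "'v \<times> (nat \<Rightarrow> ((('o \<Rightarrow> 'k) \<times> 'v \<Rightarrow> 'k) set list \<Rightarrow> 'k) set)"

definition T2_words ::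
    "('k, 'c) ring_scheme \<Rightarrow> ('k, 'v, 'm) module_scheme
      \<Rightarrow> ('k, nat \<Rightarrow> ((('o \<Rightarrow> 'k) \<times> 'v \<Rightarrow> 'k) set list \<Rightarrow> 'k) set) module" where
  "T2_words K V = direct_sum_family {2..} (tensor_power K (letter_space K V))"

definition T2 ::
    "('k, 'c) ring_scheme \<Rightarrow> ('k, 'v, 'm) module_scheme \<Rightarrow> ('k, ('k, 'o, 'v) T2_elem) module" where
  "T2 K V = direct_sum V (T2_words K V)"

definition T2_incl ::
    "('k, 'c) ring_scheme \<Rightarrow> ('k, 'v, 'm) module_scheme \<Rightarrow> 'v \<Rightarrow> ('k, 'o, 'v) T2_elem" where
  "T2_incl K V v = (v, \<zero>\<^bsub>T2_words K V\<^esub>)"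

text \<open>The word \<open>\<alpha>\<^sub>1u\<^sub>1\<dots>\<alpha>\<^sub>ku\<^sub>k\<close>, given as a list of pairs of length \<open>k \<ge> 2\<close>, in the summand of degree \<open>k\<close>.\<close>
definition T2_word ::
    "('k, 'c) ring_scheme \<Rightarrow> ('k, 'v, 'm) module_scheme \<Rightarrow> ('o \<times> 'v) list
      \<Rightarrow> ('k, 'o, 'v) T2_elem" where
  "T2_word K V ps =
     (\<zero>\<^bsub>V\<^esub>, \<zero>\<^bsub>T2_words K V\<^esub>(length ps := pure_tensor_list K (letter_space K V) (map (letter K V) ps)))"

text \<open>The product \<open>\<alpha>\<^sub>1 \<rightarrow> \<dots> \<rightarrow> \<alpha>\<^sub>k\<close> of a nonempty word.\<close>
definition word_arrow :: "('o \<Rightarrow> 'o \<Rightarrow> 'o) \<Rightarrow> ('o \<times> 'v) list \<Rightarrow> 'o" where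
  "word_arrow ar ps = foldl ar (fst (hd ps)) (map fst (tl ps))"

definition long_words :: "('k, 'v, 'm) module_scheme \<Rightarrow> ('o \<times> 'v) list set" where
  "long_words V = {ps. length ps \<ge> 2 \<and> snd ` set ps \<subseteq> carrier V}"

definition kronecker :: "('k, 'c) ring_scheme \<Rightarrow> 'o \<Rightarrow> 'o \<Rightarrow> 'k" where
  "kronecker K \<alpha> \<beta> = (if \<alpha> = \<beta> then \<one>\<^bsub>K\<^esub> else \<zero>\<^bsub>K\<^esub>)"

definition T2_products ::
    "('k, 'c) ring_scheme \<Rightarrow> ('o \<Rightarrow> 'o \<Rightarrow> 'o) \<Rightarrow> ('k, 'v, 'm) module_scheme
      \<Rightarrow> ('o \<Rightarrow> 'o \<Rightarrow> ('k, 'o, 'v) T2_elem \<Rightarrow> ('k, 'o, 'v) T2_elem \<Rightarrow> ('k, 'o, 'v) T2_elem)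
      \<Rightarrow> bool" where
  "T2_products K ar V p \<longleftrightarrow>
     (\<forall>\<alpha> \<beta>. bilinear_product K (T2 K V) (p \<alpha> \<beta>)) \<and>
     (\<forall>\<alpha> \<beta>. \<forall>u\<in>carrier V. \<forall>v\<in>carrier V.
        p \<alpha> \<beta> (T2_incl K V u) (T2_incl K V v) = T2_word K V [(\<alpha>, u), (\<beta>, v)]) \<and>
     (\<forall>\<alpha> \<beta>. \<forall>ps\<in>long_words V. \<forall>v\<in>carrier V.
        p \<alpha> \<beta> (T2_word K V ps) (T2_incl K V v) =
          kronecker K \<alpha> (word_arrow ar ps) \<odot>\<^bsub>T2 K V\<^esub> T2_word K V (ps @ [(\<beta>, v)])) \<and>
     (\<forall>\<alpha> \<beta>. \<forall>u\<in>carrier V. \<forall>qs\<in>long_words V.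
        p \<alpha> \<beta> (T2_incl K V u) (T2_word K V qs) =
          kronecker K \<beta> (word_arrow ar qs) \<odot>\<^bsub>T2 K V\<^esub> T2_word K V ((\<alpha>, u) # qs)) \<and>
     (\<forall>\<alpha> \<beta>. \<forall>ps\<in>long_words V. \<forall>qs\<in>long_words V.
        p \<alpha> \<beta> (T2_word K V ps) (T2_word K V qs) =
          (kronecker K \<alpha> (word_arrow ar ps) \<otimes>\<^bsub>K\<^esub> kronecker K \<beta> (word_arrow ar qs))
            \<odot>\<^bsub>T2 K V\<^esub> T2_word K V (ps @ qs))"

end

theory Submission
  imports Defs
begin

text \<open>
  Call a list of pairs \<open>(\<alpha>, u)\<close> a word.  Vectors of \<open>V\<close> (seen as one-letter words whose label does
  not matter) and words of length at least two generate \<open>T\<^sub>\<Omega>\<^sup>2(V)\<close>, and every function on words that is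
  linear in each vector and ignores the label of one-letter words extends to a linear map.
  Consequently the products exist and are unique, and an identity between them has only to be checked on
  words, where, after relabelling one-letter words by the index of the product, the product of two
  words is their concatenation or zero.  A homomorphism to an algebra \<open>W\<close> extending \<open>f : V \<rightarrow> W\<close> must
  send \<open>\<alpha>\<^sub>1u\<^sub>1\<dots>\<alpha>\<^sub>ku\<^sub>k\<close> to the iterated product \<open>f u\<^sub>1 * (f u\<^sub>2 * (\<dots> * f u\<^sub>k))\<close> with the indices forced by
  the word, and this assignment is multilinear and multiplicative because of the relations of \<open>W\<close>.
\<close>

text \<open>The relations of a dual algebra explain the shape of the space. An element
  \<open>q \<gamma> \<delta> x y\<close> can be multiplied further without giving zero only at the
  index \<open>ar \<gamma> \<delta>\<close>, on either side, so a word of length at least two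
  carries its own index. The carriers are nested quotients of spaces of finitely supported
  functions, and computing with their elements would be hopeless. Each layer (free module, quotient,
  tensor product, tensor power, direct sum) is therefore reduced to two facts: a generating set, and
  a lifting property for functions given on it. The delicate layer is the one of tensor powers of
  \<open>letter_space K V\<close>, since a general element of the letter space has no label, while
  all formulas are stated by labels.\<close>

lemma linear_mapD:
  assumes "linear_map K V W f"
  shows "x \<in> carrier V \<Longrightarrow> f x \<in> carrier W"
    and "x \<in> carrier V \<Longrightarrow> y \<in> carrier V \<Longrightarrow> f (x \<oplus>\<^bsub>V\<^esub> y) = f x \<oplus>\<^bsub>W\<^esub> f y"
    and "a \<in> carrier K \<Longrightarrow> x \<in> carrier V \<Longrightarrow> f (a \<odot>\<^bsub>V\<^esub> x) = a \<odot>\<^bsub>W\<^esub> f x"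
  using assms by (auto simp: linear_map_def)

lemma linear_mapI:
  assumes "\<And>x. x \<in> carrier V \<Longrightarrow> f x \<in> carrier W"
    and "\<And>x y. x \<in> carrier V \<Longrightarrow> y \<in> carrier V \<Longrightarrow> f (x \<oplus>\<^bsub>V\<^esub> y) = f x \<oplus>\<^bsub>W\<^esub> f y"
    and "\<And>a x. a \<in> carrier K \<Longrightarrow> x \<in> carrier V \<Longrightarrow> f (a \<odot>\<^bsub>V\<^esub> x) = a \<odot>\<^bsub>W\<^esub> f x"
  shows "linear_map K V W f"
  using assms by (auto simp: linear_map_def)

lemma linear_map_zero:
  assumes "module K V" "module K W" "linear_map K V W f"
  shows "f \<zero>\<^bsub>V\<^esub> = \<zero>\<^bsub>W\<^esub>"
proof -
  interpret V: module K V by fact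
  interpret W: module K W by fact
  have "f (\<zero>\<^bsub>K\<^esub> \<odot>\<^bsub>V\<^esub> \<zero>\<^bsub>V\<^esub>) = \<zero>\<^bsub>K\<^esub> \<odot>\<^bsub>W\<^esub> f \<zero>\<^bsub>V\<^esub>"
    using linear_mapD(3)[OF assms(3), of "\<zero>\<^bsub>K\<^esub>" "\<zero>\<^bsub>V\<^esub>"] by simp
  then show ?thesis using linear_mapD(1)[OF assms(3)] by simp
qed

lemma linear_map_minus:
  assumes "module K V" "module K W" "linear_map K V W f" "x \<in> carrier V" "y \<in> carrier V"
  shows "f (x \<ominus>\<^bsub>V\<^esub> y) = f x \<ominus>\<^bsub>W\<^esub> f y"
proof -
  interpret V: module K V by fact
  interpret W: module K W by fact
  note f = linear_mapD[OF assms(3)]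
  have m: "\<ominus>\<^bsub>K\<^esub> \<one>\<^bsub>K\<^esub> \<in> carrier K" by simp
  have "\<ominus>\<^bsub>V\<^esub> y = (\<ominus>\<^bsub>K\<^esub> \<one>\<^bsub>K\<^esub>) \<odot>\<^bsub>V\<^esub> y" using V.smult_l_minus[of "\<one>\<^bsub>K\<^esub>" y] assms by simp
  moreover have "\<ominus>\<^bsub>W\<^esub> f y = (\<ominus>\<^bsub>K\<^esub> \<one>\<^bsub>K\<^esub>) \<odot>\<^bsub>W\<^esub> f y"
    using W.smult_l_minus[of "\<one>\<^bsub>K\<^esub>" "f y"] assms f by simp
  ultimately show ?thesis
    using f assms m by (simp add: a_minus_def)
qed

lemma linear_map_comp:
  assumes "linear_map K U V f" "linear_map K V W g"
  shows "linear_map K U W (\<lambda>x. g (f x))"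
  using assms by (auto simp: linear_map_def Pi_def)

lemma linear_map_zero_map: "module K V \<Longrightarrow> module K W \<Longrightarrow> linear_map K V W (\<lambda>x. \<zero>\<^bsub>W\<^esub>)"
proof (rule linear_mapI)
  assume "module K V" "module K W"
  then interpret W: module K W by simp
  show "\<zero>\<^bsub>W\<^esub> \<in> carrier W" "\<zero>\<^bsub>W\<^esub> = \<zero>\<^bsub>W\<^esub> \<oplus>\<^bsub>W\<^esub> \<zero>\<^bsub>W\<^esub>" by auto
  fix a assume "a \<in> carrier K" then show "\<zero>\<^bsub>W\<^esub> = a \<odot>\<^bsub>W\<^esub> \<zero>\<^bsub>W\<^esub>" by simp
qed

lemma linear_map_smult:
  assumes "module K V" "module K W" "linear_map K V W f" "c \<in> carrier K"
  shows "linear_map K V W (\<lambda>x. c \<odot>\<^bsub>W\<^esub> f x)"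
proof -
  interpret V: module K V by fact
  interpret W: module K W by fact
  note f = linear_mapD[OF assms(3)]
  show ?thesis
  proof (rule linear_mapI)
    fix a x assume a: "a \<in> carrier K" and x: "x \<in> carrier V"
    have "c \<odot>\<^bsub>W\<^esub> (a \<odot>\<^bsub>W\<^esub> f x) = a \<odot>\<^bsub>W\<^esub> (c \<odot>\<^bsub>W\<^esub> f x)"
      using f(1)[OF x] a assms(4) by (metis W.smult_assoc1 V.R.m_comm)
    then show "c \<odot>\<^bsub>W\<^esub> f (a \<odot>\<^bsub>V\<^esub> x) = a \<odot>\<^bsub>W\<^esub> (c \<odot>\<^bsub>W\<^esub> f x)" using f(3)[OF a x] by simp
  qed (use f assms(4) in \<open>auto simp: W.smult_r_distr\<close>)
qed

lemma linear_map_add: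
  assumes "module K V" "module K W" "linear_map K V W f" "linear_map K V W g"
  shows "linear_map K V W (\<lambda>x. f x \<oplus>\<^bsub>W\<^esub> g x)"
proof -
  interpret V: module K V by fact
  interpret W: module K W by fact
  note f = linear_mapD[OF assms(3)]
  note g = linear_mapD[OF assms(4)]
  show ?thesis
    by (rule linear_mapI) (use f g in \<open>auto simp: W.smult_r_distr W.a_ac\<close>)
qed

lemma linear_map_if:
  "linear_map K V W f \<Longrightarrow> linear_map K V W g \<Longrightarrow> linear_map K V W (\<lambda>x. if c then f x else g x)"
  by (cases c) simp_all

section \<open>Submodules, spans and generating sets\<close>

text \<open>Negation is multiplication by the scalar minus one, so closure under additive inverses
  comes from closure under scalars.\<close>

lemma submoduleI_closed:
  assumes "module K M" "H \<subseteq> carrier M" "\<zero>\<^bsub>M\<^esub> \<in> H"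
    and "\<And>a b. \<lbrakk>a \<in> H ; b \<in> H\<rbrakk> \<Longrightarrow> a \<oplus>\<^bsub>M\<^esub> b \<in> H"
    and "\<And>a x. \<lbrakk>a \<in> carrier K; x \<in> H\<rbrakk> \<Longrightarrow> a \<odot>\<^bsub>M\<^esub> x \<in> H"
  shows "submodule H K M"
proof -
  interpret M: module K M by fact
  show ?thesis
  proof (rule M.submoduleI)
    fix a assume a: "a \<in> H"
    then have "\<ominus>\<^bsub>M\<^esub> a = (\<ominus>\<^bsub>K\<^esub> \<one>\<^bsub>K\<^esub>) \<odot>\<^bsub>M\<^esub> a"
      using M.smult_l_minus[of "\<one>\<^bsub>K\<^esub>" a] assms(2) by auto
    then show "\<ominus>\<^bsub>M\<^esub> a \<in> H" using assms(5)[OF _ a, of "\<ominus>\<^bsub>K\<^esub> \<one>\<^bsub>K\<^esub>"] by simp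
  qed (use assms in auto)
qed

lemma submodule_zero: "module K M \<Longrightarrow> submodule H K M \<Longrightarrow> \<zero>\<^bsub>M\<^esub> \<in> H"
  using subgroup.one_closed[OF submodule.axioms(1)] by fastforce

text \<open>Turns a condition of the form \<open>h x \<in> U\<close> into a submodule, so that it
  can be checked on generators only.\<close>

lemma submodule_vimage:
  assumes "module K M" "module K N" "linear_map K M N h" "submodule U K N"
  shows "submodule {x \<in> carrier M. h x \<in> U} K M"
proof -
  interpret M: module K M by fact
  interpret N: module K N by fact
  note U = N.submoduleE[OF assms(4)]
  note h = linear_mapD[OF assms(3)]
  show ?thesis
    by (rule submoduleI_closed[OF assms(1)])
       (use U h submodule_zero[OF assms(2,4)] linear_map_zero[OF assms(1-3)] in auto)
qed

lemma submodule_equalizer: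
  assumes "module K M" "module K N" "linear_map K M N f" "linear_map K M N g"
  shows "submodule {x \<in> carrier M. f x = g x} K M"
proof -
  interpret M: module K M by fact
  interpret N: module K N by fact
  note f = linear_mapD[OF assms(3)]
  note g = linear_mapD[OF assms(4)]
  show ?thesis
    by (rule submoduleI_closed[OF assms(1)])
       (use f g linear_map_zero[OF assms(1-3)] linear_map_zero[OF assms(1,2,4)] in auto)
qed

lemma submodule_module_span:
  assumes "module K M" "S \<subseteq> carrier M"
  shows "submodule (module_span K M S) K M"
proof -
  interpret M: module K M by fact
  let ?A = "{U. submodule U K M \<and> S \<subseteq> U}"
  have c: "carrier M \<in> ?A" using M.carrier_is_submodule assms by auto
  show ?thesis
    unfolding module_span_def
    by (rule submoduleI_closed[OF assms(1)])
       (use c submodule_zero[OF assms(1)] M.submoduleE(4,5) in blast)+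
qed

lemma module_span_superset: "S \<subseteq> module_span K M S"
  by (auto simp: module_span_def)

lemma module_span_least: "submodule U K M \<Longrightarrow> S \<subseteq> U \<Longrightarrow> module_span K M S \<subseteq> U"
  by (auto simp: module_span_def)

text \<open>One inclusion is enough: the carrier of a module is itself a submodule containing
  \<open>S\<close>, so it contains the span.\<close>

definition generates ::
    "('k, 'c) ring_scheme \<Rightarrow> ('k, 'v, 'm) module_scheme \<Rightarrow> 'v set \<Rightarrow> bool" where
  "generates K M S \<longleftrightarrow> S \<subseteq> carrier M \<and> carrier M \<subseteq> module_span K M S"

lemma generates_induct:
  assumes "generates K M S" "submodule U K M" "S \<subseteq> U"
  shows "carrier M \<subseteq> U"
  using assms(1) module_span_least[OF assms(2,3)] unfolding generates_def by blast

text \<open>The equalizer of two linear maps is a submodule. All uniqueness statements below rest on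
  this.\<close>

lemma linear_map_eqI:
  assumes "module K M" "module K N" "generates K M S" "linear_map K M N f" "linear_map K M N g"
    and "\<And>s. s \<in> S \<Longrightarrow> f s = g s" and "x \<in> carrier M"
  shows "f x = g x"
proof -
  have "S \<subseteq> {x \<in> carrier M. f x = g x}" using assms(3,6) unfolding generates_def by blast
  from generates_induct[OF assms(3) submodule_equalizer[OF assms(1,2,4,5)] this]
  show ?thesis using assms(7) by auto
qed

lemma generates_linear_image:
  assumes "module K M" "module K N" "generates K M S" "linear_map K M N h"
    and "submodule U K N" "\<And>s. s \<in> S \<Longrightarrow> h s \<in> U" "x \<in> carrier M"
  shows "h x \<in> U"
proof -
  have "S \<subseteq> {x \<in> carrier M. h x \<in> U}" using assms(3,6) unfolding generates_def by blast
  from generates_induct[OF assms(3) submodule_vimage[OF assms(1,2,4,5)] this]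
  show ?thesis using assms(7) by auto
qed

text \<open>The span of \<open>S\<close> is one of the submodules \<open>U\<close> in the last
  premise, and that instance is the claim.\<close>

lemma generatesI:
  assumes "module K M" "S \<subseteq> carrier M" "\<And>U. submodule U K M \<Longrightarrow> S \<subseteq> U \<Longrightarrow> carrier M \<subseteq> U"
  shows "generates K M S"
  using assms(2) assms(3)[OF submodule_module_span[OF assms(1,2)] module_span_superset]
  unfolding generates_def by blast

subsection \<open>Sums of finite support\<close>

text \<open>\<open>finsum\<close> over an infinite set is zero by convention, so a sum over an
  infinite index set is taken over the support of the summands.\<close>

definition supp_sum :: "('k, 'v, 'm) module_scheme \<Rightarrow> 'i set \<Rightarrow> ('i \<Rightarrow> 'v) \<Rightarrow> 'v" where
  "supp_sum M I t = finsum M t {i \<in> I. t i \<noteq> \<zero>\<^bsub>M\<^esub>}"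

context
  fixes K :: "('k, 'c) ring_scheme" and M :: "('k, 'v, 'm) module_scheme"
  assumes M: "module K M"
begin

interpretation M: module K M by (rule M)

text \<open>Families with different supports are compared by enlarging both supports to one finite
  set.\<close>

lemma supp_sum_eq:
  assumes "t \<in> I \<rightarrow> carrier M" "finite A" "A \<subseteq> I" "\<And>i. i \<in> I - A \<Longrightarrow> t i = \<zero>\<^bsub>M\<^esub>"
  shows "supp_sum M I t = finsum M t A"
  unfolding supp_sum_def
  by (rule M.add.finprod_mono_neutral_cong_left) (use assms in auto)

lemma supp_sum_closed: "t \<in> I \<rightarrow> carrier M \<Longrightarrow> supp_sum M I t \<in> carrier M"
  unfolding supp_sum_def by (rule M.finsum_closed) auto

lemma supp_sum_add:
  assumes s: "s \<in> I \<rightarrow> carrier M" "finite {i \<in> I. s i \<noteq> \<zero>\<^bsub>M\<^esub>}"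
    and t: "t \<in> I \<rightarrow> carrier M" "finite {i \<in> I. t i \<noteq> \<zero>\<^bsub>M\<^esub>}"
  shows "supp_sum M I (\<lambda>i. s i \<oplus>\<^bsub>M\<^esub> t i) = supp_sum M I s \<oplus>\<^bsub>M\<^esub> supp_sum M I t"
proof -
  let ?A = "{i \<in> I. s i \<noteq> \<zero>\<^bsub>M\<^esub>} \<union> {i \<in> I. t i \<noteq> \<zero>\<^bsub>M\<^esub>}"
  have "supp_sum M I (\<lambda>i. s i \<oplus>\<^bsub>M\<^esub> t i) = finsum M (\<lambda>i. s i \<oplus>\<^bsub>M\<^esub> t i) ?A"
    by (rule supp_sum_eq) (use s t in auto)
  also have "\<dots> = finsum M s ?A \<oplus>\<^bsub>M\<^esub> finsum M t ?A"
    by (rule M.finsum_addf) (use s t in auto)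
  also have "finsum M s ?A = supp_sum M I s"
    by (rule supp_sum_eq[symmetric]) (use s t in auto)
  also have "finsum M t ?A = supp_sum M I t"
    by (rule supp_sum_eq[symmetric]) (use s t in auto)
  finally show ?thesis .
qed

lemma supp_sum_smult:
  assumes t: "t \<in> I \<rightarrow> carrier M" "finite {i \<in> I. t i \<noteq> \<zero>\<^bsub>M\<^esub>}" and a: "a \<in> carrier K"
  shows "supp_sum M I (\<lambda>i. a \<odot>\<^bsub>M\<^esub> t i) = a \<odot>\<^bsub>M\<^esub> supp_sum M I t"
proof -
  let ?A = "{i \<in> I. t i \<noteq> \<zero>\<^bsub>M\<^esub>}"
  have "supp_sum M I (\<lambda>i. a \<odot>\<^bsub>M\<^esub> t i) = finsum M (\<lambda>i. a \<odot>\<^bsub>M\<^esub> t i) ?A"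
    by (rule supp_sum_eq) (use t a in auto)
  also have "\<dots> = a \<odot>\<^bsub>M\<^esub> finsum M t ?A"
    by (rule M.finsum_smult_ldistr[symmetric]) (use t a in auto)
  finally show ?thesis by (simp add: supp_sum_def)
qed

lemma supp_sum_single:
  assumes "i \<in> I" "t i \<in> carrier M" "\<And>j. j \<in> I \<Longrightarrow> j \<noteq> i \<Longrightarrow> t j = \<zero>\<^bsub>M\<^esub>"
  shows "supp_sum M I t = t i"
proof -
  have "supp_sum M I t = finsum M t {i}"
    by (rule supp_sum_eq) (use assms in \<open>auto simp: Pi_def, metis M.zero_closed\<close>)
  then show ?thesis using assms by simp
qed

lemma supp_sum_cong:
  assumes "t \<in> I \<rightarrow> carrier M" "\<And>i. i \<in> I \<Longrightarrow> s i = t i"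
  shows "supp_sum M I s = supp_sum M I t"
proof -
  have "{i \<in> I. s i \<noteq> \<zero>\<^bsub>M\<^esub>} = {i \<in> I. t i \<noteq> \<zero>\<^bsub>M\<^esub>}" using assms by auto
  then show ?thesis unfolding supp_sum_def
    by (intro M.finsum_cong') (use assms in auto)
qed

lemma supp_sum_in_submodule:
  assumes "submodule U K M" "t \<in> I \<rightarrow> U"
  shows "supp_sum M I t \<in> U"
proof -
  note U = M.submoduleE[OF assms(1)]
  \<comment> \<open>The set \<open>A\<close> is arbitrary: if it is infinite, the sum is zero by
    convention and lies in \<open>U\<close>.\<close>
  have "finsum M t A \<in> U" if "t \<in> A \<rightarrow> U" for A
    using that
  proof (induction A rule: infinite_finite_induct)
    case (insert x F)
    then have "finsum M t (insert x F) = t x \<oplus>\<^bsub>M\<^esub> finsum M t F"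
      using U(1) by (intro M.finsum_insert) auto
    then show ?case using insert U(5) by auto
  qed (use submodule_zero[OF M assms(1)] in auto)
  then show ?thesis using assms(2) unfolding supp_sum_def by (simp add: Pi_iff)
qed

end

lemma linear_map_finsum:
  assumes V: "module K V" and W: "module K W" and A: "finite A"
    and f: "\<And>i. i \<in> A \<Longrightarrow> linear_map K V W (f i)"
  shows "linear_map K V W (\<lambda>x. finsum W (\<lambda>i. f i x) A)"
proof -
  interpret V: module K V by (rule V)
  interpret W: module K W by (rule W)
  note fl = linear_mapD[OF f]
  have P: "(\<lambda>i. f i x) \<in> A \<rightarrow> carrier W" if "x \<in> carrier V" for x
    using fl(1) that by auto
  show ?thesis
  proof (rule linear_mapI)
    fix x assume x: "x \<in> carrier V"
    show "finsum W (\<lambda>i. f i x) A \<in> carrier W" by (rule W.finsum_closed[OF P[OF x]])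
    {
      fix y assume y: "y \<in> carrier V"
      have "finsum W (\<lambda>i. f i (x \<oplus>\<^bsub>V\<^esub> y)) A = finsum W (\<lambda>i. f i x \<oplus>\<^bsub>W\<^esub> f i y) A"
        by (rule W.finsum_cong') (use x y fl in auto)
      also have "\<dots> = finsum W (\<lambda>i. f i x) A \<oplus>\<^bsub>W\<^esub> finsum W (\<lambda>i. f i y) A"
        by (rule W.finsum_addf[OF P[OF x] P[OF y]])
      finally show "finsum W (\<lambda>i. f i (x \<oplus>\<^bsub>V\<^esub> y)) A =
        finsum W (\<lambda>i. f i x) A \<oplus>\<^bsub>W\<^esub> finsum W (\<lambda>i. f i y) A" .
    }
    fix a assume a: "a \<in> carrier K"
    have "finsum W (\<lambda>i. f i (a \<odot>\<^bsub>V\<^esub> x)) A = finsum W (\<lambda>i. a \<odot>\<^bsub>W\<^esub> f i x) A"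
      by (rule W.finsum_cong') (use x a fl in auto)
    also have "\<dots> = a \<odot>\<^bsub>W\<^esub> finsum W (\<lambda>i. f i x) A"
      by (rule W.finsum_smult_ldistr[OF A a P[OF x], symmetric])
    finally show "finsum W (\<lambda>i. f i (a \<odot>\<^bsub>V\<^esub> x)) A = a \<odot>\<^bsub>W\<^esub> finsum W (\<lambda>i. f i x) A" .
  qed
qed

subsection \<open>Free modules\<close>

lemma free_module_simps [simp]:
  "carrier (free_module K X) =
     {f. f \<in> X \<rightarrow> carrier K \<and> (\<forall>x. x \<notin> X \<longrightarrow> f x = \<zero>\<^bsub>K\<^esub>) \<and> finite {x. f x \<noteq> \<zero>\<^bsub>K\<^esub>}}"
  "\<zero>\<^bsub>free_module K X\<^esub> = (\<lambda>x. \<zero>\<^bsub>K\<^esub>)"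
  "f \<oplus>\<^bsub>free_module K X\<^esub> g = (\<lambda>x. f x \<oplus>\<^bsub>K\<^esub> g x)"
  "a \<odot>\<^bsub>free_module K X\<^esub> f = (\<lambda>x. a \<otimes>\<^bsub>K\<^esub> f x)"
  by (simp_all add: free_module_def)

context
  fixes K :: "('k, 'c) ring_scheme"
  assumes K: "cring K"
begin

interpretation K: cring K by (rule K)

lemma free_module_carrierD: "f \<in> carrier (free_module K X) \<Longrightarrow> f x \<in> carrier K"
  by (cases "x \<in> X") auto

lemma module_free_module: "module K (free_module K X)"
proof -
  note c = free_module_carrierD[of _ X]
  have add: "(\<lambda>x. f x \<oplus>\<^bsub>K\<^esub> g x) \<in> carrier (free_module K X)"
    if "f \<in> carrier (free_module K X)" "g \<in> carrier (free_module K X)" for f g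
    using that by (auto intro!: finite_subset[of _ "{x. f x \<noteq> \<zero>\<^bsub>K\<^esub>} \<union> {x. g x \<noteq> \<zero>\<^bsub>K\<^esub>}"])
  have smult: "(\<lambda>x. a \<otimes>\<^bsub>K\<^esub> f x) \<in> carrier (free_module K X)"
    if "f \<in> carrier (free_module K X)" "a \<in> carrier K" for f a
    using that by (auto intro!: finite_subset[of _ "{x. f x \<noteq> \<zero>\<^bsub>K\<^esub>}"])
  show ?thesis
  proof (rule moduleI)
    show "cring K" by (rule K)
    show "abelian_group (free_module K X)"
    proof (rule abelian_groupI)
      fix f assume f: "f \<in> carrier (free_module K X)"
      let ?g = "\<lambda>x. \<ominus>\<^bsub>K\<^esub> f x"
      \<comment> \<open>Written as a multiple by minus one, the inverse inherits its finite support
        from \<open>smult\<close>.\<close>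
      have "?g = (\<lambda>x. (\<ominus>\<^bsub>K\<^esub> \<one>\<^bsub>K\<^esub>) \<otimes>\<^bsub>K\<^esub> f x)" using c[OF f] by (simp add: K.l_minus)
      with smult[OF f, of "\<ominus>\<^bsub>K\<^esub> \<one>\<^bsub>K\<^esub>"] have "?g \<in> carrier (free_module K X)" by simp
      moreover have "?g \<oplus>\<^bsub>free_module K X\<^esub> f = \<zero>\<^bsub>free_module K X\<^esub>"
        using c[OF f] by (simp add: K.l_neg)
      ultimately show "\<exists>g\<in>carrier (free_module K X). g \<oplus>\<^bsub>free_module K X\<^esub> f = \<zero>\<^bsub>free_module K X\<^esub>"
        by blast
    next
      fix f g assume "f \<in> carrier (free_module K X)" "g \<in> carrier (free_module K X)"
      from add[OF this] show "f \<oplus>\<^bsub>free_module K X\<^esub> g \<in> carrier (free_module K X)"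
        by (simp only: free_module_simps)
    next
      show "\<zero>\<^bsub>free_module K X\<^esub> \<in> carrier (free_module K X)" by simp
    qed (use c in \<open>simp_all only: free_module_simps(2-4) K.a_assoc K.a_comm K.l_zero\<close>)
  next
    fix a f assume "a \<in> carrier K" "f \<in> carrier (free_module K X)"
    from smult[OF this(2,1)] show "a \<odot>\<^bsub>free_module K X\<^esub> f \<in> carrier (free_module K X)"
      by (simp only: free_module_simps)
  qed (use c in \<open>simp_all only: free_module_simps(2-4) K.l_distr K.r_distr K.m_assoc K.l_one\<close>)
qed

lemma basis_vec_closed: "x \<in> X \<Longrightarrow> basis_vec K x \<in> carrier (free_module K X)"
  by (auto simp: basis_vec_def)

lemma free_module_expand:
  assumes f: "f \<in> carrier (free_module K X)"
  shows "f = supp_sum (free_module K X) X (\<lambda>x. f x \<odot>\<^bsub>free_module K X\<^esub> basis_vec K x)"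
proof -
  let ?F = "free_module K X"
  interpret F: module K ?F by (rule module_free_module)
  let ?t = "\<lambda>x. f x \<odot>\<^bsub>?F\<^esub> basis_vec K x"
  have t: "?t \<in> X \<rightarrow> carrier ?F"
    by (intro funcsetI F.smult_closed free_module_carrierD[OF f] basis_vec_closed)
  \<comment> \<open>A \<open>finsum\<close> of functions is a fold in the function space and not a
    pointwise sum by definition; the induction evaluates it at \<open>y\<close>.\<close>
  have S: "finsum ?F ?t A y = (if y \<in> A then f y else \<zero>\<^bsub>K\<^esub>)" if "finite A" "A \<subseteq> X" for A y
    using that
  proof (induction A rule: finite_induct)
    case empty then show ?case by simp
  next
    case (insert x A)
    have "finsum ?F ?t (insert x A) = ?t x \<oplus>\<^bsub>?F\<^esub> finsum ?F ?t A"
      by (rule F.finsum_insert) (use insert t in auto)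
    then show ?case using insert free_module_carrierD[OF f]
      by (auto simp: basis_vec_def)
  qed
  have *: "supp_sum ?F X ?t = finsum ?F ?t {x. f x \<noteq> \<zero>\<^bsub>K\<^esub>}"
    by (rule supp_sum_eq[OF F.module_axioms t]) (use f in \<open>auto simp: basis_vec_def\<close>)
  have "finite {x. f x \<noteq> \<zero>\<^bsub>K\<^esub>}" "{x. f x \<noteq> \<zero>\<^bsub>K\<^esub>} \<subseteq> X" using f by auto
  note S = S[OF this, unfolded mem_Collect_eq]
  show ?thesis
  proof
    fix y show "f y = supp_sum ?F X ?t y" unfolding * S by simp
  qed
qed

lemma generates_free_module: "generates K (free_module K X) (basis_vec K ` X)"
proof (rule generatesI[OF module_free_module])
  let ?F = "free_module K X"
  interpret F: module K ?F by (rule module_free_module)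
  show "basis_vec K ` X \<subseteq> carrier ?F" using basis_vec_closed by (rule image_subsetI)
  fix U assume U: "submodule U K ?F" "basis_vec K ` X \<subseteq> U"
  show "carrier ?F \<subseteq> U"
  proof
    fix f assume f: "f \<in> carrier ?F"
    have "(\<lambda>x. f x \<odot>\<^bsub>?F\<^esub> basis_vec K x) \<in> X \<rightarrow> U"
      by (intro funcsetI F.submoduleE(4)[OF U(1)] free_module_carrierD[OF f] subsetD[OF U(2)] imageI)
    then have "supp_sum ?F X (\<lambda>x. f x \<odot>\<^bsub>?F\<^esub> basis_vec K x) \<in> U"
      by (rule supp_sum_in_submodule[OF F.module_axioms U(1)])
    then show "f \<in> U" using free_module_expand[OF f] by simp
  qed
qed

text \<open>The lift takes the expansion of \<open>f\<close> in basis vectors and puts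
  \<open>g x\<close> in place of the basis vector at \<open>x\<close>.\<close>

lemma free_module_lift:
  assumes "module K M" "g \<in> X \<rightarrow> carrier M"
  obtains h where "linear_map K (free_module K X) M h" "\<And>x. x \<in> X \<Longrightarrow> h (basis_vec K x) = g x"
proof
  interpret M: module K M by fact
  let ?F = "free_module K X"
  interpret F: module K ?F by (rule module_free_module)
  let ?h = "\<lambda>f. supp_sum M X (\<lambda>x. f x \<odot>\<^bsub>M\<^esub> g x)"
  have t: "(\<lambda>x. f x \<odot>\<^bsub>M\<^esub> g x) \<in> X \<rightarrow> carrier M" "finite {x \<in> X. f x \<odot>\<^bsub>M\<^esub> g x \<noteq> \<zero>\<^bsub>M\<^esub>}"
    if "f \<in> carrier ?F" for f
  proof -
    show "(\<lambda>x. f x \<odot>\<^bsub>M\<^esub> g x) \<in> X \<rightarrow> carrier M" using that assms(2) by auto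
    have "{x \<in> X. f x \<odot>\<^bsub>M\<^esub> g x \<noteq> \<zero>\<^bsub>M\<^esub>} \<subseteq> {x. f x \<noteq> \<zero>\<^bsub>K\<^esub>}"
      using assms(2) by (auto simp: Pi_iff)
    then show "finite {x \<in> X. f x \<odot>\<^bsub>M\<^esub> g x \<noteq> \<zero>\<^bsub>M\<^esub>}" using that finite_subset by auto
  qed
  show "linear_map K ?F M ?h"
  proof (rule linear_mapI)
    fix f assume f: "f \<in> carrier ?F"
    show "?h f \<in> carrier M" by (rule supp_sum_closed[OF assms(1) t(1)[OF f]])
    fix f' assume f': "f' \<in> carrier ?F"
    have "?h (f \<oplus>\<^bsub>?F\<^esub> f') = supp_sum M X (\<lambda>x. f x \<odot>\<^bsub>M\<^esub> g x \<oplus>\<^bsub>M\<^esub> f' x \<odot>\<^bsub>M\<^esub> g x)"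
      by (rule supp_sum_cong[OF assms(1)])
         (use assms(2) free_module_carrierD[OF f] free_module_carrierD[OF f'] in
           \<open>auto simp: M.smult_l_distr Pi_iff\<close>)
    also have "\<dots> = ?h f \<oplus>\<^bsub>M\<^esub> ?h f'"
      by (rule supp_sum_add[OF assms(1) t[OF f] t[OF f']])
    finally show "?h (f \<oplus>\<^bsub>?F\<^esub> f') = ?h f \<oplus>\<^bsub>M\<^esub> ?h f'" .
  next
    fix a f assume a: "a \<in> carrier K" and f: "f \<in> carrier ?F"
    have "?h (a \<odot>\<^bsub>?F\<^esub> f) = supp_sum M X (\<lambda>x. a \<odot>\<^bsub>M\<^esub> (f x \<odot>\<^bsub>M\<^esub> g x))"
      by (rule supp_sum_cong[OF assms(1)])
         (use assms(2) a free_module_carrierD[OF f] in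
           \<open>auto simp: M.smult_assoc1 Pi_iff\<close>)
    also have "\<dots> = a \<odot>\<^bsub>M\<^esub> ?h f"
      by (rule supp_sum_smult[OF assms(1) t[OF f] a])
    finally show "?h (a \<odot>\<^bsub>?F\<^esub> f) = a \<odot>\<^bsub>M\<^esub> ?h f" .
  qed
  fix x assume x: "x \<in> X"
  have gx: "g x \<in> carrier M" using x assms(2) by auto
  have "?h (basis_vec K x) = basis_vec K x x \<odot>\<^bsub>M\<^esub> g x"
    by (rule supp_sum_single[OF assms(1) x]) (use gx assms(2) in \<open>auto simp: basis_vec_def Pi_iff\<close>)
  then show "?h (basis_vec K x) = g x" using gx by (simp add: basis_vec_def)
qed

end

declare free_module_simps [simp del]

subsection \<open>Quotients\<close>

context
  fixes K :: "('k, 'c) ring_scheme" and M :: "('k, 'v, 'm) module_scheme" and N :: "'v set"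
  assumes M: "module K M" and N: "submodule N K M"
begin

interpretation M: module K M by (rule M)
interpretation N: abelian_subgroup N M
  by (rule abelian_subgroupI3)
     (auto intro: additive_subgroupI submodule.axioms(1)[OF N] M.abelian_group_axioms)

lemma quotient_module_carrier: "carrier (quotient_module M N) = (\<lambda>x. N +>\<^bsub>M\<^esub> x) ` carrier M"
  by (auto simp: quotient_module_def A_RCOSETS_def')

lemma quotient_module_zero: "\<zero>\<^bsub>quotient_module M N\<^esub> = N +>\<^bsub>M\<^esub> \<zero>\<^bsub>M\<^esub>"
  using M.a_coset_add_zero[OF N.a_subset] by (simp add: quotient_module_def)

lemma quotient_module_add:
  "x \<in> carrier M \<Longrightarrow> y \<in> carrier M \<Longrightarrow>
   (N +>\<^bsub>M\<^esub> x) \<oplus>\<^bsub>quotient_module M N\<^esub> (N +>\<^bsub>M\<^esub> y) = N +>\<^bsub>M\<^esub> (x \<oplus>\<^bsub>M\<^esub> y)"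
  using N.a_rcos_sum by (simp add: quotient_module_def)

lemma coset_eq_iff:
  assumes "x \<in> carrier M" "y \<in> carrier M"
  shows "N +>\<^bsub>M\<^esub> x = N +>\<^bsub>M\<^esub> y \<longleftrightarrow> x \<ominus>\<^bsub>M\<^esub> y \<in> N"
proof -
  have "N +>\<^bsub>M\<^esub> x = N +>\<^bsub>M\<^esub> y \<longleftrightarrow> x \<in> N +>\<^bsub>M\<^esub> y"
    using N.a_rcos_self[OF assms(1)] N.a_repr_independence'[of x y] assms(2) by auto
  also have "\<dots> \<longleftrightarrow> x \<oplus>\<^bsub>M\<^esub> \<ominus>\<^bsub>M\<^esub> y \<in> N"
    by (rule N.a_rcos_module) (use assms M.abelian_group_axioms in auto)
  finally show ?thesis by (simp add: a_minus_def)
qed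

text \<open>The scalar multiple of a coset is defined as a union over all its representatives. All
  members of this union coincide, because representatives differ by an element of \<open>N\<close>,
  which is closed under scalars.\<close>

lemma quotient_module_smult:
  assumes "a \<in> carrier K" "x \<in> carrier M"
  shows "a \<odot>\<^bsub>quotient_module M N\<^esub> (N +>\<^bsub>M\<^esub> x) = N +>\<^bsub>M\<^esub> (a \<odot>\<^bsub>M\<^esub> x)"
proof -
  have "N +>\<^bsub>M\<^esub> (a \<odot>\<^bsub>M\<^esub> y) = N +>\<^bsub>M\<^esub> (a \<odot>\<^bsub>M\<^esub> x)" if "y \<in> N +>\<^bsub>M\<^esub> x" for y
  proof -
    have y: "y \<in> carrier M" using that N.a_elemrcos_carrier M.abelian_group_axioms assms by auto
    have "N +>\<^bsub>M\<^esub> y = N +>\<^bsub>M\<^esub> x"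
      using N.a_repr_independence'[OF that assms(2)] by simp
    then have "y \<ominus>\<^bsub>M\<^esub> x \<in> N" using coset_eq_iff[OF y assms(2)] by simp
    then have "a \<odot>\<^bsub>M\<^esub> (y \<ominus>\<^bsub>M\<^esub> x) \<in> N" using M.submoduleE(4)[OF N] assms by simp
    moreover have "a \<odot>\<^bsub>M\<^esub> (y \<ominus>\<^bsub>M\<^esub> x) = a \<odot>\<^bsub>M\<^esub> y \<ominus>\<^bsub>M\<^esub> a \<odot>\<^bsub>M\<^esub> x"
      using assms y by (simp add: a_minus_def M.smult_r_distr M.smult_r_minus)
    ultimately show ?thesis using coset_eq_iff assms y by simp
  qed
  then have "(\<Union>y\<in>N +>\<^bsub>M\<^esub> x. N +>\<^bsub>M\<^esub> (a \<odot>\<^bsub>M\<^esub> y)) = (\<Union>y\<in>N +>\<^bsub>M\<^esub> x. N +>\<^bsub>M\<^esub> (a \<odot>\<^bsub>M\<^esub> x))"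
    by (rule SUP_cong[OF refl])
  also have "\<dots> = N +>\<^bsub>M\<^esub> (a \<odot>\<^bsub>M\<^esub> x)" using N.a_rcos_self[OF assms(2)] by blast
  finally show ?thesis by (simp add: quotient_module_def)
qed

lemma module_quotient_module: "module K (quotient_module M N)"
proof (rule moduleI)
  let ?Q = "quotient_module M N"
  note q = quotient_module_carrier quotient_module_zero quotient_module_add quotient_module_smult
  show "cring K" by (rule M.R.cring_axioms)
  show "abelian_group ?Q"
  proof (rule abelian_groupI)
    fix X assume "X \<in> carrier ?Q"
    then obtain x where x: "x \<in> carrier M" "X = N +>\<^bsub>M\<^esub> x" by (auto simp: q(1))
    have "(N +>\<^bsub>M\<^esub> \<ominus>\<^bsub>M\<^esub> x) \<oplus>\<^bsub>?Q\<^esub> X = \<zero>\<^bsub>?Q\<^esub>" using x by (simp add: q M.l_neg)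
    then show "\<exists>Y\<in>carrier ?Q. Y \<oplus>\<^bsub>?Q\<^esub> X = \<zero>\<^bsub>?Q\<^esub>" using x unfolding q(1) by blast
  qed (auto simp: q M.a_ac)
qed (auto simp: quotient_module_carrier quotient_module_add quotient_module_smult
        M.smult_l_distr M.smult_r_distr M.smult_assoc1)

lemma linear_map_coset: "linear_map K M (quotient_module M N) (\<lambda>x. N +>\<^bsub>M\<^esub> x)"
  by (rule linear_mapI)
     (auto simp: quotient_module_carrier quotient_module_add quotient_module_smult)

text \<open>The lift evaluates \<open>h\<close> at a chosen representative. The choice is harmless:
  two representatives differ by an element of \<open>N\<close>, where \<open>h\<close>
  vanishes.\<close>

lemma quotient_module_lift:
  assumes P: "module K P" and h: "linear_map K M P h" and "\<And>x. x \<in> N \<Longrightarrow> h x = \<zero>\<^bsub>P\<^esub>"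
  obtains h' where "linear_map K (quotient_module M N) P h'"
    "\<And>x. x \<in> carrier M \<Longrightarrow> h' (N +>\<^bsub>M\<^esub> x) = h x"
proof
  interpret P: module K P by fact
  let ?h = "\<lambda>C. h (SOME x. x \<in> C)"
  show eq: "?h (N +>\<^bsub>M\<^esub> x) = h x" if x: "x \<in> carrier M" for x
  proof -
    define y where "y = (SOME y. y \<in> N +>\<^bsub>M\<^esub> x)"
    have yx: "y \<in> N +>\<^bsub>M\<^esub> x" unfolding y_def by (rule someI) (rule N.a_rcos_self[OF x])
    have y: "y \<in> carrier M" using yx N.a_elemrcos_carrier M.abelian_group_axioms x by auto
    have "N +>\<^bsub>M\<^esub> y = N +>\<^bsub>M\<^esub> x" using N.a_repr_independence'[OF yx x] by simp
    then have "h (y \<ominus>\<^bsub>M\<^esub> x) = \<zero>\<^bsub>P\<^esub>" using coset_eq_iff[OF y x] assms(3) by simp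
    then have "h y \<ominus>\<^bsub>P\<^esub> h x = \<zero>\<^bsub>P\<^esub>" using linear_map_minus[OF M P h y x] by simp
    then show ?thesis
      using P.minus_equality[of "h y" "\<ominus>\<^bsub>P\<^esub> h x"] linear_mapD(1)[OF h x] linear_mapD(1)[OF h y]
      unfolding y_def by (simp add: a_minus_def)
  qed
  show "linear_map K (quotient_module M N) P ?h"
    by (rule linear_mapI)
       (auto simp: quotient_module_carrier quotient_module_add quotient_module_smult eq linear_mapD[OF h])
qed

lemma generates_quotient_module:
  assumes "generates K M S"
  shows "generates K (quotient_module M N) ((\<lambda>x. N +>\<^bsub>M\<^esub> x) ` S)"
proof (rule generatesI[OF module_quotient_module])
  show "(\<lambda>x. N +>\<^bsub>M\<^esub> x) ` S \<subseteq> carrier (quotient_module M N)"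
    using assms by (auto simp: generates_def quotient_module_carrier)
  fix U assume "submodule U K (quotient_module M N)" "(\<lambda>x. N +>\<^bsub>M\<^esub> x) ` S \<subseteq> U"
  then show "carrier (quotient_module M N) \<subseteq> U"
    using generates_linear_image[OF M module_quotient_module assms linear_map_coset, of U]
    unfolding quotient_module_carrier by blast
qed

end

subsection \<open>Modules given by generators and relations\<close>

context
  fixes K :: "('k, 'c) ring_scheme" and X :: "'x set" and R :: "('x \<Rightarrow> 'k) set"
  assumes K: "cring K" and R: "R \<subseteq> carrier (free_module K X)"
begin

private abbreviation (input) "pF \<equiv> free_module K X"
private abbreviation (input) "pN \<equiv> module_span K pF R"
private abbreviation (input) "pcls x \<equiv> pN +>\<^bsub>pF\<^esub> basis_vec K x"

private lemmas pF_module = module_free_module[OF K, of X]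
private lemmas pN_submodule = submodule_module_span[OF pF_module R]

lemma module_presented: "module K (quotient_module pF pN)"
  by (rule module_quotient_module[OF pF_module pN_submodule])

lemma generates_presented: "generates K (quotient_module pF pN) (pcls ` X)"
  using generates_quotient_module[OF pF_module pN_submodule generates_free_module[OF K]] unfolding image_image .

lemma presented_relation:
  assumes "f \<ominus>\<^bsub>pF\<^esub> g \<in> R" "f \<in> carrier pF" "g \<in> carrier pF"
  shows "pN +>\<^bsub>pF\<^esub> f = pN +>\<^bsub>pF\<^esub> g"
  using coset_eq_iff[OF pF_module pN_submodule assms(2,3)] subsetD[OF module_span_superset assms(1)] by blast

text \<open>The kernel of a linear map is a submodule, so it contains the span of \<open>R\<close>
  as soon as it contains \<open>R\<close>. The premise \<open>rel\<close> hands over an unknown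
  linear \<open>h\<close> with known values on basis vectors, which is all that is needed to
  evaluate a relation. Tensor products and tensor powers are both instances.\<close>

lemma presented_lift:
  assumes P: "module K P" and g: "g \<in> X \<rightarrow> carrier P"
    and rel: "\<And>h r. linear_map K pF P h \<Longrightarrow> (\<And>x. x \<in> X \<Longrightarrow> h (basis_vec K x) = g x) \<Longrightarrow>
       r \<in> R \<Longrightarrow> h r = \<zero>\<^bsub>P\<^esub>"
  obtains h where "linear_map K (quotient_module pF pN) P h" "\<And>x. x \<in> X \<Longrightarrow> h (pcls x) = g x"
proof -
  interpret P: module K P by fact
  obtain h where h: "linear_map K pF P h" "\<And>x. x \<in> X \<Longrightarrow> h (basis_vec K x) = g x"
    using free_module_lift[OF K P g] by metis
  \<comment> \<open>The kernel is treated as the preimage of the zero submodule.\<close>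
  have z: "submodule {\<zero>\<^bsub>P\<^esub>} K P" by (rule submoduleI_closed[OF P]) auto
  have "R \<subseteq> {x \<in> carrier pF. h x \<in> {\<zero>\<^bsub>P\<^esub>}}" using rel[OF h] R by blast
  from module_span_least[OF submodule_vimage[OF pF_module P h(1) z] this]
  have "h x = \<zero>\<^bsub>P\<^esub>" if "x \<in> pN" for x using that by blast
  then obtain h' where h': "linear_map K (quotient_module pF pN) P h'"
      "\<And>x. x \<in> carrier pF \<Longrightarrow> h' (pN +>\<^bsub>pF\<^esub> x) = h x"
    using quotient_module_lift[OF pF_module pN_submodule P h(1)] by metis
  show ?thesis
    by (rule that[OF h'(1)]) (simp add: h'(2) h(2) basis_vec_closed[OF K])
qed

end

subsection \<open>Tensor products\<close>

text \<open>The generating set inside \<open>tensor_null\<close>, named so that the results on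
  generators and relations can be instantiated with it.\<close>

definition tensor_relations ::
    "('k, 'c) ring_scheme \<Rightarrow> ('k, 'v, 'm) module_scheme \<Rightarrow> ('k, 'w, 'n) module_scheme
      \<Rightarrow> ('v \<times> 'w \<Rightarrow> 'k) set" where
  "tensor_relations K V W =
    (let F = free_module K (carrier V \<times> carrier W); e = (\<lambda>x y. basis_vec K (x, y)) in
      {e (x \<oplus>\<^bsub>V\<^esub> x') y \<ominus>\<^bsub>F\<^esub> (e x y \<oplus>\<^bsub>F\<^esub> e x' y) | x x' y.
          x \<in> carrier V \<and> x' \<in> carrier V \<and> y \<in> carrier W} \<union>
       {e x (y \<oplus>\<^bsub>W\<^esub> y') \<ominus>\<^bsub>F\<^esub> (e x y \<oplus>\<^bsub>F\<^esub> e x y') | x y y'.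
          x \<in> carrier V \<and> y \<in> carrier W \<and> y' \<in> carrier W} \<union>
       {e (a \<odot>\<^bsub>V\<^esub> x) y \<ominus>\<^bsub>F\<^esub> (a \<odot>\<^bsub>F\<^esub> e x y) | a x y.
          a \<in> carrier K \<and> x \<in> carrier V \<and> y \<in> carrier W} \<union>
       {e x (a \<odot>\<^bsub>W\<^esub> y) \<ominus>\<^bsub>F\<^esub> (a \<odot>\<^bsub>F\<^esub> e x y) | a x y.
          a \<in> carrier K \<and> x \<in> carrier V \<and> y \<in> carrier W})"

lemma tensor_null_eq:
  "tensor_null K V W =
     module_span K (free_module K (carrier V \<times> carrier W)) (tensor_relations K V W)"
  by (simp add: tensor_null_def tensor_relations_def Let_def)

context
  fixes K :: "('k, 'c) ring_scheme" and V :: "('k, 'v, 'm) module_scheme"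
    and W :: "('k, 'w, 'n) module_scheme"
  assumes V: "module K V" and W: "module K W"
begin

interpretation V: module K V by (rule V)
interpretation W: module K W by (rule W)

private abbreviation (input) "F \<equiv> free_module K (carrier V \<times> carrier W)"
private abbreviation (input) "R \<equiv> tensor_relations K V W"

private lemmas mF = module_free_module[OF V.R.cring_axioms, of "carrier V \<times> carrier W"]
interpretation F: module K F by (rule mF)

private lemma e: "x \<in> carrier V \<Longrightarrow> y \<in> carrier W \<Longrightarrow> basis_vec K (x, y) \<in> carrier F"
  by (intro basis_vec_closed[OF V.R.cring_axioms] SigmaI)

private lemma R: "R \<subseteq> carrier F"
  unfolding tensor_relations_def Let_def
  by (intro Un_least subsetI; elim CollectE exE conjE; hypsubst)
     (intro F.minus_closed F.a_closed F.smult_closed e V.a_closed W.a_closed V.smult_closed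
        W.smult_closed; assumption)+

private lemmas N = submodule_module_span[OF mF R]

lemma module_tensor: "module K (tensor K V W)"
  unfolding tensor_def tensor_null_eq by (rule module_presented[OF V.R.cring_axioms R])

private lemma pure_eq:
  "f \<ominus>\<^bsub>F\<^esub> g \<in> R \<Longrightarrow> f \<in> carrier F \<Longrightarrow> g \<in> carrier F \<Longrightarrow>
    tensor_null K V W +>\<^bsub>F\<^esub> f = tensor_null K V W +>\<^bsub>F\<^esub> g"
  unfolding tensor_null_eq by (rule presented_relation[OF V.R.cring_axioms R])

private lemma cls_add: "f \<in> carrier F \<Longrightarrow> g \<in> carrier F \<Longrightarrow>
    tensor_null K V W +>\<^bsub>F\<^esub> (f \<oplus>\<^bsub>F\<^esub> g) =
    (tensor_null K V W +>\<^bsub>F\<^esub> f) \<oplus>\<^bsub>tensor K V W\<^esub> (tensor_null K V W +>\<^bsub>F\<^esub> g)"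
  unfolding tensor_null_eq tensor_def by (rule quotient_module_add[OF mF N, symmetric])

private lemma cls_smult: "a \<in> carrier K \<Longrightarrow> f \<in> carrier F \<Longrightarrow>
    tensor_null K V W +>\<^bsub>F\<^esub> (a \<odot>\<^bsub>F\<^esub> f) =
    a \<odot>\<^bsub>tensor K V W\<^esub> (tensor_null K V W +>\<^bsub>F\<^esub> f)"
  unfolding tensor_null_eq tensor_def by (rule quotient_module_smult[OF mF N, symmetric])

lemma pure_tensor_closed:
  "x \<in> carrier V \<Longrightarrow> y \<in> carrier W \<Longrightarrow> pure_tensor K V W x y \<in> carrier (tensor K V W)"
  unfolding tensor_def pure_tensor_def tensor_null_eq quotient_module_carrier[OF mF N]
  by (rule imageI) (rule e)

text \<open>Additivity and homogeneity in the left factor are the first and the third family of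
  relations; the second and the fourth serve the right factor.\<close>

lemma linear_map_pure_tensor_left:
  assumes y: "y \<in> carrier W"
  shows "linear_map K V (tensor K V W) (\<lambda>x. pure_tensor K V W x y)"
proof (rule linear_mapI)
  show "pure_tensor K V W x y \<in> carrier (tensor K V W)" if "x \<in> carrier V" for x
    by (rule pure_tensor_closed[OF that y])
  fix x assume x: "x \<in> carrier V"
  {
    fix x' assume x': "x' \<in> carrier V"
    have "basis_vec K (x \<oplus>\<^bsub>V\<^esub> x', y) \<ominus>\<^bsub>F\<^esub> (basis_vec K (x, y) \<oplus>\<^bsub>F\<^esub> basis_vec K (x', y)) \<in> R"
      unfolding tensor_relations_def Let_def using x x' y by blast
    from pure_eq[OF this]
    show "pure_tensor K V W (x \<oplus>\<^bsub>V\<^esub> x') y =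
        pure_tensor K V W x y \<oplus>\<^bsub>tensor K V W\<^esub> pure_tensor K V W x' y"
      unfolding pure_tensor_def using e x x' y by (simp add: cls_add)
  }
  fix a assume a: "a \<in> carrier K"
  have "basis_vec K (a \<odot>\<^bsub>V\<^esub> x, y) \<ominus>\<^bsub>F\<^esub> (a \<odot>\<^bsub>F\<^esub> basis_vec K (x, y)) \<in> R"
    unfolding tensor_relations_def Let_def using a x y by blast
  from pure_eq[OF this]
  show "pure_tensor K V W (a \<odot>\<^bsub>V\<^esub> x) y = a \<odot>\<^bsub>tensor K V W\<^esub> pure_tensor K V W x y"
    unfolding pure_tensor_def using e a x y by (simp add: cls_smult)
qed

lemma linear_map_pure_tensor_right:
  assumes x: "x \<in> carrier V"
  shows "linear_map K W (tensor K V W) (\<lambda>y. pure_tensor K V W x y)"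
proof (rule linear_mapI)
  show "pure_tensor K V W x y \<in> carrier (tensor K V W)" if "y \<in> carrier W" for y
    by (rule pure_tensor_closed[OF x that])
  fix y assume y: "y \<in> carrier W"
  {
    fix y' assume y': "y' \<in> carrier W"
    have "basis_vec K (x, y \<oplus>\<^bsub>W\<^esub> y') \<ominus>\<^bsub>F\<^esub> (basis_vec K (x, y) \<oplus>\<^bsub>F\<^esub> basis_vec K (x, y')) \<in> R"
      unfolding tensor_relations_def Let_def using y y' x by blast
    from pure_eq[OF this]
    show "pure_tensor K V W x (y \<oplus>\<^bsub>W\<^esub> y') =
        pure_tensor K V W x y \<oplus>\<^bsub>tensor K V W\<^esub> pure_tensor K V W x y'"
      unfolding pure_tensor_def using e x y' y by (simp add: cls_add)
  }
  fix a assume a: "a \<in> carrier K"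
  have "basis_vec K (x, a \<odot>\<^bsub>W\<^esub> y) \<ominus>\<^bsub>F\<^esub> (a \<odot>\<^bsub>F\<^esub> basis_vec K (x, y)) \<in> R"
    unfolding tensor_relations_def Let_def using a x y by blast
  from pure_eq[OF this]
  show "pure_tensor K V W x (a \<odot>\<^bsub>W\<^esub> y) = a \<odot>\<^bsub>tensor K V W\<^esub> pure_tensor K V W x y"
    unfolding pure_tensor_def using e a x y by (simp add: cls_smult)
qed

lemma generates_tensor:
  "generates K (tensor K V W) {pure_tensor K V W x y | x y. x \<in> carrier V \<and> y \<in> carrier W}"
proof -
  have "{pure_tensor K V W x y | x y. x \<in> carrier V \<and> y \<in> carrier W} =
      (\<lambda>p. tensor_null K V W +>\<^bsub>F\<^esub> basis_vec K p) ` (carrier V \<times> carrier W)"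
    by (auto simp: pure_tensor_def)
  then show ?thesis
    using generates_presented[OF V.R.cring_axioms R]
    unfolding tensor_null_eq tensor_def by simp
qed

lemma tensor_lift:
  assumes P: "module K P"
    and l: "\<And>y. y \<in> carrier W \<Longrightarrow> linear_map K V P (\<lambda>x. g x y)"
    and r: "\<And>x. x \<in> carrier V \<Longrightarrow> linear_map K W P (\<lambda>y. g x y)"
  obtains h where "linear_map K (tensor K V W) P h"
    "\<And>x y. x \<in> carrier V \<Longrightarrow> y \<in> carrier W \<Longrightarrow> h (pure_tensor K V W x y) = g x y"
proof -
  interpret P: module K P by (rule P)
  note l = linear_mapD[OF l] and r = linear_mapD[OF r]
  have "case_prod g \<in> carrier V \<times> carrier W \<rightarrow> carrier P" using l(1) by auto
  moreover have "h s = \<zero>\<^bsub>P\<^esub>"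
    if h: "linear_map K F P h" and hg: "\<And>p. p \<in> carrier V \<times> carrier W \<Longrightarrow> h (basis_vec K p) = case_prod g p"
      and s: "s \<in> R" for h s
  proof -
    note hl = linear_mapD[OF h]
    have z: "x \<ominus>\<^bsub>P\<^esub> x = \<zero>\<^bsub>P\<^esub>" if "x \<in> carrier P" for x
      using that by (simp add: a_minus_def P.r_neg)
    have hg: "h (basis_vec K (x, y)) = g x y" if "x \<in> carrier V" "y \<in> carrier W" for x y
      using hg[of "(x, y)"] that by simp
    note [simp] = linear_map_minus[OF mF P h] hl e hg
    \<comment> \<open>For each of the four families, linearity of \<open>h\<close> and bilinearity
      of \<open>g\<close> turn the image of the relation into a difference of equal
      elements.\<close>
    show ?thesis
      using s unfolding tensor_relations_def Let_def
      by (elim UnE CollectE exE conjE; hypsubst) (simp_all add: l r z)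
  qed
  ultimately obtain h where "linear_map K (quotient_module F (module_span K F R)) P h"
     "\<And>p. p \<in> carrier V \<times> carrier W \<Longrightarrow> h (module_span K F R +>\<^bsub>F\<^esub> basis_vec K p) = case_prod g p"
    using presented_lift[OF V.R.cring_axioms R P, of "case_prod g"] by metis
  then show ?thesis
    by (intro that[of h]) (auto simp: tensor_null_eq tensor_def pure_tensor_def)
qed

end

subsection \<open>Tensor powers\<close>

text \<open>The varying slot is singled out by splitting the list around it. For
  \<open>n = 0\<close> there is no slot and the condition is empty, so even closedness of the values
  has to be derived from a slot; this is the reason for the premises \<open>n > 0\<close>
  below.\<close>

definition multilinear ::
    "('k, 'c) ring_scheme \<Rightarrow> ('k, 'v, 'm) module_scheme \<Rightarrow> nat \<Rightarrow> ('k, 'w, 'n) module_scheme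
      \<Rightarrow> ('v list \<Rightarrow> 'w) \<Rightarrow> bool" where
  "multilinear K V n W g \<longleftrightarrow>
     (\<forall>xs ys. set xs \<subseteq> carrier V \<and> set ys \<subseteq> carrier V \<and> length xs + Suc (length ys) = n \<longrightarrow>
        linear_map K V W (\<lambda>x. g (xs @ x # ys)))"

lemma multilinearD:
  assumes "multilinear K V n W g" "set xs \<subseteq> carrier V" "set ys \<subseteq> carrier V"
    "length xs + Suc (length ys) = n"
  shows "linear_map K V W (\<lambda>x. g (xs @ x # ys))"
  using assms by (auto simp: multilinear_def)

lemma multilinear_closed:
  assumes "multilinear K V n W g" "xs \<in> tuples V n" "n > 0"
  shows "g xs \<in> carrier W"
proof -
  obtain x ys where xs: "xs = x # ys" using assms(2,3) by (cases xs) (auto simp: tuples_def)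
  have "linear_map K V W (\<lambda>x. g ([] @ x # ys))"
    by (rule multilinearD[OF assms(1)]) (use assms xs in \<open>auto simp: tuples_def\<close>)
  from linear_mapD(1)[OF this, of x] show ?thesis using assms xs by (auto simp: tuples_def)
qed

definition tensor_power_relations ::
    "('k, 'c) ring_scheme \<Rightarrow> ('k, 'v, 'm) module_scheme \<Rightarrow> nat \<Rightarrow> ('v list \<Rightarrow> 'k) set" where
  "tensor_power_relations K V n =
    (let F = free_module K (tuples V n); e = basis_vec K in
      {e (xs @ (x \<oplus>\<^bsub>V\<^esub> x') # ys) \<ominus>\<^bsub>F\<^esub> (e (xs @ x # ys) \<oplus>\<^bsub>F\<^esub> e (xs @ x' # ys)) | xs x x' ys.
          xs @ x # ys \<in> tuples V n \<and> x' \<in> carrier V} \<union>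
       {e (xs @ (a \<odot>\<^bsub>V\<^esub> x) # ys) \<ominus>\<^bsub>F\<^esub> (a \<odot>\<^bsub>F\<^esub> e (xs @ x # ys)) | a xs x ys.
          a \<in> carrier K \<and> xs @ x # ys \<in> tuples V n})"

lemma tensor_power_null_eq:
  "tensor_power_null K V n =
     module_span K (free_module K (tuples V n)) (tensor_power_relations K V n)"
  by (simp add: tensor_power_null_def tensor_power_relations_def Let_def)

lemma tuples_append_Cons:
  "xs @ x # ys \<in> tuples V n \<longleftrightarrow> x \<in> carrier V \<and> set xs \<subseteq> carrier V \<and> set ys \<subseteq> carrier V \<and>
     length xs + Suc (length ys) = n"
  by (auto simp: tuples_def)

context
  fixes K :: "('k, 'c) ring_scheme" and V :: "('k, 'v, 'm) module_scheme" and n :: nat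
  assumes V: "module K V"
begin

interpretation V: module K V by (rule V)

private abbreviation (input) "FT \<equiv> free_module K (tuples V n)"
private abbreviation (input) "RT \<equiv> tensor_power_relations K V n"

private lemmas mFT = module_free_module[OF V.R.cring_axioms, of "tuples V n"]
interpretation F: module K FT by (rule mFT)

private lemma eT: "xs \<in> tuples V n \<Longrightarrow> basis_vec K xs \<in> carrier FT"
  by (rule basis_vec_closed[OF V.R.cring_axioms])

private lemma RT: "RT \<subseteq> carrier FT"
proof
  fix r assume "r \<in> RT"
  then show "r \<in> carrier FT"
    unfolding tensor_power_relations_def Let_def
    by (elim UnE CollectE exE conjE; hypsubst)
       (intro F.minus_closed F.a_closed F.smult_closed eT; auto simp: tuples_append_Cons)+
qed

private lemmas NT = submodule_module_span[OF mFT RT]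

lemma module_tensor_power: "module K (tensor_power K V n)"
  unfolding tensor_power_def tensor_power_null_eq by (rule module_presented[OF V.R.cring_axioms RT])

lemma generates_tensor_power:
  "generates K (tensor_power K V n) (pure_tensor_list K V ` tuples V n)"
proof -
  have "pure_tensor_list K V ` tuples V n =
      (\<lambda>p. tensor_power_null K V n +>\<^bsub>FT\<^esub> basis_vec K p) ` tuples V n"
    by (auto simp: pure_tensor_list_def tuples_def)
  then show ?thesis
    using generates_presented[OF V.R.cring_axioms RT]
    unfolding tensor_power_null_eq tensor_power_def by simp
qed

lemma multilinear_pure_tensor_list:
  "multilinear K V n (tensor_power K V n) (pure_tensor_list K V)"
  unfolding multilinear_def
proof (intro allI impI)
  fix xs ys
  assume "set xs \<subseteq> carrier V \<and> set ys \<subseteq> carrier V \<and> length xs + Suc (length ys) = n"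
  then have t: "xs @ x # ys \<in> tuples V n" if "x \<in> carrier V" for x
    using that by (simp add: tuples_append_Cons)
  let ?N = "module_span K FT RT"
  have p: "pure_tensor_list K V (xs @ x # ys) = ?N +>\<^bsub>FT\<^esub> basis_vec K (xs @ x # ys)"
    if "x \<in> carrier V" for x
    using t[OF that] unfolding pure_tensor_list_def tensor_power_null_eq by (simp add: tuples_def)
  have Q: "tensor_power K V n = quotient_module FT ?N"
    unfolding tensor_power_def tensor_power_null_eq ..
  note q = quotient_module_add[OF mFT NT] quotient_module_smult[OF mFT NT]
  note rel = presented_relation[OF V.R.cring_axioms RT]
  show "linear_map K V (tensor_power K V n) (\<lambda>x. pure_tensor_list K V (xs @ x # ys))"
  proof (rule linear_mapI)
    fix x assume x: "x \<in> carrier V"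
    show "pure_tensor_list K V (xs @ x # ys) \<in> carrier (tensor_power K V n)"
      unfolding p[OF x] Q quotient_module_carrier[OF mFT NT] using eT[OF t[OF x]] by (rule imageI)
    {
      fix x' assume x': "x' \<in> carrier V"
      have "basis_vec K (xs @ (x \<oplus>\<^bsub>V\<^esub> x') # ys) \<ominus>\<^bsub>FT\<^esub>
          (basis_vec K (xs @ x # ys) \<oplus>\<^bsub>FT\<^esub> basis_vec K (xs @ x' # ys)) \<in> RT"
        unfolding tensor_power_relations_def Let_def using x' t[OF x] by blast
      from rel[OF this]
      show "pure_tensor_list K V (xs @ (x \<oplus>\<^bsub>V\<^esub> x') # ys) =
          pure_tensor_list K V (xs @ x # ys) \<oplus>\<^bsub>tensor_power K V n\<^esub> pure_tensor_list K V (xs @ x' # ys)"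
        unfolding Q using x x' eT t by (simp add: p q)
    }
    fix a assume a: "a \<in> carrier K"
    have "basis_vec K (xs @ (a \<odot>\<^bsub>V\<^esub> x) # ys) \<ominus>\<^bsub>FT\<^esub> (a \<odot>\<^bsub>FT\<^esub> basis_vec K (xs @ x # ys)) \<in> RT"
      unfolding tensor_power_relations_def Let_def using a t[OF x] by blast
    from rel[OF this]
    show "pure_tensor_list K V (xs @ (a \<odot>\<^bsub>V\<^esub> x) # ys) =
        a \<odot>\<^bsub>tensor_power K V n\<^esub> pure_tensor_list K V (xs @ x # ys)"
      unfolding Q using a x eT t by (simp add: p q)
  qed
qed

lemma tensor_power_lift:
  assumes P: "module K P" and g: "multilinear K V n P g" and n: "n > 0"
  obtains h where "linear_map K (tensor_power K V n) P h"
    "\<And>xs. xs \<in> tuples V n \<Longrightarrow> h (pure_tensor_list K V xs) = g xs"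
proof -
  interpret P: module K P by (rule P)
  have "g \<in> tuples V n \<rightarrow> carrier P" using multilinear_closed[OF g _ n] by auto
  moreover have "h s = \<zero>\<^bsub>P\<^esub>"
    if h: "linear_map K FT P h" and hg: "\<And>xs. xs \<in> tuples V n \<Longrightarrow> h (basis_vec K xs) = g xs"
      and s: "s \<in> RT" for h s
  proof -
    note hl = linear_mapD[OF h]
    have z: "x \<ominus>\<^bsub>P\<^esub> x = \<zero>\<^bsub>P\<^esub>" if "x \<in> carrier P" for x
      using that by (simp add: a_minus_def P.r_neg)
    note [simp] = linear_map_minus[OF mFT P h] hl eT hg tuples_append_Cons linear_mapD[OF multilinearD[OF g]]
    show ?thesis
      using s unfolding tensor_power_relations_def Let_def
      by (elim UnE CollectE exE conjE; hypsubst) (simp_all add: z)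
  qed
  ultimately obtain h where "linear_map K (quotient_module FT (module_span K FT RT)) P h"
     "\<And>xs. xs \<in> tuples V n \<Longrightarrow> h (module_span K FT RT +>\<^bsub>FT\<^esub> basis_vec K xs) = g xs"
    using presented_lift[OF V.R.cring_axioms RT P, of g] by metis
  then show ?thesis
    by (intro that[of h]) (auto simp: tensor_power_null_eq tensor_power_def pure_tensor_list_def tuples_def)
qed

end

subsection \<open>Letters\<close>

context
  fixes K :: "('k, 'c) ring_scheme" and V :: "('k, 'v, 'm) module_scheme"
  assumes V: "module K V"
begin

interpretation V: module K V by (rule V)

private lemma KO: "module K (KOmega K :: ('k, 'o \<Rightarrow> 'k) module)"
  unfolding KOmega_def by (rule module_free_module[OF V.R.cring_axioms])

private lemma basis: "basis_vec K \<alpha> \<in> carrier (KOmega K)"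
  unfolding KOmega_def by (rule basis_vec_closed[OF V.R.cring_axioms UNIV_I])

lemma module_letter_space: "module K (letter_space K V :: ('k, (('o \<Rightarrow> 'k) \<times> 'v \<Rightarrow> 'k) set) module)"
  unfolding letter_space_def by (rule module_tensor[OF KO V])

lemma linear_map_letter: "linear_map K V (letter_space K V) (\<lambda>u. letter K V (\<alpha>, u))"
  unfolding letter_space_def letter_def prod.case
  by (rule linear_map_pure_tensor_right[OF KO V basis])

text \<open>For fixed \<open>u\<close> a pure tensor is linear in its first factor, and
  \<open>KOmega K\<close> is generated by its basis vectors; hence the elements \<alpha>u already
  produce all pure tensors.\<close>

lemma generates_letter_space:
  "generates K (letter_space K V) (letter K V ` (UNIV \<times> carrier V))"
proof (rule generatesI[OF module_letter_space])
  let ?L = "letter_space K V"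
  show "letter K V ` (UNIV \<times> carrier V) \<subseteq> carrier ?L"
    using linear_mapD(1)[OF linear_map_letter] by auto
  fix U assume U: "submodule U K ?L" "letter K V ` (UNIV \<times> carrier V) \<subseteq> U"
  have "pure_tensor K (KOmega K) V f u \<in> U" if f: "f \<in> carrier (KOmega K)" and u: "u \<in> carrier V" for f u
  proof -
    have gen: "generates K (KOmega K) (basis_vec K ` UNIV)"
      unfolding KOmega_def by (rule generates_free_module[OF V.R.cring_axioms])
    have lin: "linear_map K (KOmega K) ?L (\<lambda>f. pure_tensor K (KOmega K) V f u)"
      unfolding letter_space_def by (rule linear_map_pure_tensor_left[OF KO V u])
    have "pure_tensor K (KOmega K) V s u \<in> U" if "s \<in> range (basis_vec K)" for s
      using that U(2) u unfolding letter_def by force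
    from generates_linear_image[OF KO module_letter_space gen lin U(1) this f] show ?thesis .
  qed
  then have "{pure_tensor K (KOmega K) V x y |x y. x \<in> carrier (KOmega K) \<and> y \<in> carrier V} \<subseteq> U"
    by auto
  from generates_induct[OF generates_tensor[OF KO V] U(1)[unfolded letter_space_def] this]
  show "carrier ?L \<subseteq> U" unfolding letter_space_def .
qed

text \<open>Induced by the bilinear map sending \<open>(f, u)\<close> to \<open>f \<alpha>\<close>
  times \<open>u\<close>. These coordinates recover labels from elements of the letter space, which
  is abstractly a sum of copies of \<open>V\<close> indexed by \<Omega>.\<close>

lemma letter_coordinate:
  obtains c where "linear_map K (letter_space K V) V c"
    "\<And>\<beta> u. u \<in> carrier V \<Longrightarrow> c (letter K V (\<beta>, u)) = (if \<alpha> = \<beta> then u else \<zero>\<^bsub>V\<^esub>)"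
proof -
  have KOc: "f x \<in> carrier K" if "f \<in> carrier (KOmega K)" for f and x :: 'o
    using free_module_carrierD[OF V.R.cring_axioms] that unfolding KOmega_def by metis
  have KOo: "f \<oplus>\<^bsub>KOmega K\<^esub> g = (\<lambda>x. f x \<oplus>\<^bsub>K\<^esub> g x)" "a \<odot>\<^bsub>KOmega K\<^esub> f = (\<lambda>x. a \<otimes>\<^bsub>K\<^esub> f x)"
    for a and f g :: "'o \<Rightarrow> 'k"
    by (simp_all add: KOmega_def free_module_simps)
  have "linear_map K (KOmega K) V (\<lambda>f. f \<alpha> \<odot>\<^bsub>V\<^esub> u)" if "u \<in> carrier V" for u
    by (rule linear_mapI) (use that KOc[of _ \<alpha>] in
      \<open>simp_all add: KOo V.smult_l_distr V.smult_assoc1\<close>)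
  moreover have "linear_map K V V (\<lambda>u. f \<alpha> \<odot>\<^bsub>V\<^esub> u)" if "f \<in> carrier (KOmega K)" for f
  proof (rule linear_mapI)
    fix a u assume "a \<in> carrier K" "u \<in> carrier V"
    then show "f \<alpha> \<odot>\<^bsub>V\<^esub> (a \<odot>\<^bsub>V\<^esub> u) = a \<odot>\<^bsub>V\<^esub> (f \<alpha> \<odot>\<^bsub>V\<^esub> u)"
      using KOc[OF that] by (metis V.smult_assoc1 V.R.m_comm)
  qed (use KOc[OF that] V.smult_r_distr in auto)
  ultimately obtain c where c: "linear_map K (tensor K (KOmega K) V) V c"
    "\<And>f u. f \<in> carrier (KOmega K) \<Longrightarrow> u \<in> carrier V \<Longrightarrow> c (pure_tensor K (KOmega K) V f u) = f \<alpha> \<odot>\<^bsub>V\<^esub> u"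
    using tensor_lift[OF KO V V, of "\<lambda>f u. f \<alpha> \<odot>\<^bsub>V\<^esub> u"] by metis
  show ?thesis
  proof (rule that[of c])
    show "linear_map K (letter_space K V) V c" using c(1) by (simp add: letter_space_def)
    fix \<beta> u assume u: "u \<in> carrier V"
    have "c (letter K V (\<beta>, u)) = basis_vec K \<beta> \<alpha> \<odot>\<^bsub>V\<^esub> u"
      using c(2)[OF basis u] by (simp add: letter_def)
    then show "c (letter K V (\<beta>, u)) = (if \<alpha> = \<beta> then u else \<zero>\<^bsub>V\<^esub>)"
      using u by (auto simp: basis_vec_def)
  qed
qed

end

subsection \<open>Words\<close>

definition words :: "('k, 'v, 'm) module_scheme \<Rightarrow> ('o \<times> 'v) list set" where
  "words V = {ps. ps \<noteq> [] \<and> snd ` set ps \<subseteq> carrier V}"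

text \<open>Linearity is asked in the vectors only, with the labels fixed: labels form a basis of
  \<open>KOmega K\<close>, so no condition links the values at different labels. All lengths are
  treated at once, as products change the length.\<close>

definition word_multilinear ::
    "('k, 'c) ring_scheme \<Rightarrow> ('k, 'v, 'm) module_scheme \<Rightarrow> ('k, 'w, 'n) module_scheme
      \<Rightarrow> (('o \<times> 'v) list \<Rightarrow> 'w) \<Rightarrow> bool" where
  "word_multilinear K V W g \<longleftrightarrow>
     (\<forall>as \<alpha> bs. snd ` set as \<subseteq> carrier V \<and> snd ` set bs \<subseteq> carrier V \<longrightarrow>
        linear_map K V W (\<lambda>u. g (as @ (\<alpha>, u) # bs)))"

lemma word_multilinearI:
  assumes "\<And>as \<alpha> bs. snd ` set as \<subseteq> carrier V \<Longrightarrow> snd ` set bs \<subseteq> carrier V \<Longrightarrow>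
    linear_map K V W (\<lambda>u. g (as @ (\<alpha>, u) # bs))"
  shows "word_multilinear K V W g"
  using assms by (auto simp: word_multilinear_def)

lemma word_multilinearD:
  assumes "word_multilinear K V W g" "snd ` set as \<subseteq> carrier V" "snd ` set bs \<subseteq> carrier V"
  shows "linear_map K V W (\<lambda>u. g (as @ (\<alpha>, u) # bs))"
  using assms by (auto simp: word_multilinear_def)

lemma word_multilinear_closed:
  assumes "word_multilinear K V W g" "ps \<in> words V"
  shows "g ps \<in> carrier W"
proof -
  obtain \<alpha> u bs where ps: "ps = [] @ (\<alpha>, u) # bs"
    using assms(2) by (cases ps) (auto simp: words_def)
  show ?thesis
    unfolding ps by (rule linear_mapD(1)[OF word_multilinearD[OF assms(1)]])
      (use assms(2) ps in \<open>auto simp: words_def\<close>)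
qed

context
  fixes K :: "('k, 'c) ring_scheme" and V :: "('k, 'v, 'm) module_scheme"
  assumes V: "module K V"
begin

interpretation V: module K V by (rule V)

private abbreviation (input) "LS \<equiv> letter_space K V"
private lemmas letters_module = module_letter_space[OF V]

lemma letters_in_tuples:
  "snd ` set ps \<subseteq> carrier V \<Longrightarrow> map (letter K V) ps \<in> tuples LS (length ps)"
proof -
  assume ps: "snd ` set ps \<subseteq> carrier V"
  have "letter K V p \<in> carrier LS" if "p \<in> set ps" for p
  proof -
    have "snd p \<in> carrier V" using ps that by auto
    from linear_mapD(1)[OF linear_map_letter[OF V] this, of "fst p"] show ?thesis by simp
  qed
  then show ?thesis by (auto simp: tuples_def)
qed

text \<open>The slots are treated one at a time: a pure tensor is linear in each of them, and the
  letter space is generated by the elements \<alpha>u.\<close>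

lemma generates_letter_words:
  "generates K (tensor_power K LS n)
     {pure_tensor_list K LS (map (letter K V) ps) | ps :: ('o \<times> 'v) list. length ps = n \<and> snd ` set ps \<subseteq> carrier V}"
proof (rule generatesI[OF module_tensor_power[OF letters_module]])
  let ?L = "letter_space K V :: ('k, (('o \<Rightarrow> 'k) \<times> 'v \<Rightarrow> 'k) set) module"
  let ?T = "tensor_power K ?L n"
  have "pure_tensor_list K ?L ` tuples ?L n \<subseteq> carrier ?T"
    using generates_tensor_power[OF letters_module] unfolding generates_def by blast
  moreover have "{pure_tensor_list K ?L (map (letter K V) ps) | ps. length ps = n \<and> snd ` set ps \<subseteq> carrier V}
      \<subseteq> pure_tensor_list K ?L ` tuples ?L n"
    using letters_in_tuples by auto
  ultimately show "{pure_tensor_list K ?L (map (letter K V) ps) | ps. length ps = n \<and> snd ` set ps \<subseteq> carrier V}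
      \<subseteq> carrier ?T"
    by (rule subset_trans[rotated])
  fix U assume U: "submodule U K ?T"
    "{pure_tensor_list K ?L (map (letter K V) ps) | ps. length ps = n \<and> snd ` set ps \<subseteq> carrier V} \<subseteq> U"
  \<comment> \<open>Generalised to an arbitrary front \<open>xs\<close> and a tail that already
    consists of letters \<alpha>u. The induction moves the border to the left, so the hypothesis is
    used with a longer tail.\<close>
  have "pure_tensor_list K ?L (xs @ map (letter K V) ps) \<in> U"
    if "set xs \<subseteq> carrier ?L" "snd ` set ps \<subseteq> carrier V" "length xs + length ps = n" for xs ps
    using that
  proof (induction xs arbitrary: ps rule: rev_induct)
    case Nil
    then show ?case using U(2) by auto
  next
    case (snoc x xs)
    have s: "set (map (letter K V) ps) \<subseteq> carrier ?L"
      using letters_in_tuples[OF snoc.prems(2)] unfolding tuples_def by blast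
    have xs: "set xs \<subseteq> carrier ?L" and x: "x \<in> carrier ?L" using snoc.prems(1) by auto
    have n: "length xs + Suc (length ps) = n" using snoc.prems(3) by simp
    have lin: "linear_map K ?L ?T (\<lambda>x. pure_tensor_list K ?L (xs @ x # map (letter K V) ps))"
      by (rule multilinearD[OF multilinear_pure_tensor_list[OF letters_module] xs s]) (use n in simp)
    have "pure_tensor_list K ?L (xs @ s # map (letter K V) ps) \<in> U"
      if "s \<in> letter K V ` (UNIV \<times> carrier V)" for s
    proof -
      obtain \<alpha> u where s: "s = letter K V (\<alpha>, u)" "u \<in> carrier V" using \<open>s \<in> _\<close> by auto
      have "pure_tensor_list K ?L (xs @ map (letter K V) ((\<alpha>, u) # ps)) \<in> U"
        by (rule snoc.IH[OF xs]) (use snoc.prems(2) s(2) n in auto)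
      then show ?thesis by (simp add: s(1))
    qed
    from generates_linear_image[OF letters_module module_tensor_power[OF letters_module] generates_letter_space[OF V] lin U(1) this x]
    show ?case by simp
  qed
  from this[of _ "[]"] have "pure_tensor_list K ?L xs \<in> U" if "xs \<in> tuples ?L n" for xs
    using that by (simp add: tuples_def)
  then have "pure_tensor_list K ?L ` tuples ?L n \<subseteq> U" by blast
  then show "carrier ?T \<subseteq> U" by (rule generates_induct[OF generates_tensor_power[OF letters_module] U(1)])
qed

text \<open>Every letter is the sum of its coordinates \<open>\<alpha> u\<^sub>\<alpha>\<close>, so a multilinear function of letters is
  forced to be the sum of its values on all labellings of the coordinates; this sum is finite
  because \<open>\<Omega>\<close> is.\<close>
lemma letter_words_lift:
  fixes g :: "('o::finite \<times> 'v) list \<Rightarrow> 'w" and P :: "('k, 'w, 'n) module_scheme"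
  assumes P: "module K P" and g: "word_multilinear K V P g" and n: "n > 0"
  obtains h where "linear_map K (tensor_power K LS n) P h"
    "\<And>ps. length ps = n \<Longrightarrow> snd ` set ps \<subseteq> carrier V \<Longrightarrow>
       h (pure_tensor_list K LS (map (letter K V) ps)) = g ps"
proof -
  let ?L = "letter_space K V :: ('k, (('o \<Rightarrow> 'k) \<times> 'v \<Rightarrow> 'k) set) module"
  interpret P: module K P by (rule P)
  have "\<forall>\<alpha>::'o. \<exists>c. linear_map K ?L V c \<and>
    (\<forall>\<beta>::'o. \<forall>u\<in>carrier V. c (letter K V (\<beta>, u)) = (if \<alpha> = \<beta> then u else \<zero>\<^bsub>V\<^esub>))"
  proof
    fix \<alpha> :: 'o
    obtain c where "linear_map K ?L V c"
      "\<And>\<beta> u. u \<in> carrier V \<Longrightarrow> c (letter K V (\<beta>, u)) = (if \<alpha> = \<beta> then u else \<zero>\<^bsub>V\<^esub>)"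
      using letter_coordinate[OF V, of \<alpha> thesis] by simp
    then show "\<exists>c. linear_map K ?L V c \<and>
      (\<forall>\<beta>. \<forall>u\<in>carrier V. c (letter K V (\<beta>, u)) = (if \<alpha> = \<beta> then u else \<zero>\<^bsub>V\<^esub>))"
      by blast
  qed
  then obtain c where c: "\<And>\<alpha>. linear_map K ?L V (c \<alpha>)"
    and cl: "\<And>\<alpha> \<beta> u. u \<in> carrier V \<Longrightarrow> c \<alpha> (letter K V (\<beta>, u)) = (if \<alpha> = \<beta> then u else \<zero>\<^bsub>V\<^esub>)"
    unfolding choice_iff by metis
  define I where "I = {as :: 'o list. length as = n}"
  have I: "finite I" unfolding I_def using finite_lists_length_eq[of "UNIV :: 'o set"] by simp
  \<comment> \<open>\<open>t as xs\<close> replaces each entry of \<open>xs\<close> by its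
    coordinate at the prescribed label and remembers that label.\<close>
  define t where "t as xs = map2 (\<lambda>\<alpha> x. (\<alpha>, c \<alpha> x)) as xs" for as xs
  have tV: "snd ` set (t as xs) \<subseteq> carrier V" if "set xs \<subseteq> carrier ?L" for as xs
    using that linear_mapD(1)[OF c] unfolding t_def by (auto dest!: set_zip_rightD)
  have "multilinear K ?L n P (\<lambda>xs. finsum P (\<lambda>as. g (t as xs)) I)"
    unfolding multilinear_def
  proof (intro allI impI linear_map_finsum[OF letters_module P I])
    fix xs ys as
    assume xy: "set xs \<subseteq> carrier ?L \<and> set ys \<subseteq> carrier ?L \<and> length xs + Suc (length ys) = n"
      and as: "as \<in> I"
    then have l: "length xs < length as" by (auto simp: I_def)
    \<comment> \<open>The labelling is cut at the varying slot, so that only the middle letter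
      depends on \<open>x\<close>, and linearly so.\<close>
    define \<alpha> bs cs where "\<alpha> = as ! length xs" and "bs = take (length xs) as" and "cs = drop (Suc (length xs)) as"
    have "as = bs @ \<alpha> # cs" unfolding bs_def cs_def \<alpha>_def by (rule id_take_nth_drop[OF l])
    moreover have "length bs = length xs" using l by (simp add: bs_def)
    ultimately have "t as (xs @ x # ys) = t bs xs @ (\<alpha>, c \<alpha> x) # t cs ys" for x
      by (simp add: t_def)
    then show "linear_map K ?L P (\<lambda>x. g (t as (xs @ x # ys)))"
      using linear_map_comp[OF c word_multilinearD[OF g tV tV]] xy by simp
  qed
  then obtain h where h: "linear_map K (tensor_power K ?L n) P h"
      "\<And>xs. xs \<in> tuples ?L n \<Longrightarrow> h (pure_tensor_list K ?L xs) = finsum P (\<lambda>as. g (t as xs)) I"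
    using tensor_power_lift[OF letters_module P _ n] by metis
  show ?thesis
  proof (rule that[OF h(1)])
    fix ps :: "('o \<times> 'v) list" assume ps: "length ps = n" "snd ` set ps \<subseteq> carrier V"
    let ?xs = "map (letter K V) ps"
    have xs: "?xs \<in> tuples ?L n" using letters_in_tuples[OF ps(2)] ps(1) by simp
    \<comment> \<open>With its own labels, a word is returned unchanged.\<close>
    have t0: "t (map fst ps) ?xs = ps"
    proof (rule nth_equalityI)
      fix i assume "i < length (t (map fst ps) ?xs)"
      then have i: "i < length ps" by (simp add: t_def)
      obtain \<beta> u where bu: "ps ! i = (\<beta>, u)" by (cases "ps ! i")
      have "u \<in> carrier V" using ps(2) nth_mem[OF i] bu by force
      then show "t (map fst ps) ?xs ! i = ps ! i" using i bu cl by (simp add: t_def)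
    qed (simp add: t_def)
    \<comment> \<open>A wrong label at position \<open>i\<close> makes the coordinate there zero,
      and a linear map in that slot sends zero to zero. Only one summand survives.\<close>
    have other: "g (t as ?xs) = \<zero>\<^bsub>P\<^esub>" if as: "as \<in> I" "as \<noteq> map fst ps" for as
    proof -
      obtain i where i: "i < n" "as ! i \<noteq> fst (ps ! i)"
        using as ps(1) nth_equalityI[of as "map fst ps"] unfolding I_def by auto
      obtain \<beta> u where bu: "ps ! i = (\<beta>, u)" by (cases "ps ! i")
      have u: "u \<in> carrier V" using ps nth_mem[of i ps] i bu by force
      have "t as ?xs ! i = (as ! i, \<zero>\<^bsub>V\<^esub>)"
        using i as ps(1) bu u cl by (simp add: t_def I_def)
      moreover have l: "i < length (t as ?xs)" using i as ps(1) by (simp add: t_def I_def)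
      ultimately have eq: "t as ?xs = take i (t as ?xs) @ (as ! i, \<zero>\<^bsub>V\<^esub>) # drop (Suc i) (t as ?xs)"
        using id_take_nth_drop[OF l] by simp
      have "snd ` set (t as ?xs) \<subseteq> carrier V" using tV xs by (simp add: tuples_def)
      then have "linear_map K V P (\<lambda>u. g (take i (t as ?xs) @ (as ! i, u) # drop (Suc i) (t as ?xs)))"
        by (intro word_multilinearD[OF g]) (auto dest: in_set_takeD in_set_dropD)
      from linear_map_zero[OF V P this] show ?thesis using eq by simp
    qed
    have gc: "g (t as ?xs) \<in> carrier P" if "as \<in> I" for as
    proof (rule word_multilinear_closed[OF g])
      show "t as ?xs \<in> words V"
        using tV[of ?xs as] xs that n ps(1) unfolding words_def by (auto simp: tuples_def I_def t_def)
    qed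
    have "finsum P (\<lambda>as. g (t as ?xs)) I = supp_sum P I (\<lambda>as. g (t as ?xs))"
      by (rule supp_sum_eq[OF P _ I, symmetric]) (use gc in auto)
    also have "\<dots> = g (t (map fst ps) ?xs)"
      by (rule supp_sum_single[OF P]) (use gc other ps in \<open>auto simp: I_def\<close>)
    finally show "h (pure_tensor_list K ?L ?xs) = g ps" using h(2)[OF xs] t0 by simp
  qed
qed

end

subsection \<open>Direct sums\<close>

lemma direct_sum_simps:
  "carrier (direct_sum V W) = carrier V \<times> carrier W"
  "\<zero>\<^bsub>direct_sum V W\<^esub> = (\<zero>\<^bsub>V\<^esub>, \<zero>\<^bsub>W\<^esub>)"
  "x \<oplus>\<^bsub>direct_sum V W\<^esub> y = (fst x \<oplus>\<^bsub>V\<^esub> fst y, snd x \<oplus>\<^bsub>W\<^esub> snd y)"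
  "a \<odot>\<^bsub>direct_sum V W\<^esub> x = (a \<odot>\<^bsub>V\<^esub> fst x, a \<odot>\<^bsub>W\<^esub> snd x)"
  by (simp_all add: direct_sum_def)

lemma module_direct_sum:
  assumes "module K V" "module K W"
  shows "module K (direct_sum V W)"
proof -
  interpret V: module K V by fact
  interpret W: module K W by fact
  show ?thesis
  proof (rule moduleI)
    show "abelian_group (direct_sum V W)"
    proof (rule abelian_groupI)
      fix x assume "x \<in> carrier (direct_sum V W)"
      then show "\<exists>y\<in>carrier (direct_sum V W). y \<oplus>\<^bsub>direct_sum V W\<^esub> x = \<zero>\<^bsub>direct_sum V W\<^esub>"
        by (intro bexI[of _ "(\<ominus>\<^bsub>V\<^esub> fst x, \<ominus>\<^bsub>W\<^esub> snd x)"])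
           (auto simp: direct_sum_simps V.l_neg W.l_neg)
    qed (auto simp: direct_sum_simps V.a_ac W.a_ac)
  qed (auto simp: direct_sum_simps V.R.cring_axioms V.smult_l_distr W.smult_l_distr
         V.smult_r_distr W.smult_r_distr V.smult_assoc1 W.smult_assoc1)
qed

lemma direct_sum_family_simps:
  "carrier (direct_sum_family I V) =
     {f \<in> \<Pi>\<^sub>E i\<in>I. carrier (V i). finite {i \<in> I. f i \<noteq> \<zero>\<^bsub>V i\<^esub>}}"
  "\<zero>\<^bsub>direct_sum_family I V\<^esub> = (\<lambda>i\<in>I. \<zero>\<^bsub>V i\<^esub>)"
  "f \<oplus>\<^bsub>direct_sum_family I V\<^esub> g = (\<lambda>i\<in>I. f i \<oplus>\<^bsub>V i\<^esub> g i)"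
  "a \<odot>\<^bsub>direct_sum_family I V\<^esub> f = (\<lambda>i\<in>I. a \<odot>\<^bsub>V i\<^esub> f i)"
  by (simp_all add: direct_sum_family_def)

context
  fixes K :: "('k, 'c) ring_scheme" and V :: "'i \<Rightarrow> ('k, 'v, 'm) module_scheme" and I :: "'i set"
  assumes K: "cring K" and V: "\<And>i. i \<in> I \<Longrightarrow> module K (V i)"
begin

private abbreviation (input) "D \<equiv> direct_sum_family I V"

private lemma group: "i \<in> I \<Longrightarrow> abelian_group (V i)"
  using V module.axioms(2) by blast

text \<open>Elements are extensional functions on \<open>I\<close>, so every identity is checked at
  the indices in \<open>I\<close>, where \<open>V i\<close> is known to be a module.\<close>

lemma module_direct_sum_family: "module K D"
proof -
  have zero [simp]: "\<zero>\<^bsub>V i\<^esub> \<in> carrier (V i)" if "i \<in> I" for i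
    using abelian_monoid.zero_closed abelian_group.axioms(1) group[OF that] by blast
  have neg [simp]: "a_inv (V i) x \<in> carrier (V i)" if "i \<in> I" "x \<in> carrier (V i)" for i x
    using abelian_group.a_inv_closed[OF group[OF that(1)] that(2)] .
  have add: "f \<oplus>\<^bsub>D\<^esub> g \<in> carrier D" if "f \<in> carrier D" "g \<in> carrier D" for f g
  proof -
    have "{i \<in> I. (f \<oplus>\<^bsub>D\<^esub> g) i \<noteq> \<zero>\<^bsub>V i\<^esub>} \<subseteq> {i \<in> I. f i \<noteq> \<zero>\<^bsub>V i\<^esub>} \<union> {i \<in> I. g i \<noteq> \<zero>\<^bsub>V i\<^esub>}"
      using abelian_monoid.l_zero[OF abelian_group.axioms(1)[OF group] zero]
      by (auto simp: direct_sum_family_simps)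
    then have "finite {i \<in> I. (f \<oplus>\<^bsub>D\<^esub> g) i \<noteq> \<zero>\<^bsub>V i\<^esub>}"
      using that by (auto simp: direct_sum_family_simps(1) intro: finite_subset)
    then show ?thesis
      using that abelian_monoid.a_closed[OF abelian_group.axioms(1)[OF group]]
      by (auto simp: direct_sum_family_simps PiE_def Pi_def)
  qed
  have smult: "a \<odot>\<^bsub>D\<^esub> f \<in> carrier D" if "f \<in> carrier D" "a \<in> carrier K" for f a
  proof -
    have "{i \<in> I. (a \<odot>\<^bsub>D\<^esub> f) i \<noteq> \<zero>\<^bsub>V i\<^esub>} \<subseteq> {i \<in> I. f i \<noteq> \<zero>\<^bsub>V i\<^esub>}"
      using module.smult_r_null[OF V that(2)] by (auto simp: direct_sum_family_simps)
    then have "finite {i \<in> I. (a \<odot>\<^bsub>D\<^esub> f) i \<noteq> \<zero>\<^bsub>V i\<^esub>}"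
      using that by (auto simp: direct_sum_family_simps(1) intro: finite_subset)
    then show ?thesis
      using that module.smult_closed[OF V that(2)]
      by (auto simp: direct_sum_family_simps)
  qed
  have comp: "f i \<in> carrier (V i)" if "f \<in> carrier D" "i \<in> I" for f i
    using that by (auto simp: direct_sum_family_simps)
  have ext: "f = g"
    if "f \<in> carrier D" "g \<in> carrier D" "\<And>i. i \<in> I \<Longrightarrow> f i = g i" for f g
    using that by (auto simp: direct_sum_family_simps(1) intro: PiE_ext)
  have z: "\<zero>\<^bsub>D\<^esub> \<in> carrier D" by (auto simp: direct_sum_family_simps)
  have at: "\<zero>\<^bsub>D\<^esub> i = \<zero>\<^bsub>V i\<^esub>" "(f \<oplus>\<^bsub>D\<^esub> g) i = f i \<oplus>\<^bsub>V i\<^esub> g i" "(a \<odot>\<^bsub>D\<^esub> f) i = a \<odot>\<^bsub>V i\<^esub> f i"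
    if "i \<in> I" for i f g a
    using that by (simp_all add: direct_sum_family_simps)
  show ?thesis
  proof (rule moduleI[OF K])
    show "abelian_group D"
    proof (rule abelian_groupI)
      fix f assume f: "f \<in> carrier D"
      \<comment> \<open>As for free modules, the inverse is a scalar multiple, so its membership in
        the carrier follows from \<open>smult\<close>.\<close>
      let ?g = "(\<ominus>\<^bsub>K\<^esub> \<one>\<^bsub>K\<^esub>) \<odot>\<^bsub>D\<^esub> f"
      have m1: "\<ominus>\<^bsub>K\<^esub> \<one>\<^bsub>K\<^esub> \<in> carrier K"
        by (intro abelian_group.a_inv_closed ring.ring_simprules(6) ring.is_abelian_group cring.axioms(1)[OF K])
      have "?g \<oplus>\<^bsub>D\<^esub> f = \<zero>\<^bsub>D\<^esub>"
      proof (rule ext[OF add[OF smult[OF f m1] f] z])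
        fix i assume i: "i \<in> I"
        interpret Vi: module K "V i" by (rule V[OF i])
        show "(?g \<oplus>\<^bsub>D\<^esub> f) i = \<zero>\<^bsub>D\<^esub> i"
          using comp[OF f i] by (simp add: at[OF i] Vi.smult_l_minus Vi.l_neg)
      qed
      then show "\<exists>g\<in>carrier D. g \<oplus>\<^bsub>D\<^esub> f = \<zero>\<^bsub>D\<^esub>" using smult[OF f m1] by blast
    next
      fix f g h assume f: "f \<in> carrier D" and g: "g \<in> carrier D" and h: "h \<in> carrier D"
      show "f \<oplus>\<^bsub>D\<^esub> g \<oplus>\<^bsub>D\<^esub> h = f \<oplus>\<^bsub>D\<^esub> (g \<oplus>\<^bsub>D\<^esub> h)"
      proof (rule ext)
        fix i assume i: "i \<in> I"
        interpret Vi: module K "V i" by (rule V[OF i])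
        show "(f \<oplus>\<^bsub>D\<^esub> g \<oplus>\<^bsub>D\<^esub> h) i = (f \<oplus>\<^bsub>D\<^esub> (g \<oplus>\<^bsub>D\<^esub> h)) i"
          using comp[OF f i] comp[OF g i] comp[OF h i] by (simp add: at[OF i] Vi.a_assoc)
      qed (intro add f g h)+
    next
      fix f g assume f: "f \<in> carrier D" and g: "g \<in> carrier D"
      show "f \<oplus>\<^bsub>D\<^esub> g = g \<oplus>\<^bsub>D\<^esub> f"
      proof (rule ext)
        fix i assume i: "i \<in> I"
        interpret Vi: module K "V i" by (rule V[OF i])
        show "(f \<oplus>\<^bsub>D\<^esub> g) i = (g \<oplus>\<^bsub>D\<^esub> f) i"
          using comp[OF f i] comp[OF g i] by (simp add: at[OF i] Vi.a_comm)
      qed (intro add f g)+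
    next
      fix f assume f: "f \<in> carrier D"
      show "\<zero>\<^bsub>D\<^esub> \<oplus>\<^bsub>D\<^esub> f = f"
      proof (rule ext)
        fix i assume i: "i \<in> I"
        interpret Vi: module K "V i" by (rule V[OF i])
        show "(\<zero>\<^bsub>D\<^esub> \<oplus>\<^bsub>D\<^esub> f) i = f i" using comp[OF f i] by (simp add: at[OF i])
      qed (intro add f z)+
    qed (rule z add; assumption?)+
  next
    fix a b f assume a: "a \<in> carrier K" and b: "b \<in> carrier K" and f: "f \<in> carrier D"
    interpret K: cring K by (rule K)
    show "(a \<oplus>\<^bsub>K\<^esub> b) \<odot>\<^bsub>D\<^esub> f = a \<odot>\<^bsub>D\<^esub> f \<oplus>\<^bsub>D\<^esub> b \<odot>\<^bsub>D\<^esub> f"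
      by (rule ext)
         (use a b f in \<open>simp_all add: add smult at comp module.smult_l_distr[OF V]\<close>)
    show "(a \<otimes>\<^bsub>K\<^esub> b) \<odot>\<^bsub>D\<^esub> f = a \<odot>\<^bsub>D\<^esub> (b \<odot>\<^bsub>D\<^esub> f)"
      by (rule ext)
         (use a b f in \<open>simp_all add: add smult at comp module.smult_assoc1[OF V]\<close>)
  next
    fix a f g assume a: "a \<in> carrier K" and f: "f \<in> carrier D" and g: "g \<in> carrier D"
    show "a \<odot>\<^bsub>D\<^esub> (f \<oplus>\<^bsub>D\<^esub> g) = a \<odot>\<^bsub>D\<^esub> f \<oplus>\<^bsub>D\<^esub> a \<odot>\<^bsub>D\<^esub> g"
      by (rule ext)
         (use a f g in \<open>simp_all add: add smult at comp module.smult_r_distr[OF V]\<close>)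
  next
    fix f assume f: "f \<in> carrier D"
    interpret K: cring K by (rule K)
    show "\<one>\<^bsub>K\<^esub> \<odot>\<^bsub>D\<^esub> f = f"
      by (rule ext) (use f in \<open>simp_all add: smult at comp module.smult_one[OF V]\<close>)
  qed (rule smult)
qed

lemma linear_map_direct_sum_family_single:
  assumes i: "i \<in> I"
  shows "linear_map K (V i) D (\<lambda>x. \<zero>\<^bsub>D\<^esub>(i := x))"
proof -
  interpret Vi: module K "V i" by (rule V[OF i])
  note zero = abelian_monoid.zero_closed[OF abelian_group.axioms(1)[OF group]]
    abelian_monoid.l_zero[OF abelian_group.axioms(1)[OF group]]
  show ?thesis
  proof (rule linear_mapI)
    fix x assume x: "x \<in> carrier (V i)"
    have "{j \<in> I. (\<zero>\<^bsub>D\<^esub>(i := x)) j \<noteq> \<zero>\<^bsub>V j\<^esub>} \<subseteq> {i}" by (auto simp: direct_sum_family_simps)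
    then show "\<zero>\<^bsub>D\<^esub>(i := x) \<in> carrier D"
      using x i zero(1) finite_subset
      by (auto simp: direct_sum_family_simps PiE_def extensional_def split: if_splits)
  next
    fix x y
    show "\<zero>\<^bsub>D\<^esub>(i := x \<oplus>\<^bsub>V i\<^esub> y) = \<zero>\<^bsub>D\<^esub>(i := x) \<oplus>\<^bsub>D\<^esub> \<zero>\<^bsub>D\<^esub>(i := y)"
      using i zero by (intro ext) (simp add: direct_sum_family_simps restrict_def)
  next
    fix a x assume "a \<in> carrier K"
    then show "\<zero>\<^bsub>D\<^esub>(i := a \<odot>\<^bsub>V i\<^esub> x) = a \<odot>\<^bsub>D\<^esub> \<zero>\<^bsub>D\<^esub>(i := x)"
      using i module.smult_r_null[OF V] by (intro ext) (simp add: direct_sum_family_simps restrict_def)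
  qed
qed

lemma direct_sum_family_induct:
  assumes U: "submodule U K D" and s: "\<And>i x. i \<in> I \<Longrightarrow> x \<in> carrier (V i) \<Longrightarrow> \<zero>\<^bsub>D\<^esub>(i := x) \<in> U"
  shows "carrier D \<subseteq> U"
proof
  interpret D: module K D by (rule module_direct_sum_family)
  note zero = abelian_monoid.zero_closed[OF abelian_group.axioms(1)[OF group]]
    abelian_monoid.l_zero[OF abelian_group.axioms(1)[OF group]]
    abelian_monoid.r_zero[OF abelian_group.axioms(1)[OF group]]
  \<comment> \<open>The induction runs over a finite set that contains the support; setting one
    component to zero then reduces to a smaller set.\<close>
  have "f \<in> U" if "finite A" "f \<in> carrier D" "{i \<in> I. f i \<noteq> \<zero>\<^bsub>V i\<^esub>} \<subseteq> A" for A f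
    using that
  proof (induction A arbitrary: f rule: finite_induct)
    case empty
    then have "f = \<zero>\<^bsub>D\<^esub>"
      by (auto simp: direct_sum_family_simps PiE_def extensional_def)
    then show ?case using submodule_zero[OF D.module_axioms U] by simp
  next
    case (insert i A)
    show ?case
    proof (cases "i \<in> I")
      case False
      then show ?thesis using insert by auto
    next
      case True
      let ?f = "f(i := \<zero>\<^bsub>V i\<^esub>)"
      have fi: "f i \<in> carrier (V i)" using insert.prems True by (auto simp: direct_sum_family_simps)
      have "{j \<in> I. ?f j \<noteq> \<zero>\<^bsub>V j\<^esub>} \<subseteq> {i \<in> I. f i \<noteq> \<zero>\<^bsub>V i\<^esub>}" by auto
      then have "finite {j \<in> I. ?f j \<noteq> \<zero>\<^bsub>V j\<^esub>}"
        by (rule finite_subset) (use insert.prems(1) in \<open>simp add: direct_sum_family_simps(1)\<close>)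
      moreover have "?f \<in> (\<Pi>\<^sub>E i\<in>I. carrier (V i))"
        using insert.prems(1) True zero(1)
        by (auto simp: direct_sum_family_simps(1) PiE_def extensional_def Pi_def)
      ultimately have "?f \<in> carrier D" by (simp add: direct_sum_family_simps(1))
      moreover have "{j \<in> I. ?f j \<noteq> \<zero>\<^bsub>V j\<^esub>} \<subseteq> A" using insert.prems by auto
      ultimately have "?f \<in> U" by (rule insert.IH)
      moreover have "f = \<zero>\<^bsub>D\<^esub>(i := f i) \<oplus>\<^bsub>D\<^esub> ?f"
        using insert.prems True fi zero
        by (intro ext) (auto simp: direct_sum_family_simps restrict_def PiE_def extensional_def Pi_def)
      ultimately show ?thesis using D.submoduleE(5)[OF U s[OF True fi]] by metis
    qed
  qed
  then show "f \<in> U" if "f \<in> carrier D" for f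
    using that by (auto simp: direct_sum_family_simps(1))
qed

text \<open>The lift adds up the images of the components. The sum is finite because each
  \<open>h i\<close> maps zero to zero, so its support lies in that of the element.\<close>

lemma direct_sum_family_lift:
  assumes P: "module K P" and h: "\<And>i. i \<in> I \<Longrightarrow> linear_map K (V i) P (h i)"
  shows "\<exists>H. linear_map K D P H \<and> (\<forall>i\<in>I. \<forall>x\<in>carrier (V i). H (\<zero>\<^bsub>D\<^esub>(i := x)) = h i x)"
proof (intro exI conjI ballI)
  interpret P: module K P by (rule P)
  let ?H = "\<lambda>f. supp_sum P I (\<lambda>i. h i (f i))"
  note hl = linear_mapD[OF h]
  note h0 = linear_map_zero[OF V P h]
  have comp: "f i \<in> carrier (V i)" if "f \<in> carrier D" "i \<in> I" for f i
    using that by (auto simp: direct_sum_family_simps)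
  have t: "(\<lambda>i. h i (f i)) \<in> I \<rightarrow> carrier P" if "f \<in> carrier D" for f
    using hl(1) comp[OF that] by auto
  have fin: "finite {i \<in> I. h i (f i) \<noteq> \<zero>\<^bsub>P\<^esub>}" if "f \<in> carrier D" for f
  proof -
    have "{i \<in> I. h i (f i) \<noteq> \<zero>\<^bsub>P\<^esub>} \<subseteq> {i \<in> I. f i \<noteq> \<zero>\<^bsub>V i\<^esub>}" using h0 by auto
    then show ?thesis using that finite_subset by (auto simp: direct_sum_family_simps(1))
  qed
  show "linear_map K D P ?H"
  proof (rule linear_mapI)
    fix f assume f: "f \<in> carrier D"
    show "?H f \<in> carrier P" by (rule supp_sum_closed[OF P t[OF f]])
    {
      fix g assume g: "g \<in> carrier D"
      have "?H (f \<oplus>\<^bsub>D\<^esub> g) = supp_sum P I (\<lambda>i. h i (f i) \<oplus>\<^bsub>P\<^esub> h i (g i))"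
        by (rule supp_sum_cong[OF P])
           (use t[OF f] t[OF g] comp[OF f] comp[OF g] hl in \<open>auto simp: direct_sum_family_simps(3)\<close>)
      also have "\<dots> = ?H f \<oplus>\<^bsub>P\<^esub> ?H g"
        by (rule supp_sum_add[OF P t[OF f] fin[OF f] t[OF g] fin[OF g]])
      finally show "?H (f \<oplus>\<^bsub>D\<^esub> g) = ?H f \<oplus>\<^bsub>P\<^esub> ?H g" .
    }
    fix a assume a: "a \<in> carrier K"
    have "?H (a \<odot>\<^bsub>D\<^esub> f) = supp_sum P I (\<lambda>i. a \<odot>\<^bsub>P\<^esub> h i (f i))"
      by (rule supp_sum_cong[OF P])
         (use a t[OF f] comp[OF f] hl in \<open>auto simp: direct_sum_family_simps(4)\<close>)
    also have "\<dots> = a \<odot>\<^bsub>P\<^esub> ?H f"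
      by (rule supp_sum_smult[OF P t[OF f] fin[OF f] a])
    finally show "?H (a \<odot>\<^bsub>D\<^esub> f) = a \<odot>\<^bsub>P\<^esub> ?H f" .
  qed
  fix i x assume i: "i \<in> I" and x: "x \<in> carrier (V i)"
  have "?H (\<zero>\<^bsub>D\<^esub>(i := x)) = h i ((\<zero>\<^bsub>D\<^esub>(i := x)) i)"
    by (rule supp_sum_single[OF P i]) (use hl(1)[OF i x] h0 in \<open>auto simp: direct_sum_family_simps(2)\<close>)
  then show "?H (\<zero>\<^bsub>D\<^esub>(i := x)) = h i x" by simp
qed

end

subsection \<open>Generators of the space \<open>T\<^sub>\<Omega>\<^sup>2(V)\<close>\<close>

text \<open>A vector \<open>u\<close> of \<open>V\<close> is treated as the one-letter word \<open>\<alpha>u\<close> with an irrelevant label \<open>\<alpha>\<close>.\<close>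
definition T2_gen ::
    "('k, 'c) ring_scheme \<Rightarrow> ('k, 'v, 'm) module_scheme \<Rightarrow> ('o \<times> 'v) list
      \<Rightarrow> ('k, 'o, 'v) T2_elem" where
  "T2_gen K V ps = (if length ps = 1 then T2_incl K V (snd (hd ps)) else T2_word K V ps)"

text \<open>The label of a one-letter word is replaced by the index of the product applied to it, so that
  all four formulas for the products take the form of a concatenation.\<close>
definition relabel :: "'o \<Rightarrow> ('o \<times> 'v) list \<Rightarrow> ('o \<times> 'v) list" where
  "relabel \<alpha> ps = (if length ps = 1 then [(\<alpha>, snd (hd ps))] else ps)"

text \<open>The compatibility forced by \<open>T2_gen\<close>, which forgets the label of a
  one-letter word: without it a function on words could not factor through the generators.\<close>

definition label_free :: "('k, 'v, 'm) module_scheme \<Rightarrow> (('o \<times> 'v) list \<Rightarrow> 'w) \<Rightarrow> bool" where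
  "label_free V g \<longleftrightarrow> (\<forall>\<alpha> \<beta>. \<forall>u\<in>carrier V. g [(\<alpha>, u)] = g [(\<beta>, u)])"

lemma words_cases:
  assumes "ps \<in> words V"
  obtains (single) \<alpha> u where "u \<in> carrier V" "ps = [(\<alpha>, u)]" | (long) "ps \<in> long_words V"
proof (cases "length ps = 1")
  case True
  then obtain \<alpha> u where "ps = [(\<alpha>, u)]" by (cases ps) auto
  then show ?thesis using assms single by (auto simp: words_def)
next
  case False
  then have "length ps \<ge> 2" using assms by (cases ps) (auto simp: words_def Suc_le_eq)
  then show ?thesis using assms long by (auto simp: words_def long_words_def)
qed

lemma long_words_words: "ps \<in> long_words V \<Longrightarrow> ps \<in> words V"
  by (auto simp: words_def long_words_def)

lemma words_single: "u \<in> carrier V \<Longrightarrow> [(\<alpha>, u)] \<in> words V"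
  by (auto simp: words_def)

lemma relabel_words: "ps \<in> words V \<Longrightarrow> relabel \<alpha> ps \<in> words V"
  by (cases ps) (auto simp: words_def relabel_def)

lemma relabel_append: "ps \<noteq> [] \<Longrightarrow> qs \<noteq> [] \<Longrightarrow> relabel \<alpha> (ps @ qs) = ps @ qs"
  by (cases ps; cases qs) (auto simp: relabel_def)

lemma relabel_long: "ps \<in> long_words V \<Longrightarrow> relabel \<alpha> ps = ps"
  by (auto simp: relabel_def long_words_def)

lemma words_append: "ps \<in> words V \<Longrightarrow> qs \<in> words V \<Longrightarrow> ps @ qs \<in> long_words V"
  by (cases ps; cases qs) (auto simp: words_def long_words_def)

lemma T2_gen_single: "T2_gen K V [(\<alpha>, u)] = T2_incl K V u"
  by (simp add: T2_gen_def)

lemma T2_gen_long: "ps \<in> long_words V \<Longrightarrow> T2_gen K V ps = T2_word K V ps"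
  by (auto simp: T2_gen_def long_words_def)

text \<open>The new label can be chosen independently of \<open>u\<close>, so relabelling preserves
  linearity in a slot.\<close>

lemma relabel_letter:
  "\<exists>\<gamma>'. \<forall>u. relabel \<beta> (as @ (\<gamma>, u) # bs) = as @ (\<gamma>', u) # bs"
proof (cases "as = [] \<and> bs = []")
  case True
  then show ?thesis by (simp add: relabel_def)
next
  case False
  then have "length (as @ (\<gamma>, u) # bs) \<noteq> 1" for u by auto
  then show ?thesis by (intro exI[of _ \<gamma>]) (simp only: relabel_def if_False simp_thms)
qed

lemma word_arrow_single: "word_arrow ar [(\<alpha>, u)] = \<alpha>"
  by (simp add: word_arrow_def)

text \<open>Only labels enter the arrow; hence the Kronecker conditions stay constant while one
  vector varies.\<close>

lemma word_arrow_letter: "\<exists>\<epsilon>. \<forall>u. word_arrow ar (as @ (\<gamma>, u) # bs) = \<epsilon>"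
  by (cases as) (auto simp: word_arrow_def)

lemma word_arrow_append:
  assumes "semigroup ar" "ps \<noteq> []" "qs \<noteq> []"
  shows "word_arrow ar (ps @ qs) = ar (word_arrow ar ps) (word_arrow ar qs)"
proof -
  have fold: "foldl ar (ar a b) xs = ar a (foldl ar b xs)" for a b xs
    by (induction xs arbitrary: b) (simp_all add: semigroup.assoc[OF assms(1)])
  obtain p ps' q qs' where "ps = p # ps'" "qs = q # qs'"
    using assms(2,3) by (meson neq_Nil_conv)
  then show ?thesis by (simp add: word_arrow_def fold)
qed

context
  fixes K :: "('k, 'c) ring_scheme" and V :: "('k, 'v, 'm) module_scheme"
    and ar :: "'o::finite \<Rightarrow> 'o \<Rightarrow> 'o"
  assumes V: "module K V"
begin

interpretation V: module K V by (rule V)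

private abbreviation (input) L :: "('k, (('o \<Rightarrow> 'k) \<times> 'v \<Rightarrow> 'k) set) module"
  where "L \<equiv> letter_space K V"
private abbreviation (input)
  TW :: "('k, nat \<Rightarrow> ((('o \<Rightarrow> 'k) \<times> 'v \<Rightarrow> 'k) set list \<Rightarrow> 'k) set) module"
  where "TW \<equiv> T2_words K V"
private abbreviation (input) T :: "('k, ('k, 'o, 'v) T2_elem) module" where "T \<equiv> T2 K V"
private abbreviation (input) gen :: "('o \<times> 'v) list \<Rightarrow> ('k, 'o, 'v) T2_elem"
  where "gen \<equiv> T2_gen K V"

private lemma mL: "module K L" by (rule module_letter_space[OF V])
private lemma mTP: "module K (tensor_power K L n)" by (rule module_tensor_power[OF mL])
private lemma mTW: "module K TW"
  unfolding T2_words_def by (rule module_direct_sum_family[OF V.R.cring_axioms mTP])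
lemma module_T2: "module K T" unfolding T2_def by (rule module_direct_sum[OF V mTW])

interpretation TW: module K TW by (rule mTW)
interpretation T: module K T by (rule module_T2)

private lemmas T_simps = direct_sum_simps[of V "T2_words K V", folded T2_def]

lemma linear_map_T2_incl: "linear_map K V T (T2_incl K V)"
  by (rule linear_mapI) (simp_all add: T2_incl_def T_simps)

private lemma lin_inr: "linear_map K TW T (\<lambda>w. (\<zero>\<^bsub>V\<^esub>, w))"
  by (rule linear_mapI) (simp_all add: T_simps)

private lemma lin_fst: "linear_map K T V fst"
  by (rule linear_mapI) (auto simp: T_simps)

private lemma lin_snd: "linear_map K T TW snd"
  by (rule linear_mapI) (auto simp: T_simps)

private lemma lin_single: "n \<ge> 2 \<Longrightarrow> linear_map K (tensor_power K L n) TW (\<lambda>x. \<zero>\<^bsub>TW\<^esub>(n := x))"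
  unfolding T2_words_def
  by (rule linear_map_direct_sum_family_single[OF V.R.cring_axioms mTP]) simp

text \<open>For at least two letters, the dependence on one vector is a composite of four linear
  maps: forming the letter, inserting it in a slot of the pure tensor, placing the result in its
  degree, and embedding the word part into the direct sum.\<close>

lemma word_multilinear_T2_gen: "word_multilinear K V T gen"
proof (rule word_multilinearI)
  fix as bs :: "('o \<times> 'v) list" and \<alpha>
  assume as: "snd ` set as \<subseteq> carrier V" and bs: "snd ` set bs \<subseteq> carrier V"
  show "linear_map K V T (\<lambda>u. gen (as @ (\<alpha>, u) # bs))"
  proof (cases "as = [] \<and> bs = []")
    case True
    then show ?thesis using linear_map_T2_incl by (simp add: T2_gen_single)
  next
    case False
    let ?n = "length as + Suc (length bs)"
    have n: "?n \<ge> 2" using False by (cases as; cases bs) auto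
    have "gen (as @ (\<alpha>, u) # bs) = (\<zero>\<^bsub>V\<^esub>, \<zero>\<^bsub>TW\<^esub>(?n :=
        pure_tensor_list K L (map (letter K V) as @ letter K V (\<alpha>, u) # map (letter K V) bs)))" for u
      using False by (auto simp: T2_gen_def T2_word_def)
    moreover have "set (map (letter K V) as) \<subseteq> carrier L" "set (map (letter K V) bs) \<subseteq> carrier L"
      using letters_in_tuples[OF V as] letters_in_tuples[OF V bs] by (simp_all add: tuples_def)
    then have "linear_map K L (tensor_power K L ?n)
        (\<lambda>x. pure_tensor_list K L (map (letter K V) as @ x # map (letter K V) bs))"
      by (rule multilinearD[OF multilinear_pure_tensor_list[OF mL]]) simp
    from linear_map_comp[OF linear_map_comp[OF linear_map_comp[OF linear_map_letter[OF V] this]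
        lin_single[OF n]] lin_inr]
    have "linear_map K V T (\<lambda>u. (\<zero>\<^bsub>V\<^esub>, \<zero>\<^bsub>TW\<^esub>(?n :=
        pure_tensor_list K L (map (letter K V) as @ letter K V (\<alpha>, u) # map (letter K V) bs))))" .
    ultimately show ?thesis by simp
  qed
qed

lemma T2_gen_closed: "ps \<in> words V \<Longrightarrow> gen ps \<in> carrier T"
  by (rule word_multilinear_closed[OF word_multilinear_T2_gen])

lemma generates_T2: "generates K T (gen ` words V)"
proof (rule generatesI[OF module_T2])
  show "gen ` words V \<subseteq> carrier T" using T2_gen_closed by (rule image_subsetI)
  fix U assume U: "submodule U K T" "gen ` words V \<subseteq> U"
  have single: "(\<zero>\<^bsub>V\<^esub>, \<zero>\<^bsub>TW\<^esub>(n := x)) \<in> U" if n: "n \<ge> 2" and x: "x \<in> carrier (tensor_power K L n)" for n x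
  proof -
    have "(\<zero>\<^bsub>V\<^esub>, \<zero>\<^bsub>TW\<^esub>(n := s)) \<in> U"
      if "s \<in> {pure_tensor_list K L (map (letter K V) ps) | ps. length ps = n \<and> snd ` set ps \<subseteq> carrier V}" for s
    proof -
      obtain ps :: "('o \<times> 'v) list" where ps: "length ps = n" "snd ` set ps \<subseteq> carrier V"
        and s: "s = pure_tensor_list K L (map (letter K V) ps)" using \<open>s \<in> _\<close> by blast
      have l: "ps \<in> long_words V" using ps n by (simp add: long_words_def)
      have "gen ps \<in> U" using long_words_words[OF l] U(2) by blast
      then show ?thesis unfolding T2_gen_long[OF l] T2_word_def using s ps by simp
    qed
    from generates_linear_image[OF mTP module_T2 generates_letter_words[OF V]
        linear_map_comp[OF lin_single[OF n] lin_inr] U(1) this x]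
    show ?thesis .
  qed
  \<comment> \<open>The word part is reached degree by degree: the preimage of \<open>U\<close> is a
    submodule containing every element concentrated in one degree.\<close>
  have "carrier TW \<subseteq> {w \<in> carrier TW. (\<zero>\<^bsub>V\<^esub>, w) \<in> U}"
    using submodule_vimage[OF mTW module_T2 lin_inr U(1)] single linear_mapD(1)[OF lin_single]
    unfolding T2_words_def
    by (intro direct_sum_family_induct[OF V.R.cring_axioms mTP]) auto
  then have w: "(\<zero>\<^bsub>V\<^esub>, w) \<in> U" if "w \<in> carrier TW" for w using that by blast
  have v: "(v, \<zero>\<^bsub>TW\<^esub>) \<in> U" if "v \<in> carrier V" for v
    using U(2) words_single[OF that] T2_gen_single[of K V _ v] unfolding T2_incl_def
    by (metis image_subset_iff)
  show "carrier T \<subseteq> U"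
  proof
    fix x assume "x \<in> carrier T"
    then have x: "fst x \<in> carrier V" "snd x \<in> carrier TW" by (auto simp: T_simps)
    have "x = (fst x, \<zero>\<^bsub>TW\<^esub>) \<oplus>\<^bsub>T\<^esub> (\<zero>\<^bsub>V\<^esub>, snd x)"
      using x by (simp add: T_simps)
    then show "x \<in> U" using T.submoduleE(5)[OF U(1) v[OF x(1)] w[OF x(2)]] by simp
  qed
qed

text \<open>The function is lifted separately on \<open>V\<close> and on each tensor power; the
  lifts on tensor powers are glued on the direct sum, and the two parts are added.\<close>

lemma T2_lift:
  fixes g :: "('o \<times> 'v) list \<Rightarrow> 'w" and P :: "('k, 'w, 'n) module_scheme"
  assumes P: "module K P" and g: "word_multilinear K V P g" and lab: "label_free V g"
  obtains h where "linear_map K T P h" "\<And>ps. ps \<in> words V \<Longrightarrow> h (gen ps) = g ps"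
proof -
  interpret P: module K P by (rule P)
  have "\<exists>h. linear_map K (tensor_power K L n) P h \<and> (\<forall>ps. length ps = n \<and> snd ` set ps \<subseteq> carrier V \<longrightarrow>
      h (pure_tensor_list K L (map (letter K V) ps)) = g ps)" if "n > 0" for n
    using letter_words_lift[OF V P g that] by metis
  then obtain h where h: "\<And>n. n > 0 \<Longrightarrow> linear_map K (tensor_power K L n) P (h n)"
    and hg: "\<And>n ps. n > 0 \<Longrightarrow> length ps = n \<Longrightarrow> snd ` set ps \<subseteq> carrier V \<Longrightarrow>
      h n (pure_tensor_list K L (map (letter K V) ps)) = g ps"
    by metis
  have h2: "linear_map K (tensor_power K L n) P (h n)" if "n \<in> {2..}" for n
    using h that by simp
  obtain H where H: "linear_map K TW P H"
    and Hh: "\<And>n x. n \<in> {2..} \<Longrightarrow> x \<in> carrier (tensor_power K L n) \<Longrightarrow> H (\<zero>\<^bsub>TW\<^esub>(n := x)) = h n x"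
    using direct_sum_family_lift[of K "{2..}" "tensor_power K L" P h, OF V.R.cring_axioms mTP P h2]
    unfolding T2_words_def by blast
  \<comment> \<open>Any label serves for the summand \<open>V\<close>: by \<open>lab\<close> the
    value of \<open>g\<close> does not depend on it.\<close>
  define \<alpha> :: 'o where "\<alpha> = undefined"
  have g1: "linear_map K V P (\<lambda>u. g [(\<alpha>, u)])"
    using word_multilinearD[OF g, of "[]" "[]" \<alpha>] by simp
  show ?thesis
  proof (rule that)
    show "linear_map K T P (\<lambda>x. g [(\<alpha>, fst x)] \<oplus>\<^bsub>P\<^esub> H (snd x))"
      by (rule linear_map_add[OF module_T2 P linear_map_comp[OF lin_fst g1] linear_map_comp[OF lin_snd H]])
    fix ps :: "('o \<times> 'v) list" assume ps: "ps \<in> words V"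
    then show "g [(\<alpha>, fst (gen ps))] \<oplus>\<^bsub>P\<^esub> H (snd (gen ps)) = g ps"
    proof (cases rule: words_cases)
      case (single \<beta> u)
      have "g [(\<alpha>, u)] = g [(\<beta>, u)]" using lab single(1) unfolding label_free_def by blast
      then show ?thesis
        using single linear_map_zero[OF mTW P H] word_multilinear_closed[OF g words_single[OF single(1)]]
        by (simp add: T2_gen_single T2_incl_def)
    next
      case long
      let ?n = "length ps"
      have n: "?n \<ge> 2" "?n > 0" "snd ` set ps \<subseteq> carrier V" using long by (auto simp: long_words_def)
      have "pure_tensor_list K L (map (letter K V) ps) \<in> carrier (tensor_power K L ?n)"
        by (rule multilinear_closed[OF multilinear_pure_tensor_list[OF mL] letters_in_tuples[OF V n(3)] n(2)])
      then have "H (snd (gen ps)) = g ps"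
        using Hh[of ?n] n(1) hg[OF n(2) refl n(3)] by (simp add: T2_gen_long[OF long] T2_word_def)
      then show ?thesis
        using linear_map_zero[OF V P g1] word_multilinear_closed[OF g ps]
        by (simp add: T2_gen_long[OF long] T2_word_def)
    qed
  qed
qed

lemma T2_linear_eqI:
  assumes "module K P" "linear_map K T P f" "linear_map K T P g"
    and "\<And>ps. ps \<in> words V \<Longrightarrow> f (gen ps) = g (gen ps)" and "x \<in> carrier T"
  shows "f x = g x"
proof (rule linear_map_eqI[OF module_T2 assms(1) generates_T2 assms(2,3) _ assms(5)])
  fix s assume "s \<in> gen ` words V"
  then show "f s = g s" using assms(4) by blast
qed

text \<open>Two successive applications of \<open>T2_lift\<close>: for a fixed left word in the
  right argument, then for a fixed right argument in the left word.\<close>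

lemma T2_bilinear_lift:
  fixes B :: "('o \<times> 'v) list \<Rightarrow> ('o \<times> 'v) list \<Rightarrow> ('k, 'o, 'v) T2_elem"
  assumes l: "\<And>qs. qs \<in> words V \<Longrightarrow> word_multilinear K V T (\<lambda>ps. B ps qs)"
    "\<And>qs. qs \<in> words V \<Longrightarrow> label_free V (\<lambda>ps. B ps qs)"
    and r: "\<And>ps. ps \<in> words V \<Longrightarrow> word_multilinear K V T (B ps)"
    "\<And>ps. ps \<in> words V \<Longrightarrow> label_free V (B ps)"
  obtains p where "bilinear_product K T p"
    "\<And>ps qs. ps \<in> words V \<Longrightarrow> qs \<in> words V \<Longrightarrow> p (gen ps) (gen qs) = B ps qs"
proof -
  have "\<exists>h. linear_map K T T h \<and> (\<forall>qs\<in>words V. h (gen qs) = B ps qs)" if "ps \<in> words V" for ps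
    using T2_lift[OF module_T2 r[OF that]] by metis
  then obtain R where R: "\<And>ps. ps \<in> words V \<Longrightarrow> linear_map K T T (R ps)"
    and RB: "\<And>ps qs. ps \<in> words V \<Longrightarrow> qs \<in> words V \<Longrightarrow> R ps (gen qs) = B ps qs"
    by metis
  have w: "as @ (\<alpha>, u) # bs \<in> words V"
    if "snd ` set as \<subseteq> carrier V" "snd ` set bs \<subseteq> carrier V" "u \<in> carrier V"
    for as bs :: "('o \<times> 'v) list" and \<alpha> u
    using that by (auto simp: words_def)
  \<comment> \<open>For the second lift, multilinearity in the left word is needed at every
    \<open>y\<close>, but \<open>B\<close> gives it only at words. Both sides of each identity are
    linear in \<open>y\<close>, so words suffice.\<close>
  have Rm: "word_multilinear K V T (\<lambda>ps. R ps y)" if y: "y \<in> carrier T" for y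
  proof (rule word_multilinearI, rule linear_mapI)
    fix as bs :: "('o \<times> 'v) list" and \<alpha>
    assume ab: "snd ` set as \<subseteq> carrier V" "snd ` set bs \<subseteq> carrier V"
    let ?w = "\<lambda>u. as @ (\<alpha>, u) # bs"
    note Bl = linear_mapD[OF word_multilinearD[OF l(1) ab]]
    fix u assume u: "u \<in> carrier V"
    show "R (?w u) y \<in> carrier T" using linear_mapD(1)[OF R[OF w[OF ab u]] y] .
    {
      fix v assume v: "v \<in> carrier V"
      have uv: "u \<oplus>\<^bsub>V\<^esub> v \<in> carrier V" using u v by simp
      show "R (?w (u \<oplus>\<^bsub>V\<^esub> v)) y = R (?w u) y \<oplus>\<^bsub>T\<^esub> R (?w v) y"
      proof (rule T2_linear_eqI[OF module_T2 R[OF w[OF ab uv]] _ _ y])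
        show "linear_map K T T (\<lambda>y. R (?w u) y \<oplus>\<^bsub>T\<^esub> R (?w v) y)"
          by (rule linear_map_add[OF module_T2 module_T2 R[OF w[OF ab u]] R[OF w[OF ab v]]])
        fix qs :: "('o \<times> 'v) list" assume qs: "qs \<in> words V"
        show "R (?w (u \<oplus>\<^bsub>V\<^esub> v)) (gen qs) = R (?w u) (gen qs) \<oplus>\<^bsub>T\<^esub> R (?w v) (gen qs)"
          using Bl(2)[OF qs u v] by (simp add: RB w ab u v qs)
      qed
    }
    fix a assume a: "a \<in> carrier K"
    have au: "a \<odot>\<^bsub>V\<^esub> u \<in> carrier V" using a u by simp
    show "R (?w (a \<odot>\<^bsub>V\<^esub> u)) y = a \<odot>\<^bsub>T\<^esub> R (?w u) y"
    proof (rule T2_linear_eqI[OF module_T2 R[OF w[OF ab au]] _ _ y])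
      show "linear_map K T T (\<lambda>y. a \<odot>\<^bsub>T\<^esub> R (?w u) y)"
        by (rule linear_map_smult[OF module_T2 module_T2 R[OF w[OF ab u]] a])
      fix qs :: "('o \<times> 'v) list" assume qs: "qs \<in> words V"
      show "R (?w (a \<odot>\<^bsub>V\<^esub> u)) (gen qs) = a \<odot>\<^bsub>T\<^esub> R (?w u) (gen qs)"
        using Bl(3)[OF qs a u] by (simp add: RB w ab a u qs)
    qed
  qed
  have Rl: "label_free V (\<lambda>ps. R ps y)" if y: "y \<in> carrier T" for y
    unfolding label_free_def
  proof (intro allI ballI)
    fix \<alpha> \<beta> :: 'o and u assume u: "u \<in> carrier V"
    show "R [(\<alpha>, u)] y = R [(\<beta>, u)] y"
    proof (rule T2_linear_eqI[OF module_T2 R[OF words_single[OF u]] R[OF words_single[OF u]] _ y])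
      fix qs :: "('o \<times> 'v) list" assume qs: "qs \<in> words V"
      show "R [(\<alpha>, u)] (gen qs) = R [(\<beta>, u)] (gen qs)"
        using l(2)[OF qs] u unfolding label_free_def
        by (simp add: RB words_single qs)
    qed
  qed
  have "\<exists>h. linear_map K T T h \<and> (\<forall>ps\<in>words V. h (gen ps) = R ps y)" if "y \<in> carrier T" for y
    using T2_lift[OF module_T2 Rm[OF that] Rl[OF that]] by metis
  then obtain k where k: "\<And>y. y \<in> carrier T \<Longrightarrow> linear_map K T T (k y)"
    and kR: "\<And>y ps. y \<in> carrier T \<Longrightarrow> ps \<in> words V \<Longrightarrow> k y (gen ps) = R ps y"
    by metis
  \<comment> \<open>\<open>k\<close> takes the right argument first, because the second lift was
    made for a fixed right argument.\<close>
  show ?thesis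
  proof (rule that[of "\<lambda>x y. k y x"])
    show "k (gen qs) (gen ps) = B ps qs" if "ps \<in> words V" "qs \<in> words V" for ps qs
      using that by (simp add: kR RB T2_gen_closed)
    show "bilinear_product K T (\<lambda>x y. k y x)"
      unfolding bilinear_product_def
    proof (intro conjI ballI)
      show "linear_map K T T (\<lambda>x. k y x)" if "y \<in> carrier T" for y using k[OF that] .
      fix x assume x: "x \<in> carrier T"
      show "linear_map K T T (\<lambda>y. k y x)"
      proof (rule linear_mapI)
        fix y assume y: "y \<in> carrier T"
        show "k y x \<in> carrier T" by (rule linear_mapD(1)[OF k[OF y] x])
        {
          fix z assume z: "z \<in> carrier T"
          show "k (y \<oplus>\<^bsub>T\<^esub> z) x = k y x \<oplus>\<^bsub>T\<^esub> k z x"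
            by (rule T2_linear_eqI[OF module_T2 k linear_map_add[OF module_T2 module_T2 k k] _ x])
               (use y z linear_mapD(2)[OF R y z] in \<open>simp_all add: kR\<close>)
        }
        fix a assume a: "a \<in> carrier K"
        show "k (a \<odot>\<^bsub>T\<^esub> y) x = a \<odot>\<^bsub>T\<^esub> k y x"
          by (rule T2_linear_eqI[OF module_T2 k linear_map_smult[OF module_T2 module_T2 k a] _ x])
             (use y a linear_mapD(3)[OF R a y] in \<open>simp_all add: kR\<close>)
      qed
    qed
  qed
qed

subsection \<open>The products\<close>

text \<open>For a one-letter factor, \<open>relabel\<close> makes the arrow equal to the index, so
  its condition holds automatically. This reproduces the absence of a Kronecker symbol for factors
  from \<open>V\<close>.\<close>

definition word_prod ::
    "'o \<Rightarrow> 'o \<Rightarrow> ('o \<times> 'v) list \<Rightarrow> ('o \<times> 'v) list \<Rightarrow> ('k, 'o, 'v) T2_elem" where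
  "word_prod \<alpha> \<beta> ps qs =
     (if \<alpha> = word_arrow ar (relabel \<alpha> ps) \<and> \<beta> = word_arrow ar (relabel \<beta> qs)
      then T2_gen K V (relabel \<alpha> ps @ relabel \<beta> qs) else \<zero>\<^bsub>T2 K V\<^esub>)"

lemma label_free_word_prod: "label_free V (\<lambda>ps. word_prod \<alpha> \<beta> ps qs)" "label_free V (word_prod \<alpha> \<beta> ps)"
  by (auto simp: label_free_def word_prod_def relabel_def)

text \<open>When one vector varies, the condition in \<open>word_prod\<close> is constant, so the
  function is either the zero map or a slot of \<open>T2_gen\<close> in the concatenated
  word.\<close>

lemma word_multilinear_word_prod_left:
  assumes "qs \<in> words V"
  shows "word_multilinear K V T (\<lambda>ps. word_prod \<alpha> \<beta> ps qs)"
proof (rule word_multilinearI)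
  fix as bs :: "('o \<times> 'v) list" and \<gamma>
  assume ab: "snd ` set as \<subseteq> carrier V" "snd ` set bs \<subseteq> carrier V"
  obtain \<gamma>' where r: "\<And>u. relabel \<alpha> (as @ (\<gamma>, u) # bs) = as @ (\<gamma>', u) # bs"
    using relabel_letter by metis
  obtain \<epsilon> where e: "\<And>u. word_arrow ar (as @ (\<gamma>', u) # bs) = \<epsilon>"
    using word_arrow_letter by metis
  have "snd ` set (bs @ relabel \<beta> qs) \<subseteq> carrier V"
    using ab(2) relabel_words[OF assms, of \<beta>] by (auto simp: words_def)
  from word_multilinearD[OF word_multilinear_T2_gen ab(1) this, of \<gamma>']
  show "linear_map K V T (\<lambda>u. word_prod \<alpha> \<beta> (as @ (\<gamma>, u) # bs) qs)"
    unfolding word_prod_def r e append_assoc append_Cons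
    by (intro linear_map_if linear_map_zero_map[OF V module_T2])
qed

lemma word_multilinear_word_prod_right:
  assumes "ps \<in> words V"
  shows "word_multilinear K V T (word_prod \<alpha> \<beta> ps)"
proof (rule word_multilinearI)
  fix as bs :: "('o \<times> 'v) list" and \<gamma>
  assume ab: "snd ` set as \<subseteq> carrier V" "snd ` set bs \<subseteq> carrier V"
  obtain \<gamma>' where r: "\<And>u. relabel \<beta> (as @ (\<gamma>, u) # bs) = as @ (\<gamma>', u) # bs"
    using relabel_letter by metis
  obtain \<epsilon> where e: "\<And>u. word_arrow ar (as @ (\<gamma>', u) # bs) = \<epsilon>"
    using word_arrow_letter by metis
  have "snd ` set (relabel \<alpha> ps @ as) \<subseteq> carrier V"
    using ab(1) relabel_words[OF assms, of \<alpha>] by (auto simp: words_def)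
  from word_multilinearD[OF word_multilinear_T2_gen this ab(2), of \<gamma>']
  show "linear_map K V T (\<lambda>u. word_prod \<alpha> \<beta> ps (as @ (\<gamma>, u) # bs))"
    unfolding word_prod_def r e append_assoc append_Cons
    by (intro linear_map_if linear_map_zero_map[OF V module_T2])
qed

lemma kronecker_smult: "x \<in> carrier T \<Longrightarrow> kronecker K \<alpha> \<beta> \<odot>\<^bsub>T\<^esub> x = (if \<alpha> = \<beta> then x else \<zero>\<^bsub>T\<^esub>)"
  by (simp add: kronecker_def)

lemma kronecker_mult_smult:
  "x \<in> carrier T \<Longrightarrow> (kronecker K \<alpha> \<beta> \<otimes>\<^bsub>K\<^esub> kronecker K \<gamma> \<delta>) \<odot>\<^bsub>T\<^esub> x =
     (if \<alpha> = \<beta> \<and> \<gamma> = \<delta> then x else \<zero>\<^bsub>T\<^esub>)"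
  by (simp add: kronecker_def)

text \<open>The four clauses of \<open>T2_products\<close> are the cases in which each factor has
  one letter or at least two. Afterwards only \<open>word_prod\<close> is used.\<close>

lemma T2_products_iff:
  "T2_products K ar V p \<longleftrightarrow>
     (\<forall>\<alpha> \<beta>. bilinear_product K T (p \<alpha> \<beta>)) \<and>
     (\<forall>\<alpha> \<beta>. \<forall>ps\<in>words V. \<forall>qs\<in>words V. p \<alpha> \<beta> (gen ps) (gen qs) = word_prod \<alpha> \<beta> ps qs)"
proof -
  have w: "T2_word K V (ps @ qs) = gen (ps @ qs)" "gen (ps @ qs) \<in> carrier T"
    if "ps \<in> words V" "qs \<in> words V" for ps qs :: "('o \<times> 'v) list"
    using words_append[OF that] T2_gen_long T2_gen_closed long_words_words by metis+
  have ss: "word_prod \<alpha> \<beta> [(\<gamma>, u)] [(\<delta>, v)] = T2_word K V [(\<alpha>, u), (\<beta>, v)]"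
    if "u \<in> carrier V" "v \<in> carrier V" for \<alpha> \<beta> \<gamma> \<delta> u v
    using w(1)[OF words_single[OF that(1)] words_single[OF that(2)], of \<alpha> \<beta>]
    by (simp add: word_prod_def relabel_def word_arrow_single)
  have ls: "word_prod \<alpha> \<beta> ps [(\<delta>, v)] =
      kronecker K \<alpha> (word_arrow ar ps) \<odot>\<^bsub>T\<^esub> T2_word K V (ps @ [(\<beta>, v)])"
    if ps: "ps \<in> long_words V" and v: "v \<in> carrier V" for \<alpha> \<beta> \<delta> ps v
    using w[OF long_words_words[OF ps] words_single[OF v], of \<beta>] relabel_long[OF ps]
    by (simp add: word_prod_def kronecker_smult word_arrow_single) (simp add: relabel_def word_arrow_single)
  have sl: "word_prod \<alpha> \<beta> [(\<gamma>, u)] qs =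
      kronecker K \<beta> (word_arrow ar qs) \<odot>\<^bsub>T\<^esub> T2_word K V ((\<alpha>, u) # qs)"
    if u: "u \<in> carrier V" and qs: "qs \<in> long_words V" for \<alpha> \<beta> \<gamma> u qs
    using w[OF words_single[OF u] long_words_words[OF qs], of \<alpha>] relabel_long[OF qs]
    by (simp add: word_prod_def kronecker_smult word_arrow_single) (simp add: relabel_def word_arrow_single)
  have ll: "word_prod \<alpha> \<beta> ps qs =
      (kronecker K \<alpha> (word_arrow ar ps) \<otimes>\<^bsub>K\<^esub> kronecker K \<beta> (word_arrow ar qs)) \<odot>\<^bsub>T\<^esub> T2_word K V (ps @ qs)"
    if ps: "ps \<in> long_words V" and qs: "qs \<in> long_words V" for \<alpha> \<beta> ps qs
    using w[OF long_words_words[OF ps] long_words_words[OF qs]] relabel_long[OF ps] relabel_long[OF qs]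
    by (simp add: word_prod_def kronecker_mult_smult)
  show ?thesis
  proof
    assume p: "T2_products K ar V p"
    have "p \<alpha> \<beta> (gen ps) (gen qs) = word_prod \<alpha> \<beta> ps qs"
      if ps: "ps \<in> words V" and qs: "qs \<in> words V" for \<alpha> \<beta> ps qs
      using ps
    proof (cases rule: words_cases)
      case (single \<gamma> u)
      note ps = single
      show ?thesis using qs
      proof (cases rule: words_cases)
        case (single \<delta> v)
        then show ?thesis using p ps by (simp add: T2_products_def T2_gen_single ss)
      next
        case long
        then show ?thesis using p ps by (simp add: T2_products_def T2_gen_single T2_gen_long sl)
      qed
    next
      case long
      note ps = long
      show ?thesis using qs
      proof (cases rule: words_cases)
        case (single \<delta> v)
        then show ?thesis using p ps by (simp add: T2_products_def T2_gen_single T2_gen_long ls)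
      next
        case long
        then show ?thesis using p ps by (simp add: T2_products_def T2_gen_long ll)
      qed
    qed
    then show "(\<forall>\<alpha> \<beta>. bilinear_product K T (p \<alpha> \<beta>)) \<and>
      (\<forall>\<alpha> \<beta>. \<forall>ps\<in>words V. \<forall>qs\<in>words V. p \<alpha> \<beta> (gen ps) (gen qs) = word_prod \<alpha> \<beta> ps qs)"
      using p by (simp add: T2_products_def)
  next
    assume "(\<forall>\<alpha> \<beta>. bilinear_product K T (p \<alpha> \<beta>)) \<and>
      (\<forall>\<alpha> \<beta>. \<forall>ps\<in>words V. \<forall>qs\<in>words V. p \<alpha> \<beta> (gen ps) (gen qs) = word_prod \<alpha> \<beta> ps qs)"
    then have b: "\<And>\<alpha> \<beta>. bilinear_product K T (p \<alpha> \<beta>)"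
      and p: "\<And>\<alpha> \<beta> ps qs. ps \<in> words V \<Longrightarrow> qs \<in> words V \<Longrightarrow>
        p \<alpha> \<beta> (gen ps) (gen qs) = word_prod \<alpha> \<beta> ps qs"
      by blast+
    \<comment> \<open>The label is a placeholder, since \<open>T2_gen\<close> drops it.\<close>
    have inc: "T2_incl K V u = gen [(undefined, u)]" for u by (simp add: T2_gen_single)
    show "T2_products K ar V p"
      unfolding T2_products_def inc
      by (intro conjI allI ballI b)
         (simp_all add: p words_single long_words_words ss sl ls ll T2_gen_long[symmetric]
           del: T2_gen_long)
  qed
qed

text \<open>Words are inserted one argument at a time: first \<open>x\<close> is reduced to a word
  with \<open>y\<close> arbitrary, then \<open>y\<close>.\<close>

lemma bilinear_T2_eqI:
  assumes P: "module K P"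
    and f: "\<And>x. x \<in> carrier T \<Longrightarrow> linear_map K T P (f x)" "\<And>y. y \<in> carrier T \<Longrightarrow> linear_map K T P (\<lambda>x. f x y)"
    and g: "\<And>x. x \<in> carrier T \<Longrightarrow> linear_map K T P (g x)" "\<And>y. y \<in> carrier T \<Longrightarrow> linear_map K T P (\<lambda>x. g x y)"
    and eq: "\<And>ps qs. ps \<in> words V \<Longrightarrow> qs \<in> words V \<Longrightarrow> f (gen ps) (gen qs) = g (gen ps) (gen qs)"
    and x: "x \<in> carrier T" and y: "y \<in> carrier T"
  shows "f x y = g x y"
proof (rule T2_linear_eqI[OF P f(2)[OF y] g(2)[OF y] _ x])
  fix ps :: "('o \<times> 'v) list" assume ps: "ps \<in> words V"
  show "f (gen ps) y = g (gen ps) y"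
    by (rule T2_linear_eqI[OF P f(1) g(1) _ y]) (use ps eq T2_gen_closed in auto)
qed

lemma T2_products_exist: "\<exists>p. T2_products K ar V p"
proof -
  have "\<exists>p. bilinear_product K T p \<and>
    (\<forall>ps\<in>words V. \<forall>qs\<in>words V. p (gen ps) (gen qs) = word_prod \<alpha> \<beta> ps qs)" for \<alpha> \<beta>
    using T2_bilinear_lift[of "word_prod \<alpha> \<beta>", OF word_multilinear_word_prod_left
        label_free_word_prod(1) word_multilinear_word_prod_right label_free_word_prod(2)]
    by metis
  then obtain p where "\<And>\<alpha> \<beta>. bilinear_product K T (p \<alpha> \<beta>) \<and>
    (\<forall>ps\<in>words V. \<forall>qs\<in>words V. p \<alpha> \<beta> (gen ps) (gen qs) = word_prod \<alpha> \<beta> ps qs)"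
    by metis
  then show ?thesis unfolding T2_products_iff by blast
qed

lemma bilinear_productD:
  assumes "bilinear_product K T p"
  shows "x \<in> carrier T \<Longrightarrow> linear_map K T T (p x)" "y \<in> carrier T \<Longrightarrow> linear_map K T T (\<lambda>x. p x y)"
  using assms by (auto simp: bilinear_product_def)

lemma T2_products_unique:
  assumes "T2_products K ar V p" "T2_products K ar V p'" "x \<in> carrier T" "y \<in> carrier T"
  shows "p' \<alpha> \<beta> x y = p \<alpha> \<beta> x y"
proof -
  have b: "bilinear_product K T (p \<alpha> \<beta>)" "bilinear_product K T (p' \<alpha> \<beta>)"
    using assms(1,2) unfolding T2_products_iff by blast+
  show ?thesis
    by (rule bilinear_T2_eqI[OF module_T2 bilinear_productD[OF b(2)] bilinear_productD[OF b(1)] _ assms(3,4)])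
       (use assms(1,2)[unfolded T2_products_iff] in simp_all)
qed

section \<open>The dual algebra axioms for the products\<close>

context
  fixes p :: "'o \<Rightarrow> 'o \<Rightarrow> ('k, 'o, 'v) T2_elem \<Rightarrow> ('k, 'o, 'v) T2_elem \<Rightarrow> ('k, 'o, 'v) T2_elem"
  assumes ar: "semigroup ar" and p: "T2_products K ar V p"
begin

private lemma bil: "bilinear_product K T (p \<alpha> \<beta>)"
  using p unfolding T2_products_iff by blast

private lemma p_gen: "ps \<in> words V \<Longrightarrow> qs \<in> words V \<Longrightarrow> p \<alpha> \<beta> (gen ps) (gen qs) = word_prod \<alpha> \<beta> ps qs"
  using p unfolding T2_products_iff by blast

private lemmas p_lin = linear_mapD[OF bilinear_productD(1)[OF bil]] linear_mapD[OF bilinear_productD(2)[OF bil]]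

private lemma p_zero: "x \<in> carrier T \<Longrightarrow> p \<alpha> \<beta> x \<zero>\<^bsub>T\<^esub> = \<zero>\<^bsub>T\<^esub>" "x \<in> carrier T \<Longrightarrow> p \<alpha> \<beta> \<zero>\<^bsub>T\<^esub> x = \<zero>\<^bsub>T\<^esub>"
  using linear_map_zero[OF module_T2 module_T2 bilinear_productD(1)[OF bil]]
    linear_map_zero[OF module_T2 module_T2 bilinear_productD(2)[OF bil]] by auto

text \<open>A nonzero inner product is a word with at least two letters, which relabelling leaves
  alone, and its arrow is \<open>ar \<alpha> \<beta>\<close>. This forces the outer index
  \<open>\<gamma>\<close>.\<close>

lemma T2_prod_prod_left:
  assumes "ps \<in> words V" "qs \<in> words V" "rs \<in> words V"
  shows "p \<gamma> \<delta> (p \<alpha> \<beta> (gen ps) (gen qs)) (gen rs) =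
    (if \<alpha> = word_arrow ar (relabel \<alpha> ps) \<and> \<beta> = word_arrow ar (relabel \<beta> qs) \<and>
        \<gamma> = ar \<alpha> \<beta> \<and> \<delta> = word_arrow ar (relabel \<delta> rs)
     then gen (relabel \<alpha> ps @ relabel \<beta> qs @ relabel \<delta> rs) else \<zero>\<^bsub>T\<^esub>)"
proof (cases "\<alpha> = word_arrow ar (relabel \<alpha> ps) \<and> \<beta> = word_arrow ar (relabel \<beta> qs)")
  case True
  let ?P = "relabel \<alpha> ps" and ?Q = "relabel \<beta> qs"
  have w: "?P \<in> words V" "?Q \<in> words V" by (rule relabel_words, fact)+
  then have ne: "?P \<noteq> []" "?Q \<noteq> []" by (auto simp: words_def)
  have "word_arrow ar (?P @ ?Q) = ar \<alpha> \<beta>" using word_arrow_append[OF ar ne] True by simp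
  then show ?thesis
    using p_gen[OF assms(1,2)] p_gen[OF long_words_words[OF words_append[OF w]] assms(3)] True
    by (simp add: word_prod_def relabel_append[OF ne])
next
  case False
  then have "p \<alpha> \<beta> (gen ps) (gen qs) = \<zero>\<^bsub>T\<^esub>"
    using p_gen[OF assms(1,2)] by (auto simp: word_prod_def)
  then show ?thesis using False p_zero T2_gen_closed[OF assms(3)] by auto
qed

text \<open>Mirror image of the previous computation. For the indices in the associativity relation,
  both bracketings give the same conditions and the same concatenation; for mismatched indices the
  condition fails, which gives the vanishing relations.\<close>

lemma T2_prod_prod_right:
  assumes "ps \<in> words V" "qs \<in> words V" "rs \<in> words V"
  shows "p \<alpha> \<beta> (gen ps) (p \<gamma> \<delta> (gen qs) (gen rs)) =
    (if \<alpha> = word_arrow ar (relabel \<alpha> ps) \<and> \<gamma> = word_arrow ar (relabel \<gamma> qs) \<and>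
        \<beta> = ar \<gamma> \<delta> \<and> \<delta> = word_arrow ar (relabel \<delta> rs)
     then gen (relabel \<alpha> ps @ relabel \<gamma> qs @ relabel \<delta> rs) else \<zero>\<^bsub>T\<^esub>)"
proof (cases "\<gamma> = word_arrow ar (relabel \<gamma> qs) \<and> \<delta> = word_arrow ar (relabel \<delta> rs)")
  case True
  let ?P = "relabel \<gamma> qs" and ?Q = "relabel \<delta> rs"
  have w: "?P \<in> words V" "?Q \<in> words V" by (rule relabel_words, fact)+
  then have ne: "?P \<noteq> []" "?Q \<noteq> []" by (auto simp: words_def)
  have "word_arrow ar (?P @ ?Q) = ar \<gamma> \<delta>" using word_arrow_append[OF ar ne] True by simp
  then show ?thesis
    using p_gen[OF assms(2,3)] p_gen[OF assms(1) long_words_words[OF words_append[OF w]]] True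
    by (simp add: word_prod_def relabel_append[OF ne])
next
  case False
  then have "p \<gamma> \<delta> (gen qs) (gen rs) = \<zero>\<^bsub>T\<^esub>"
    using p_gen[OF assms(2,3)] by (auto simp: word_prod_def)
  then show ?thesis using False p_zero T2_gen_closed[OF assms(1)] by auto
qed

text \<open>Both sides of each defining identity are trilinear, hence determined on words.\<close>
lemma T2_trilinear_eqI:
  assumes eq: "\<And>ps qs rs. ps \<in> words V \<Longrightarrow> qs \<in> words V \<Longrightarrow> rs \<in> words V \<Longrightarrow>
      f (gen ps) (gen qs) (gen rs) = g (gen ps) (gen qs) (gen rs)"
    and f: "\<And>x y. x \<in> carrier T \<Longrightarrow> y \<in> carrier T \<Longrightarrow> linear_map K T T (f x y)"
      "\<And>x y. x \<in> carrier T \<Longrightarrow> y \<in> carrier T \<Longrightarrow> linear_map K T T (\<lambda>z. f x z y)"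
      "\<And>x y. x \<in> carrier T \<Longrightarrow> y \<in> carrier T \<Longrightarrow> linear_map K T T (\<lambda>z. f z x y)"
    and g: "\<And>x y. x \<in> carrier T \<Longrightarrow> y \<in> carrier T \<Longrightarrow> linear_map K T T (g x y)"
      "\<And>x y. x \<in> carrier T \<Longrightarrow> y \<in> carrier T \<Longrightarrow> linear_map K T T (\<lambda>z. g x z y)"
      "\<And>x y. x \<in> carrier T \<Longrightarrow> y \<in> carrier T \<Longrightarrow> linear_map K T T (\<lambda>z. g z x y)"
    and "x \<in> carrier T" "y \<in> carrier T" "z \<in> carrier T"
  shows "f x y z = g x y z"
proof (rule T2_linear_eqI[OF module_T2 f(3) g(3)])
  fix ps :: "('o \<times> 'v) list" assume ps: "ps \<in> words V"
  note gp = T2_gen_closed[OF ps]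
  show "f (gen ps) y z = g (gen ps) y z"
    by (rule bilinear_T2_eqI[OF module_T2 f(1,2)[OF gp] g(1,2)[OF gp]]) (use eq ps assms(8-) in auto)
qed (use assms(8-) in auto)

lemma As2_dual_algebra_T2: "As2_dual_algebra K ar T p"
proof -
  note l = bilinear_productD(1)[OF bil] and r = bilinear_productD(2)[OF bil]
  note c = p_lin(1)
  \<comment> \<open>Each bracketing is viewed as a function of its third, second and first argument
    in turn, in the order in which \<open>T2_trilinear_eqI\<close> asks for linearity.\<close>
  have L: "linear_map K T T (p \<gamma> \<delta> (p \<alpha> \<beta> x y))"
      "linear_map K T T (\<lambda>z. p \<gamma> \<delta> (p \<alpha> \<beta> x z) y)"
      "linear_map K T T (\<lambda>z. p \<gamma> \<delta> (p \<alpha> \<beta> z x) y)"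
    and R: "linear_map K T T (\<lambda>z. p \<gamma> \<delta> x (p \<alpha> \<beta> y z))"
      "linear_map K T T (\<lambda>z. p \<gamma> \<delta> x (p \<alpha> \<beta> z y))"
      "linear_map K T T (\<lambda>z. p \<gamma> \<delta> z (p \<alpha> \<beta> x y))"
    if "x \<in> carrier T" "y \<in> carrier T" for \<alpha> \<beta> \<gamma> \<delta> x y
    by (rule l[OF c[OF that]], rule linear_map_comp[OF l[OF that(1)] r[OF that(2)]],
        rule linear_map_comp[OF r[OF that(1)] r[OF that(2)]],
        rule linear_map_comp[OF l[OF that(2)] l[OF that(1)]],
        rule linear_map_comp[OF r[OF that(2)] l[OF that(1)]], rule r[OF c[OF that]])
  note Z = linear_map_zero_map[OF module_T2 module_T2]
  have assoc: "ar (ar \<alpha> \<beta>) \<gamma> = ar \<alpha> (ar \<beta> \<gamma>)" for \<alpha> \<beta> \<gamma>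
    by (rule semigroup.assoc[OF ar])
  show ?thesis
    unfolding As2_dual_algebra_def
  proof (intro conjI allI ballI impI bil module_T2)
    fix \<alpha> \<beta> \<gamma> x y z assume xyz: "x \<in> carrier T" "y \<in> carrier T" "z \<in> carrier T"
    show "p (ar \<alpha> \<beta>) \<gamma> (p \<alpha> \<beta> x y) z = p \<alpha> (ar \<beta> \<gamma>) x (p \<beta> \<gamma> y z)"
      by (rule T2_trilinear_eqI[of "\<lambda>x y z. p (ar \<alpha> \<beta>) \<gamma> (p \<alpha> \<beta> x y) z"
            "\<lambda>x y z. p \<alpha> (ar \<beta> \<gamma>) x (p \<beta> \<gamma> y z)", OF _ L R xyz])
         (simp_all add: T2_prod_prod_left T2_prod_prod_right)
  next
    fix \<alpha> \<beta> \<gamma> \<delta> x y z assume xyz: "x \<in> carrier T" "y \<in> carrier T" "z \<in> carrier T" and "ar \<alpha> \<beta> \<noteq> \<gamma>"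
    \<comment> \<open>The vanishing relation is an equality with the constant zero function, which
      is linear in each argument.\<close>
    then show "p \<gamma> \<delta> (p \<alpha> \<beta> x y) z = \<zero>\<^bsub>T\<^esub>"
      by (intro T2_trilinear_eqI[of "\<lambda>x y z. p \<gamma> \<delta> (p \<alpha> \<beta> x y) z"
            "\<lambda>x y z. \<zero>\<^bsub>T\<^esub>", OF _ L Z Z Z xyz])
         (auto simp: T2_prod_prod_left)
  next
    fix \<alpha> \<beta> \<gamma> \<delta> x y z assume xyz: "x \<in> carrier T" "y \<in> carrier T" "z \<in> carrier T" and "\<beta> \<noteq> ar \<gamma> \<delta>"
    then show "p \<alpha> \<beta> x (p \<gamma> \<delta> y z) = \<zero>\<^bsub>T\<^esub>"
      by (intro T2_trilinear_eqI[of "\<lambda>x y z. p \<alpha> \<beta> x (p \<gamma> \<delta> y z)"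
            "\<lambda>x y z. \<zero>\<^bsub>T\<^esub>", OF _ R Z Z Z xyz])
         (auto simp: T2_prod_prod_right)
  qed
qed

end

subsection \<open>Evaluation of words in an algebra\<close>

text \<open>The right-nested product. The left index is the label of the first letter; the right
  index is the arrow of the remaining word, the only one at which a remainder with at least two
  letters does not multiply to zero. The value at the empty list is irrelevant, as words are
  nonempty.\<close>

fun eval_word :: "('o \<Rightarrow> 'o \<Rightarrow> 'w \<Rightarrow> 'w \<Rightarrow> 'w) \<Rightarrow> ('v \<Rightarrow> 'w) \<Rightarrow> ('o \<times> 'v) list \<Rightarrow> 'w" where
  "eval_word q f [] = undefined"
| "eval_word q f [p] = f (snd p)"
| "eval_word q f (p # r # rs) = q (fst p) (word_arrow ar (r # rs)) (f (snd p)) (eval_word q f (r # rs))"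

lemma eval_word_Cons:
  "ps \<noteq> [] \<Longrightarrow> eval_word q f ((\<alpha>, u) # ps) = q \<alpha> (word_arrow ar ps) (f u) (eval_word q f ps)"
  by (cases ps) simp_all

lemma eval_word_relabel: "eval_word q f (relabel \<alpha> ps) = eval_word q f ps"
  by (cases ps) (auto simp: relabel_def)

context
  fixes W :: "('k, 'w, 'n) module_scheme" and q and f
  assumes ar: "semigroup ar" and W: "As2_dual_algebra K ar W q" and f: "linear_map K V W f"
begin

private abbreviation (input) ev :: "('o \<times> 'v) list \<Rightarrow> 'w" where "ev \<equiv> eval_word q f"

private lemma mW: "module K W" using W by (simp add: As2_dual_algebra_def)

interpretation W: module K W by (rule mW)

private lemma q_lin: "x \<in> carrier W \<Longrightarrow> linear_map K W W (q \<alpha> \<beta> x)"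
    "x \<in> carrier W \<Longrightarrow> linear_map K W W (\<lambda>y. q \<alpha> \<beta> y x)"
  using W by (auto simp: As2_dual_algebra_def bilinear_product_def)

private lemma q_rel: 
  assumes "x \<in> carrier W" "y \<in> carrier W" "z \<in> carrier W"
  shows "q (ar \<alpha> \<beta>) \<gamma> (q \<alpha> \<beta> x y) z = q \<alpha> (ar \<beta> \<gamma>) x (q \<beta> \<gamma> y z)"
    "ar \<alpha> \<beta> \<noteq> \<gamma> \<Longrightarrow> q \<gamma> \<delta> (q \<alpha> \<beta> x y) z = \<zero>\<^bsub>W\<^esub>"
    "\<beta> \<noteq> ar \<gamma> \<delta> \<Longrightarrow> q \<alpha> \<beta> x (q \<gamma> \<delta> y z) = \<zero>\<^bsub>W\<^esub>"
  using W assms by (simp_all add: As2_dual_algebra_def)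

lemma eval_word_closed:
  assumes "ps \<in> words V"
  shows "ev ps \<in> carrier W"
  using assms
proof (induction ps)
  case Nil then show ?case by (simp add: words_def)
next
  case (Cons p ps)
  obtain \<alpha> u where p: "p = (\<alpha>, u)" by (cases p)
  have u: "f u \<in> carrier W" using Cons.prems p linear_mapD(1)[OF f] by (simp add: words_def)
  show ?case
  proof (cases "ps = []")
    case True
    then show ?thesis using u p by simp
  next
    case False
    then have "ev ps \<in> carrier W" using Cons by (simp add: words_def)
    then show ?thesis using linear_mapD(1)[OF q_lin(1)[OF u]] p by (simp add: eval_word_Cons[OF False])
  qed
qed

lemma word_multilinear_eval_word: "word_multilinear K V W ev"
proof (rule word_multilinearI)
  fix as bs :: "('o \<times> 'v) list" and \<alpha>
  assume "snd ` set as \<subseteq> carrier V" and bs: "snd ` set bs \<subseteq> carrier V"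
  then show "linear_map K V W (\<lambda>u. ev (as @ (\<alpha>, u) # bs))"
  proof (induction as)
    case Nil
    show ?case
    proof (cases "bs = []")
      case True
      then show ?thesis using f by simp
    next
      case False
      then have "ev bs \<in> carrier W" using bs by (intro eval_word_closed) (simp add: words_def)
      from linear_map_comp[OF f q_lin(2)[OF this]]
      show ?thesis by (simp add: eval_word_Cons[OF False])
    qed
  next
    case (Cons p as)
    obtain \<gamma> v where p: "p = (\<gamma>, v)" by (cases p)
    have v: "f v \<in> carrier W" using Cons.prems p linear_mapD(1)[OF f] by simp
    \<comment> \<open>The right index of the outermost product must not vary with \<open>u\<close>,
      or the product would not be one fixed linear map.\<close>
    obtain \<epsilon> where e: "\<And>u. word_arrow ar (as @ (\<alpha>, u) # bs) = \<epsilon>" using word_arrow_letter by metis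
    have "linear_map K V W (\<lambda>u. ev (as @ (\<alpha>, u) # bs))" using Cons by simp
    from linear_map_comp[OF this q_lin(1)[OF v, of \<gamma> \<epsilon>]]
    show ?case using p by (simp add: eval_word_Cons e)
  qed
qed

text \<open>Induction on the left word: the associativity relation moves its first letter out of the
  bracket. The relation applies since the arrow of a word is the label of its first letter followed
  by the arrow of the rest.\<close>

lemma eval_word_append:
  assumes "ps \<in> words V" "qs \<in> words V"
  shows "q (word_arrow ar ps) (word_arrow ar qs) (ev ps) (ev qs) = ev (ps @ qs)"
  using assms(1)
proof (induction ps)
  case Nil then show ?case by (simp add: words_def)
next
  case (Cons p ps)
  have qs: "qs \<noteq> []" using assms(2) by (simp add: words_def)
  obtain \<alpha> u where p: "p = (\<alpha>, u)" by (cases p)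
  have u: "f u \<in> carrier W" using Cons.prems p linear_mapD(1)[OF f] by (simp add: words_def)
  show ?case
  proof (cases "ps = []")
    case True
    then show ?thesis using p by (simp add: eval_word_Cons[OF qs] word_arrow_single)
  next
    case False
    then have ps: "ps \<in> words V" using Cons.prems by (simp add: words_def)
    have "word_arrow ar (p # ps) = ar \<alpha> (word_arrow ar ps)"
      using word_arrow_append[OF ar _ False, of "[p]"] p by (simp add: word_arrow_single)
    moreover have "word_arrow ar (ps @ qs) = ar (word_arrow ar ps) (word_arrow ar qs)"
      by (rule word_arrow_append[OF ar False qs])
    ultimately show ?thesis
      using q_rel(1)[OF u eval_word_closed[OF ps] eval_word_closed[OF assms(2)]] Cons.IH[OF ps]
      by (simp add: p eval_word_Cons[OF False] eval_word_Cons False)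
  qed
qed

text \<open>A mismatch can occur only at a factor with at least two letters. Such a factor evaluates
  to a product whose indices do not compose to the required one, so a vanishing relation of
  \<open>W\<close> applies.\<close>

lemma eval_word_prod_zero:
  assumes "ps \<in> words V" "qs \<in> words V"
    and "\<not> (\<alpha> = word_arrow ar (relabel \<alpha> ps) \<and> \<beta> = word_arrow ar (relabel \<beta> qs))"
  shows "q \<alpha> \<beta> (ev ps) (ev qs) = \<zero>\<^bsub>W\<^esub>"
proof -
  have *: "\<exists>\<gamma> \<delta> x y. x \<in> carrier W \<and> y \<in> carrier W \<and> ev rs = q \<gamma> \<delta> x y \<and> ar \<gamma> \<delta> \<noteq> \<epsilon>"
    if rs: "rs \<in> words V" and ne: "\<epsilon> \<noteq> word_arrow ar (relabel \<epsilon> rs)" for rs and \<epsilon>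
    using rs
  proof (cases rule: words_cases)
    case (single \<gamma> u)
    then show ?thesis using ne by (simp add: relabel_def word_arrow_single)
  next
    case long
    \<comment> \<open>Splitting off the first letter displays the value as a product in
      \<open>W\<close>, with the arrow of the whole word as composed index.\<close>
    then obtain \<gamma> u ss where ss: "rs = (\<gamma>, u) # ss" "ss \<noteq> []" "ss \<in> words V" "u \<in> carrier V"
      by (cases rs; cases "tl rs") (auto simp: long_words_def words_def)
    have "word_arrow ar rs = ar \<gamma> (word_arrow ar ss)"
      using word_arrow_append[OF ar _ ss(2), of "[(\<gamma>, u)]"] ss(1) by (simp add: word_arrow_single)
    then have "ar \<gamma> (word_arrow ar ss) \<noteq> \<epsilon>" using ne relabel_long[OF long] by auto
    then show ?thesis
      using ss eval_word_closed[OF ss(3)] linear_mapD(1)[OF f ss(4)] eval_word_Cons[OF ss(2)] by metis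
  qed
  show ?thesis
  proof (cases "\<alpha> = word_arrow ar (relabel \<alpha> ps)")
    case True
    then show ?thesis
      using assms(3) *[OF assms(2), of \<beta>] q_rel(3)[OF eval_word_closed[OF assms(1)]] by metis
  next
    case False
    then show ?thesis
      using *[OF assms(1), of \<alpha>] q_rel(2)[OF _ _ eval_word_closed[OF assms(2)]] by metis
  qed
qed

text \<open>Existence lifts the evaluation of words; multiplicativity follows from
  \<open>eval_word_append\<close> where the indices match and from
  \<open>eval_word_prod_zero\<close> elsewhere. Uniqueness holds since words are iterated products
  of vectors of \<open>V\<close>.\<close>

lemma T2_universal:
  assumes p: "T2_products K ar V p"
  shows "\<exists>!F. F \<in> extensional (carrier T) \<and> As2_dual_hom K T p W q F \<and>
    (\<forall>v\<in>carrier V. F (T2_incl K V v) = f v)"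
proof -
  have bil: "bilinear_product K T (p \<alpha> \<beta>)" for \<alpha> \<beta>
    using p unfolding T2_products_iff by blast
  have pg: "p \<alpha> \<beta> (gen ps) (gen qs) = word_prod \<alpha> \<beta> ps qs"
    if "ps \<in> words V" "qs \<in> words V" for \<alpha> \<beta> ps qs
    using p that unfolding T2_products_iff by blast
  have pc: "p \<alpha> \<beta> x y \<in> carrier T" if "x \<in> carrier T" "y \<in> carrier T" for \<alpha> \<beta> x y
    using linear_mapD(1)[OF bilinear_productD(1)[OF bil that(1)] that(2)] .
  have "label_free V ev" by (simp add: label_free_def)
  then obtain h where h: "linear_map K T W h" and hg: "\<And>ps. ps \<in> words V \<Longrightarrow> h (gen ps) = ev ps"
    using T2_lift[OF mW word_multilinear_eval_word] by metis
  have hom: "h (p \<alpha> \<beta> x y) = q \<alpha> \<beta> (h x) (h y)" if x: "x \<in> carrier T" and y: "y \<in> carrier T" for \<alpha> \<beta> x y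
  proof (rule bilinear_T2_eqI[where f = "\<lambda>x y. h (p \<alpha> \<beta> x y)" and g = "\<lambda>x y. q \<alpha> \<beta> (h x) (h y)",
        OF mW _ _ _ _ _ x y])
    fix x assume x: "x \<in> carrier T"
    show "linear_map K T W (\<lambda>y. h (p \<alpha> \<beta> x y))" by (rule linear_map_comp[OF bilinear_productD(1)[OF bil x] h])
    show "linear_map K T W (\<lambda>y. h (p \<alpha> \<beta> y x))" by (rule linear_map_comp[OF bilinear_productD(2)[OF bil x] h])
    show "linear_map K T W (\<lambda>y. q \<alpha> \<beta> (h x) (h y))"
      by (rule linear_map_comp[OF h q_lin(1)[OF linear_mapD(1)[OF h x]]])
    show "linear_map K T W (\<lambda>y. q \<alpha> \<beta> (h y) (h x))"
      by (rule linear_map_comp[OF h q_lin(2)[OF linear_mapD(1)[OF h x]]])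
  next
    fix ps qs :: "('o \<times> 'v) list" assume ps: "ps \<in> words V" and qs: "qs \<in> words V"
    show "h (p \<alpha> \<beta> (gen ps) (gen qs)) = q \<alpha> \<beta> (h (gen ps)) (h (gen qs))"
    proof (cases "\<alpha> = word_arrow ar (relabel \<alpha> ps) \<and> \<beta> = word_arrow ar (relabel \<beta> qs)")
      case True
      let ?P = "relabel \<alpha> ps" and ?Q = "relabel \<beta> qs"
      have w: "?P \<in> words V" "?Q \<in> words V" by (rule relabel_words, fact)+
      have "q \<alpha> \<beta> (ev ?P) (ev ?Q) = ev (?P @ ?Q)"
        using eval_word_append[OF w] True by simp
      then show ?thesis
        using True hg[OF long_words_words[OF words_append[OF w]]]
        by (simp add: pg hg ps qs word_prod_def eval_word_relabel)
    next
      case False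
      then show ?thesis
        using eval_word_prod_zero[OF ps qs False] linear_map_zero[OF module_T2 mW h]
        by (auto simp: pg hg ps qs word_prod_def)
    qed
  qed
  have inc: "T2_incl K V u \<in> carrier T" if "u \<in> carrier V" for u
    by (rule linear_mapD(1)[OF linear_map_T2_incl that])
  \<comment> \<open>Uniqueness is asked among extensional functions, so the lift is cut down to the
    carrier.\<close>
  let ?F = "restrict h (carrier T)"
  show ?thesis
  proof (rule ex1I[of _ ?F])
    have "linear_map K T W ?F"
      by (rule linear_mapI) (use linear_mapD[OF h] in auto)
    then have "As2_dual_hom K T p W q ?F"
      using hom pc by (simp add: As2_dual_hom_def)
    moreover have "?F (T2_incl K V v) = f v" if "v \<in> carrier V" for v
      using hg[OF words_single[OF that]] inc[OF that] by (simp add: T2_gen_single)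
    ultimately show "?F \<in> extensional (carrier T) \<and> As2_dual_hom K T p W q ?F \<and>
        (\<forall>v\<in>carrier V. ?F (T2_incl K V v) = f v)"
      by simp
  next
    fix F assume F: "F \<in> extensional (carrier T) \<and> As2_dual_hom K T p W q F \<and>
      (\<forall>v\<in>carrier V. F (T2_incl K V v) = f v)"
    then have Fl: "linear_map K T W F"
      and Fp: "\<And>\<alpha> \<beta> x y. x \<in> carrier T \<Longrightarrow> y \<in> carrier T \<Longrightarrow> F (p \<alpha> \<beta> x y) = q \<alpha> \<beta> (F x) (F y)"
      and Ff: "\<And>v. v \<in> carrier V \<Longrightarrow> F (T2_incl K V v) = f v"
      by (auto simp: As2_dual_hom_def)
    \<comment> \<open>A longer word is the product of its first letter with the rest, so induction
      on the length forces the value of \<open>F\<close>.\<close>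
    have Fg: "F (gen ps) = ev ps" if "ps \<in> words V" for ps
      using that
    proof (induction ps)
      case Nil then show ?case by (simp add: words_def)
    next
      case (Cons a ps)
      obtain \<alpha> u where a: "a = (\<alpha>, u)" by (cases a)
      have u: "u \<in> carrier V" using Cons.prems a by (simp add: words_def)
      show ?case
      proof (cases "ps = []")
        case True
        then show ?thesis using a Ff[OF u] by (simp add: T2_gen_single)
      next
        case False
        then have ps: "ps \<in> words V" using Cons.prems by (simp add: words_def)
        let ?\<beta> = "word_arrow ar ps"
        \<comment> \<open>The second index is chosen as the arrow of the rest, so relabelling
          changes nothing, even if the rest is a single letter.\<close>
        have rel: "relabel ?\<beta> ps = ps"
          using ps
        proof (cases rule: words_cases)
          case (single \<gamma> v)
          then show ?thesis by (simp add: relabel_def word_arrow_single)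
        next
          case long
          then show ?thesis by (rule relabel_long)
        qed
        have "word_prod \<alpha> ?\<beta> [(\<alpha>, u)] ps = gen (a # ps)"
          by (simp add: word_prod_def rel a relabel_def[of _ "[(\<alpha>, u)]"] word_arrow_single)
        then have "F (gen (a # ps)) = q \<alpha> ?\<beta> (F (gen [(\<alpha>, u)])) (F (gen ps))"
          using Fp[OF T2_gen_closed[OF words_single[OF u]] T2_gen_closed[OF ps], of \<alpha> ?\<beta> \<alpha>]
          unfolding pg[OF words_single[OF u] ps] by (simp only:)
        then show ?thesis
          using Cons.IH[OF ps] Ff[OF u] by (simp add: a T2_gen_single eval_word_Cons[OF False])
      qed
    qed
    have "F x = h x" if "x \<in> carrier T" for x
      by (rule T2_linear_eqI[OF mW Fl h _ that]) (simp add: Fg hg)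
    then show "F = ?F" using F by (auto simp: extensional_def restrict_def)
  qed
qed

end

end

section \<open>Existence and uniqueness of the products, and freeness\<close>

theorem corollary1p8:
  fixes K :: "('k, 'c) ring_scheme"
    and V :: "('k, 'v, 'm) module_scheme"
    and ar :: "'o::finite \<Rightarrow> 'o \<Rightarrow> 'o"
  assumes "field K" and "module K V" and "semigroup ar"
  shows "\<exists>p. T2_products K ar V p \<and>
             (\<forall>p'. T2_products K ar V p' \<longrightarrow>
                (\<forall>\<alpha> \<beta>. \<forall>x\<in>carrier (T2 K V). \<forall>y\<in>carrier (T2 K V). p' \<alpha> \<beta> x y = p \<alpha> \<beta> x y)) \<and>
             free_As2_dual_algebra TYPE('w) K ar V (T2 K V) p (T2_incl K V)"
proof -
  note V = assms(2) and ar = assms(3)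
  obtain p where p: "T2_products K ar V p" using T2_products_exist[OF V] by blast
  have "free_As2_dual_algebra TYPE('w) K ar V (T2 K V) p (T2_incl K V)"
    unfolding free_As2_dual_algebra_def
  proof (intro conjI allI impI)
    fix W :: "('k, 'w) module" and q f
    assume A: "As2_dual_algebra K ar W q \<and> linear_map K V W f"
    show "\<exists>!F. F \<in> extensional (carrier (T2 K V)) \<and> As2_dual_hom K (T2 K V) p W q F \<and>
        (\<forall>v\<in>carrier V. F (T2_incl K V v) = f v)"
      by (rule T2_universal[OF V ar conjunct1[OF A] conjunct2[OF A] p])
  qed (rule As2_dual_algebra_T2[OF V ar p] linear_map_T2_incl[OF V])+
  then show ?thesis
    by (intro exI[of _ p] conjI allI impI ballI p) (rule T2_products_unique[OF V p])
qed

end
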